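(* Let $\mathbb H=\mathbb H(\Phi,c)$ be a graded affine Hecke algebra and let $\mathcal D=\sum_i\widetilde\omega_i\otimes\omega^i\in\mathbb H\otimes C(V^\vee)$ be the abstract Dirac operator. Then $$\mathcal D^2=-\Omega\otimes1+\rho(\Omega_{\widetilde W})$$ as elements of $\mathbb H\otimes C(V^\vee)$.
   Context: Root system: $\Phi=(V_0,R,V_0^\vee,R^\vee)$ is a reduced real root system, not necessarily crystallographic: $V_0,V_0^\vee$ are finite-dimensional real vector spaces with a perfect bilinear pairing $(\cdot,\cdot):V_0\times V_0^\vee\to\mathbb R$; $R\subset V_0\setminus\{0\}$ and $R^\vee\subset V_0^\vee\setminus\{0\}$ are finite spanning sets with a bijection $\alpha\mapsto\alpha^\vee$, $(\alpha,\alpha^\vee)=2$; the reflections $s_\alpha(v)=v-(v,\alpha^\vee)\alpha$ and $s_\alpha(v')=v'-(\alpha,v')\alpha^\vee$ preserve $R$ and $R^\vee$; $\alpha\in R$ implies $2\alpha\notin R$. $W$ is the group generated by the $s_\alpha$, acting on both spaces. Fix positive roots $R^+$ with simple roots $\Pi$; $\beta>0$ means $\beta\in R^+$, $\beta<0$ means $-\beta\in R^+$. Fix a $W$-invariant inner product $\langle\cdot,\cdot\rangle$ on $V_0^\vee$; dual bases $\{\omega_i\},\{\omega^i\}$ of $V_0^\vee$ are bases with $\langle\omega_i,\omega^j\rangle=\delta_{ij}$, and $\langle v_1,v_2\rangle=\sum_i(v_1,\omega_i)(v_2,\omega^i)$ is the dual inner product on $V_0$. Put $|v|=\langle v,v\rangle^{1/2}$,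 $V=V_0\otimes_{\mathbb R}\mathbb C$, $V^\vee=V_0^\vee\otimes_{\mathbb R}\mathbb C$; forms are extended complex bilinearly. Hecke algebra: fix a $W$-invariant function $c:R\to\mathbb R$, $c_\alpha=c(\alpha)$. $\mathbb H(\Phi,c)$ is the unital associative complex algebra generated by $t_w$ ($w\in W$) and $S(V^\vee)$, such that $w\mapsto t_w$ and the inclusion of $S(V^\vee)$ are injective algebra maps from $\mathbb C[W]$ and $S(V^\vee)$, with relations $\omega t_{s_\alpha}-t_{s_\alpha}s_\alpha(\omega)=c_\alpha(\alpha,\omega)$ for $\alpha\in\Pi$, $\omega\in V^\vee$; as a vector space $\mathbb H\simeq\mathbb C[W]\otimes S(V^\vee)$. Put $\Omega=\sum_i\omega_i\omega^i\in\mathbb H$ and $\widetilde\omega=\omega-\frac12\sum_{\beta>0}c_\beta(\beta,\omega)t_{s_\beta}\in\mathbb H$ for $\omega\in V^\vee$. $\mathcal D$ and $\Omega$ are independent of the choice of dual bases. Clifford algebra and $\widetilde W$: $C(V^\vee)$ is the complex algebra generated by $V^\vee$ with relations $\omega\omega'+\omega'\omega=-2\langle\omega,\omega'\rangle$. Let $\epsilon$ be its automorphism with $\epsilon(\omega)=-\omega$ and ${}^t$ its antiautomorphism with $\omega^t=-\omega$ ($\omega\in V^\vee$). $\mathrm{Pin}(V^\vee)=\{a:\epsilon(a)V^\vee a^{-1}\subset V^\vee,\ a^t=a^{-1}\}$, $p:\mathrm{Pin}(V^\vee)\to O(V^\vee)$, $p(a)(\omega)=\epsilon(a)\omega a^{-1}$,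 with kernel $\{\pm1\}$. $\widetilde W=p^{-1}(W)$, generated by $f_\alpha=\alpha^\vee/|\alpha^\vee|$, $\alpha\in R$; $p(f_\alpha)=s_\alpha$, $f_\alpha^2=-1$. $\rho:\mathbb C[\widetilde W]\to\mathbb H\otimes C(V^\vee)$ is the linear extension of $\rho(\widetilde w)=t_{p(\widetilde w)}\otimes\widetilde w$, and $$\Omega_{\widetilde W}=-\frac14\sum_{\alpha>0,\ \beta>0,\ s_\alpha(\beta)<0}c_\alpha c_\beta|\alpha||\beta|f_\alpha f_\beta\in\mathbb C[\widetilde W]$$ (products of group elements in $\widetilde W$; terms with $\alpha=\beta$ are included).
   Formalization: "Reduced" is taken to mean that the only real multiples of a root α that are roots are ±α, instead of only 2α∉R; with the weaker condition the identity fails, e.g. for R={±1,±3} in rank one with generic c. *)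

theory Defs
  imports Complex_Main "HOL-Library.Product_Plus" "HOL-Library.Poly_Mapping"
    "HOL-Algebra.Module" "HOL-Algebra.QuotRing" "HOL-Algebra.Bij" "HOL-Algebra.Generated_Groups"
begin

section \<open>Complex algebras by generators and relations\<close>

text \<open>
  Complex algebras are \<^type>\<open>module\<close> records: the ring fields together with the scalar
  multiplication by complex numbers.
\<close>

text \<open>The monoid algebra of \<open>G\<close>: finitely supported functions on \<open>carrier G\<close> under convolution.\<close>

definition monoid_algebra :: "('g, 'm) monoid_scheme \<Rightarrow> (complex, 'g \<Rightarrow>\<^sub>0 complex) module" where
  "monoid_algebra G =
    \<lparr>carrier = {f. Poly_Mapping.keys f \<subseteq> carrier G},
     mult = (\<lambda>f g. \<Sum>a\<in>Poly_Mapping.keys f. \<Sum>b\<in>Poly_Mapping.keys g.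
        Poly_Mapping.single (a \<otimes>\<^bsub>G\<^esub> b) (Poly_Mapping.lookup f a * Poly_Mapping.lookup g b)),
     one = Poly_Mapping.single \<one>\<^bsub>G\<^esub> 1,
     zero = 0,
     add = (+),
     smult = (\<lambda>z. Poly_Mapping.map ((*) z))\<rparr>"

text \<open>The library quotient ring, with the induced scalar multiplication on cosets.\<close>

definition quot_algebra :: "(complex, 'x) module \<Rightarrow> 'x set \<Rightarrow> (complex, 'x set) module" where
  "quot_algebra A J =
    ring.extend (A Quot J) (module.fields (\<lambda>z X. \<Union>x\<in>X. J +>\<^bsub>A\<^esub> (z \<odot>\<^bsub>A\<^esub> x)))"

definition free_monoid :: "'g set \<Rightarrow> 'g list monoid" where
  "free_monoid S = \<lparr>carrier = lists S, mult = (@), one = []\<rparr>"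

abbreviation free_algebra :: "'g set \<Rightarrow> (complex, 'g list \<Rightarrow>\<^sub>0 complex) module" where
  "free_algebra S \<equiv> monoid_algebra (free_monoid S)"

abbreviation word :: "'g list \<Rightarrow> ('g list \<Rightarrow>\<^sub>0 complex)" where
  "word gs \<equiv> Poly_Mapping.single gs 1"

text \<open>
  The algebra with generators \<open>S\<close> in which the elements of \<open>rels\<close> vanish
  (\<open>Idl\<close> is the two-sided ideal), and the class of an element of the free algebra.
\<close>

definition presented_algebra ::
    "'g set \<Rightarrow> ('g list \<Rightarrow>\<^sub>0 complex) set \<Rightarrow> (complex, ('g list \<Rightarrow>\<^sub>0 complex) set) module" where
  "presented_algebra S rels = quot_algebra (free_algebra S) (Idl\<^bsub>free_algebra S\<^esub> rels)"

definition presented_class ::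
    "'g set \<Rightarrow> ('g list \<Rightarrow>\<^sub>0 complex) set \<Rightarrow> ('g list \<Rightarrow>\<^sub>0 complex) \<Rightarrow> ('g list \<Rightarrow>\<^sub>0 complex) set" where
  "presented_class S rels f = Idl\<^bsub>free_algebra S\<^esub> rels +>\<^bsub>free_algebra S\<^esub> f"

text \<open>
  The tensor product over the complex numbers: the free vector space on pairs, with
  \<open>(a, b) (a', b') = (a a', b b')\<close>, modulo the bilinearity relations.  These relations are
  stable under multiplication by pairs, so the ideal they generate is their linear span.
\<close>

definition tensor_rels ::
    "(complex, 'x) module \<Rightarrow> (complex, 'y) module \<Rightarrow> ('x \<times> 'y \<Rightarrow>\<^sub>0 complex) set" where
  "tensor_rels A B =
     {Poly_Mapping.single (a \<oplus>\<^bsub>A\<^esub> a', b) 1 - Poly_Mapping.single (a, b) 1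
        - Poly_Mapping.single (a', b) 1 | a a' b.
        a \<in> carrier A \<and> a' \<in> carrier A \<and> b \<in> carrier B} \<union>
     {Poly_Mapping.single (a, b \<oplus>\<^bsub>B\<^esub> b') 1 - Poly_Mapping.single (a, b) 1
        - Poly_Mapping.single (a, b') 1 | a b b'.
        a \<in> carrier A \<and> b \<in> carrier B \<and> b' \<in> carrier B} \<union>
     {Poly_Mapping.single (z \<odot>\<^bsub>A\<^esub> a, b) 1 - Poly_Mapping.single (a, b) z | z a b.
        a \<in> carrier A \<and> b \<in> carrier B} \<union>
     {Poly_Mapping.single (a, z \<odot>\<^bsub>B\<^esub> b) 1 - Poly_Mapping.single (a, b) z | z a b.
        a \<in> carrier A \<and> b \<in> carrier B}"

definition tensor_algebra ::
    "(complex, 'x) module \<Rightarrow> (complex, 'y) module \<Rightarrow> (complex, ('x \<times> 'y \<Rightarrow>\<^sub>0 complex) set) module" where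
  "tensor_algebra A B =
     quot_algebra (monoid_algebra (A \<times>\<times> B)) (Idl\<^bsub>monoid_algebra (A \<times>\<times> B)\<^esub> (tensor_rels A B))"

definition tens ::
    "(complex, 'x) module \<Rightarrow> (complex, 'y) module \<Rightarrow> 'x \<Rightarrow> 'y \<Rightarrow> ('x \<times> 'y \<Rightarrow>\<^sub>0 complex) set" where
  "tens A B a b =
     Idl\<^bsub>monoid_algebra (A \<times>\<times> B)\<^esub> (tensor_rels A B)
       +>\<^bsub>monoid_algebra (A \<times>\<times> B)\<^esub> Poly_Mapping.single (a, b) 1"


section \<open>Root systems\<close>

text \<open>\<open>V\<^sub>0\<close> and \<open>V\<^sub>0\<^sup>\<or>\<close> are the types \<^typ>\<open>'a\<close> and \<^typ>\<open>'b\<close>.\<close>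

record ('a, 'b) root_datum =
  pairing :: "'a \<Rightarrow> 'b \<Rightarrow> real"
  roots :: "'a set"
  coroots :: "'b set"
  coroot :: "'a \<Rightarrow> 'b"

definition perfect_pairing :: "('a::real_vector \<Rightarrow> 'b::real_vector \<Rightarrow> real) \<Rightarrow> bool" where
  "perfect_pairing b \<longleftrightarrow>
     (\<forall>v. linear (b v)) \<and> (\<forall>y. linear (\<lambda>v. b v y)) \<and>
     (\<forall>\<phi>. linear \<phi> \<longrightarrow> (\<exists>!v. b v = \<phi>)) \<and>
     (\<forall>\<psi>. linear \<psi> \<longrightarrow> (\<exists>!y. (\<lambda>v. b v y) = \<psi>))"

definition refl :: "('a::real_vector, 'b::real_vector) root_datum \<Rightarrow> 'a \<Rightarrow> 'a \<Rightarrow> 'a" where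
  "refl \<Phi> \<alpha> v = v - pairing \<Phi> v (coroot \<Phi> \<alpha>) *\<^sub>R \<alpha>"

definition corefl :: "('a::real_vector, 'b::real_vector) root_datum \<Rightarrow> 'a \<Rightarrow> 'b \<Rightarrow> 'b" where
  "corefl \<Phi> \<alpha> y = y - pairing \<Phi> \<alpha> y *\<^sub>R coroot \<Phi> \<alpha>"

text \<open>
  Finite dimensionality of both spaces follows from the finite spanning sets.
  Reducedness for not necessarily crystallographic root systems means that the only multiples
  of a root that are roots are \<open>\<plusminus>\<alpha>\<close>.  In particular \<open>2\<alpha>\<close> is not a root; the latter alone
  would still admit \<open>{\<plusminus>\<alpha>, \<plusminus>3\<alpha>}\<close> in rank one.
\<close>

definition reduced_root_system :: "('a::real_vector, 'b::real_vector) root_datum \<Rightarrow> bool" where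
  "reduced_root_system \<Phi> \<longleftrightarrow>
     perfect_pairing (pairing \<Phi>) \<and>
     finite (roots \<Phi>) \<and> 0 \<notin> roots \<Phi> \<and> span (roots \<Phi>) = UNIV \<and>
     finite (coroots \<Phi>) \<and> 0 \<notin> coroots \<Phi> \<and> span (coroots \<Phi>) = UNIV \<and>
     bij_betw (coroot \<Phi>) (roots \<Phi>) (coroots \<Phi>) \<and>
     (\<forall>\<alpha>\<in>roots \<Phi>. pairing \<Phi> \<alpha> (coroot \<Phi> \<alpha>) = 2) \<and>
     (\<forall>\<alpha>\<in>roots \<Phi>. refl \<Phi> \<alpha> ` roots \<Phi> = roots \<Phi>) \<and>
     (\<forall>\<alpha>\<in>roots \<Phi>. corefl \<Phi> \<alpha> ` coroots \<Phi> = coroots \<Phi>) \<and>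
     (\<forall>\<alpha>\<in>roots \<Phi>. \<forall>r::real. r *\<^sub>R \<alpha> \<in> roots \<Phi> \<longrightarrow> r = 1 \<or> r = -1)"

text \<open>
  The Weyl group through its (faithful) actions on \<open>V\<^sub>0\<^sup>\<or>\<close> and on \<open>V\<^sub>0\<close>; the first one serves as
  the group \<open>W\<close> itself.
\<close>

definition weyl :: "('a::real_vector, 'b::real_vector) root_datum \<Rightarrow> ('b \<Rightarrow> 'b) monoid" where
  "weyl \<Phi> = (BijGroup UNIV)\<lparr>carrier := generate (BijGroup UNIV) (corefl \<Phi> ` roots \<Phi>)\<rparr>"

definition weyl_on_roots :: "('a::real_vector, 'b::real_vector) root_datum \<Rightarrow> ('a \<Rightarrow> 'a) monoid" where
  "weyl_on_roots \<Phi> = (BijGroup UNIV)\<lparr>carrier := generate (BijGroup UNIV) (refl \<Phi> ` roots \<Phi>)\<rparr>"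

text \<open>\<open>Rp\<close> is \<open>R\<^sup>+\<close> and \<open>\<Delta>\<close> its set of simple roots.\<close>

definition positive_roots_with_simple ::
    "('a::real_vector, 'b::real_vector) root_datum \<Rightarrow> 'a set \<Rightarrow> 'a set \<Rightarrow> bool" where
  "positive_roots_with_simple \<Phi> Rp \<Delta> \<longleftrightarrow>
     \<Delta> \<subseteq> roots \<Phi> \<and> independent \<Delta> \<and> span \<Delta> = UNIV \<and>
     Rp = {\<beta> \<in> roots \<Phi>. \<exists>k. (\<forall>\<alpha>\<in>\<Delta>. 0 \<le> k \<alpha>) \<and> \<beta> = (\<Sum>\<alpha>\<in>\<Delta>. k \<alpha> *\<^sub>R \<alpha>)} \<and>
     roots \<Phi> = Rp \<union> uminus ` Rp"

definition weyl_invariant_parameter ::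
    "('a::real_vector, 'b::real_vector) root_datum \<Rightarrow> ('a \<Rightarrow> real) \<Rightarrow> bool" where
  "weyl_invariant_parameter \<Phi> c \<longleftrightarrow>
     (\<forall>w\<in>carrier (weyl_on_roots \<Phi>). \<forall>\<alpha>\<in>roots \<Phi>. c (w \<alpha>) = c \<alpha>)"

definition weyl_invariant_inner_product ::
    "('a::real_vector, 'b::real_vector) root_datum \<Rightarrow> ('b \<Rightarrow> 'b \<Rightarrow> real) \<Rightarrow> bool" where
  "weyl_invariant_inner_product \<Phi> ip \<longleftrightarrow>
     (\<forall>x. linear (ip x)) \<and> (\<forall>x y. ip x y = ip y x) \<and> (\<forall>x. x \<noteq> 0 \<longrightarrow> 0 < ip x x) \<and>
     (\<forall>w\<in>carrier (weyl \<Phi>). \<forall>x y. ip (w x) (w y) = ip x y)"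

text \<open>\<open>e i\<close> and \<open>e' i\<close> are \<open>\<omega>\<^sub>i\<close> and \<open>\<omega>\<^sup>i\<close>.\<close>

definition dual_bases ::
    "('b::real_vector \<Rightarrow> 'b \<Rightarrow> real) \<Rightarrow> 'i set \<Rightarrow> ('i \<Rightarrow> 'b) \<Rightarrow> ('i \<Rightarrow> 'b) \<Rightarrow> bool" where
  "dual_bases ip I e e' \<longleftrightarrow> finite I \<and>
     inj_on e I \<and> independent (e ` I) \<and> span (e ` I) = UNIV \<and>
     inj_on e' I \<and> independent (e' ` I) \<and> span (e' ` I) = UNIV \<and>
     (\<forall>i\<in>I. \<forall>j\<in>I. ip (e i) (e' j) = (if i = j then 1 else 0))"

definition dual_ip ::
    "('a, 'b) root_datum \<Rightarrow> 'i set \<Rightarrow> ('i \<Rightarrow> 'b) \<Rightarrow> ('i \<Rightarrow> 'b) \<Rightarrow> 'a \<Rightarrow> 'a \<Rightarrow> real" where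
  "dual_ip \<Phi> I e e' v\<^sub>1 v\<^sub>2 = (\<Sum>i\<in>I. pairing \<Phi> v\<^sub>1 (e i) * pairing \<Phi> v\<^sub>2 (e' i))"

definition root_norm ::
    "('a, 'b) root_datum \<Rightarrow> 'i set \<Rightarrow> ('i \<Rightarrow> 'b) \<Rightarrow> ('i \<Rightarrow> 'b) \<Rightarrow> 'a \<Rightarrow> real" where
  "root_norm \<Phi> I e e' v = sqrt (dual_ip \<Phi> I e e' v v)"


section \<open>Complexification\<close>

text \<open>
  The pair \<open>(x, y)\<close> stands for \<open>x \<otimes> 1 + y \<otimes> \<i>\<close> in \<open>V\<^sup>\<or> = V\<^sub>0\<^sup>\<or> \<otimes> \<complex>\<close>; addition is componentwise.
  A real linear map \<open>f\<close> extends to \<open>map_prod f f\<close>.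
\<close>

type_synonym 'b cplx = "'b \<times> 'b"

abbreviation of_real_vec :: "'b::real_vector \<Rightarrow> 'b cplx" where
  "of_real_vec x \<equiv> (x, 0)"

definition cscale :: "complex \<Rightarrow> 'b::real_vector cplx \<Rightarrow> 'b cplx" where
  "cscale z \<omega> = (Re z *\<^sub>R fst \<omega> - Im z *\<^sub>R snd \<omega>, Re z *\<^sub>R snd \<omega> + Im z *\<^sub>R fst \<omega>)"

definition cpairing :: "('a, 'b) root_datum \<Rightarrow> 'a \<Rightarrow> 'b cplx \<Rightarrow> complex" where
  "cpairing \<Phi> \<alpha> \<omega> = Complex (pairing \<Phi> \<alpha> (fst \<omega>)) (pairing \<Phi> \<alpha> (snd \<omega>))"

definition cip :: "('b \<Rightarrow> 'b \<Rightarrow> real) \<Rightarrow> 'b cplx \<Rightarrow> 'b cplx \<Rightarrow> complex" where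
  "cip ip \<omega> \<omega>' = Complex (ip (fst \<omega>) (fst \<omega>') - ip (snd \<omega>) (snd \<omega>'))
                         (ip (fst \<omega>) (snd \<omega>') + ip (snd \<omega>) (fst \<omega>'))"


section \<open>The graded affine Hecke algebra\<close>

datatype 'b hecke_gen = GrpGen "'b \<Rightarrow> 'b" | VecGen "'b cplx"

definition hecke_gens :: "('a::real_vector, 'b::real_vector) root_datum \<Rightarrow> 'b hecke_gen set" where
  "hecke_gens \<Phi> = GrpGen ` carrier (weyl \<Phi>) \<union> range VecGen"

text \<open>
  The first two families of relations make \<open>w \<mapsto> t\<^sub>w\<close> an algebra map on the group algebra of \<open>W\<close>,
  the next three make \<open>\<omega> \<mapsto> \<omega>\<close> an algebra map on \<open>S(V\<^sup>\<or>)\<close>.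
\<close>

definition hecke_rels ::
    "('a::real_vector, 'b::real_vector) root_datum \<Rightarrow> 'a set \<Rightarrow> ('a \<Rightarrow> real)
      \<Rightarrow> ('b hecke_gen list \<Rightarrow>\<^sub>0 complex) set" where
  "hecke_rels \<Phi> \<Delta> c =
     {word [GrpGen \<one>\<^bsub>weyl \<Phi>\<^esub>] - word []} \<union>
     {word [GrpGen u, GrpGen v] - word [GrpGen (u \<otimes>\<^bsub>weyl \<Phi>\<^esub> v)] | u v.
        u \<in> carrier (weyl \<Phi>) \<and> v \<in> carrier (weyl \<Phi>)} \<union>
     {word [VecGen (\<omega> + \<omega>')] - word [VecGen \<omega>] - word [VecGen \<omega>'] | \<omega> \<omega>'. True} \<union>
     {word [VecGen (cscale z \<omega>)] - Poly_Mapping.single [VecGen \<omega>] z | z \<omega>. True} \<union>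
     {word [VecGen \<omega>, VecGen \<omega>'] - word [VecGen \<omega>', VecGen \<omega>] | \<omega> \<omega>'. True} \<union>
     {word [VecGen \<omega>, GrpGen (corefl \<Phi> \<alpha>)]
        - word [GrpGen (corefl \<Phi> \<alpha>), VecGen (map_prod (corefl \<Phi> \<alpha>) (corefl \<Phi> \<alpha>) \<omega>)]
        - Poly_Mapping.single [] (of_real (c \<alpha>) * cpairing \<Phi> \<alpha> \<omega>) | \<alpha> \<omega>. \<alpha> \<in> \<Delta>}"

type_synonym 'b hecke_elem = "('b hecke_gen list \<Rightarrow>\<^sub>0 complex) set"

definition hecke ::
    "('a::real_vector, 'b::real_vector) root_datum \<Rightarrow> 'a set \<Rightarrow> ('a \<Rightarrow> real)
      \<Rightarrow> (complex, 'b hecke_elem) module" where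
  "hecke \<Phi> \<Delta> c = presented_algebra (hecke_gens \<Phi>) (hecke_rels \<Phi> \<Delta> c)"

definition hecke_t ::
    "('a::real_vector, 'b::real_vector) root_datum \<Rightarrow> 'a set \<Rightarrow> ('a \<Rightarrow> real)
      \<Rightarrow> ('b \<Rightarrow> 'b) \<Rightarrow> 'b hecke_elem" where
  "hecke_t \<Phi> \<Delta> c w = presented_class (hecke_gens \<Phi>) (hecke_rels \<Phi> \<Delta> c) (word [GrpGen w])"

definition hecke_vec ::
    "('a::real_vector, 'b::real_vector) root_datum \<Rightarrow> 'a set \<Rightarrow> ('a \<Rightarrow> real)
      \<Rightarrow> 'b cplx \<Rightarrow> 'b hecke_elem" where
  "hecke_vec \<Phi> \<Delta> c \<omega> = presented_class (hecke_gens \<Phi>) (hecke_rels \<Phi> \<Delta> c) (word [VecGen \<omega>])"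

definition hecke_Omega ::
    "('a::real_vector, 'b::real_vector) root_datum \<Rightarrow> 'a set \<Rightarrow> ('a \<Rightarrow> real)
      \<Rightarrow> 'i set \<Rightarrow> ('i \<Rightarrow> 'b) \<Rightarrow> ('i \<Rightarrow> 'b) \<Rightarrow> 'b hecke_elem" where
  "hecke_Omega \<Phi> \<Delta> c I e e' =
     (\<Oplus>\<^bsub>hecke \<Phi> \<Delta> c\<^esub>i\<in>I. hecke_vec \<Phi> \<Delta> c (of_real_vec (e i))
        \<otimes>\<^bsub>hecke \<Phi> \<Delta> c\<^esub> hecke_vec \<Phi> \<Delta> c (of_real_vec (e' i)))"

definition hecke_tilde ::
    "('a::real_vector, 'b::real_vector) root_datum \<Rightarrow> 'a set \<Rightarrow> 'a set \<Rightarrow> ('a \<Rightarrow> real)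
      \<Rightarrow> 'b cplx \<Rightarrow> 'b hecke_elem" where
  "hecke_tilde \<Phi> Rp \<Delta> c \<omega> =
     hecke_vec \<Phi> \<Delta> c \<omega> \<ominus>\<^bsub>hecke \<Phi> \<Delta> c\<^esub>
       (1/2) \<odot>\<^bsub>hecke \<Phi> \<Delta> c\<^esub>
         (\<Oplus>\<^bsub>hecke \<Phi> \<Delta> c\<^esub>\<beta>\<in>Rp.
            (of_real (c \<beta>) * cpairing \<Phi> \<beta> \<omega>) \<odot>\<^bsub>hecke \<Phi> \<Delta> c\<^esub> hecke_t \<Phi> \<Delta> c (corefl \<Phi> \<beta>))"


section \<open>The Clifford algebra, the Pin group and the double cover of the Weyl group\<close>

definition clifford_rels ::
    "('b::real_vector \<Rightarrow> 'b \<Rightarrow> real) \<Rightarrow> ('b cplx list \<Rightarrow>\<^sub>0 complex) set" where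
  "clifford_rels ip =
     {word [\<omega> + \<omega>'] - word [\<omega>] - word [\<omega>'] | \<omega> \<omega>'. True} \<union>
     {word [cscale z \<omega>] - Poly_Mapping.single [\<omega>] z | z \<omega>. True} \<union>
     {word [\<omega>, \<omega>'] + word [\<omega>', \<omega>] + Poly_Mapping.single [] (2 * cip ip \<omega> \<omega>') | \<omega> \<omega>'. True}"

type_synonym 'b clifford_elem = "('b cplx list \<Rightarrow>\<^sub>0 complex) set"

definition clifford ::
    "('b::real_vector \<Rightarrow> 'b \<Rightarrow> real) \<Rightarrow> (complex, 'b clifford_elem) module" where
  "clifford ip = presented_algebra UNIV (clifford_rels ip)"

definition clifford_vec :: "('b::real_vector \<Rightarrow> 'b \<Rightarrow> real) \<Rightarrow> 'b cplx \<Rightarrow> 'b clifford_elem" where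
  "clifford_vec ip \<omega> = presented_class UNIV (clifford_rels ip) (word [\<omega>])"

text \<open>
  The (anti)automorphisms of the free algebra
  \<open>\<omega>\<^sub>1\<cdots>\<omega>\<^sub>k \<mapsto> (-1)\<^sup>k \<omega>\<^sub>1\<cdots>\<omega>\<^sub>k\<close> and \<open>\<omega>\<^sub>1\<cdots>\<omega>\<^sub>k \<mapsto> (-1)\<^sup>k \<omega>\<^sub>k\<cdots>\<omega>\<^sub>1\<close> are involutions that preserve the
  ideal of relations.  Hence they map cosets onto cosets and induce \<open>\<epsilon>\<close> and \<open>\<^sup>t\<close> by taking images.
\<close>

definition clifford_eps :: "'b clifford_elem \<Rightarrow> 'b clifford_elem" where
  "clifford_eps X =
     (\<lambda>f. \<Sum>w\<in>Poly_Mapping.keys f. Poly_Mapping.single w ((-1) ^ length w * Poly_Mapping.lookup f w)) ` X"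

definition clifford_transpose :: "'b clifford_elem \<Rightarrow> 'b clifford_elem" where
  "clifford_transpose X =
     (\<lambda>f. \<Sum>w\<in>Poly_Mapping.keys f.
        Poly_Mapping.single (rev w) ((-1) ^ length w * Poly_Mapping.lookup f w)) ` X"

definition pin :: "('b::real_vector \<Rightarrow> 'b \<Rightarrow> real) \<Rightarrow> 'b clifford_elem set" where
  "pin ip = {a \<in> Units (clifford ip).
     (\<forall>\<omega>. clifford_eps a \<otimes>\<^bsub>clifford ip\<^esub> clifford_vec ip \<omega> \<otimes>\<^bsub>clifford ip\<^esub> inv\<^bsub>clifford ip\<^esub> a
            \<in> range (clifford_vec ip)) \<and>
     clifford_transpose a = inv\<^bsub>clifford ip\<^esub> a}"

text \<open>\<open>p(a)\<close>, as a map on \<open>V\<^sup>\<or>\<close>.\<close>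

definition pin_proj ::
    "('b::real_vector \<Rightarrow> 'b \<Rightarrow> real) \<Rightarrow> 'b clifford_elem \<Rightarrow> 'b cplx \<Rightarrow> 'b cplx" where
  "pin_proj ip a \<omega> = the_inv (clifford_vec ip)
     (clifford_eps a \<otimes>\<^bsub>clifford ip\<^esub> clifford_vec ip \<omega> \<otimes>\<^bsub>clifford ip\<^esub> inv\<^bsub>clifford ip\<^esub> a)"

definition weyl_cover ::
    "('a::real_vector, 'b::real_vector) root_datum \<Rightarrow> ('b \<Rightarrow> 'b \<Rightarrow> real) \<Rightarrow> 'b clifford_elem monoid" where
  "weyl_cover \<Phi> ip =
     \<lparr>carrier = {a \<in> pin ip. \<exists>w\<in>carrier (weyl \<Phi>). pin_proj ip a = map_prod w w},
      mult = mult (clifford ip), one = \<one>\<^bsub>clifford ip\<^esub>\<rparr>"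

text \<open>\<open>p(a)\<close>, as an element of \<open>W\<close>.\<close>

definition weyl_cover_proj ::
    "('a::real_vector, 'b::real_vector) root_datum \<Rightarrow> ('b \<Rightarrow> 'b \<Rightarrow> real)
      \<Rightarrow> 'b clifford_elem \<Rightarrow> 'b \<Rightarrow> 'b" where
  "weyl_cover_proj \<Phi> ip a = (THE w. w \<in> carrier (weyl \<Phi>) \<and> pin_proj ip a = map_prod w w)"

definition clifford_root ::
    "('a, 'b::real_vector) root_datum \<Rightarrow> ('b \<Rightarrow> 'b \<Rightarrow> real) \<Rightarrow> 'a \<Rightarrow> 'b clifford_elem" where
  "clifford_root \<Phi> ip \<alpha> = clifford_vec ip
     (of_real_vec ((1 / sqrt (ip (coroot \<Phi> \<alpha>) (coroot \<Phi> \<alpha>))) *\<^sub>R coroot \<Phi> \<alpha>))"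


section \<open>The Dirac operator\<close>

text \<open>
  The condition \<open>- refl \<Phi> \<alpha> \<beta> \<in> Rp\<close> says \<open>s\<^sub>\<alpha>(\<beta>) < 0\<close>.  The products are those of the group
  algebra of the double cover, in which \<open>-1\<close> of the Clifford algebra is a group element and
  not a scalar.
\<close>

definition Omega_cover ::
    "('a::real_vector, 'b::real_vector) root_datum \<Rightarrow> 'a set \<Rightarrow> ('a \<Rightarrow> real) \<Rightarrow> ('b \<Rightarrow> 'b \<Rightarrow> real)
      \<Rightarrow> 'i set \<Rightarrow> ('i \<Rightarrow> 'b) \<Rightarrow> ('i \<Rightarrow> 'b) \<Rightarrow> ('b clifford_elem \<Rightarrow>\<^sub>0 complex)" where
  "Omega_cover \<Phi> Rp c ip I e e' =
     (- 1/4) \<odot>\<^bsub>monoid_algebra (weyl_cover \<Phi> ip)\<^esub>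
       (\<Sum>(\<alpha>, \<beta>) \<in> {(\<alpha>, \<beta>). \<alpha> \<in> Rp \<and> \<beta> \<in> Rp \<and> - refl \<Phi> \<alpha> \<beta> \<in> Rp}.
          complex_of_real (c \<alpha> * c \<beta> * root_norm \<Phi> I e e' \<alpha> * root_norm \<Phi> I e e' \<beta>)
            \<odot>\<^bsub>monoid_algebra (weyl_cover \<Phi> ip)\<^esub>
            (Poly_Mapping.single (clifford_root \<Phi> ip \<alpha>) 1
              \<otimes>\<^bsub>monoid_algebra (weyl_cover \<Phi> ip)\<^esub> Poly_Mapping.single (clifford_root \<Phi> ip \<beta>) 1))"

type_synonym 'b hecke_clifford_elem = "('b hecke_elem \<times> 'b clifford_elem \<Rightarrow>\<^sub>0 complex) set"

definition hecke_clifford ::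
    "('a::real_vector, 'b::real_vector) root_datum \<Rightarrow> 'a set \<Rightarrow> ('a \<Rightarrow> real) \<Rightarrow> ('b \<Rightarrow> 'b \<Rightarrow> real)
      \<Rightarrow> (complex, 'b hecke_clifford_elem) module" where
  "hecke_clifford \<Phi> \<Delta> c ip = tensor_algebra (hecke \<Phi> \<Delta> c) (clifford ip)"

definition rho ::
    "('a::real_vector, 'b::real_vector) root_datum \<Rightarrow> 'a set \<Rightarrow> ('a \<Rightarrow> real) \<Rightarrow> ('b \<Rightarrow> 'b \<Rightarrow> real)
      \<Rightarrow> ('b clifford_elem \<Rightarrow>\<^sub>0 complex) \<Rightarrow> 'b hecke_clifford_elem" where
  "rho \<Phi> \<Delta> c ip x =
     (\<Oplus>\<^bsub>hecke_clifford \<Phi> \<Delta> c ip\<^esub>a\<in>Poly_Mapping.keys x.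
        Poly_Mapping.lookup x a \<odot>\<^bsub>hecke_clifford \<Phi> \<Delta> c ip\<^esub>
          tens (hecke \<Phi> \<Delta> c) (clifford ip) (hecke_t \<Phi> \<Delta> c (weyl_cover_proj \<Phi> ip a)) a)"

definition dirac ::
    "('a::real_vector, 'b::real_vector) root_datum \<Rightarrow> 'a set \<Rightarrow> 'a set \<Rightarrow> ('a \<Rightarrow> real)
      \<Rightarrow> ('b \<Rightarrow> 'b \<Rightarrow> real) \<Rightarrow> 'i set \<Rightarrow> ('i \<Rightarrow> 'b) \<Rightarrow> ('i \<Rightarrow> 'b) \<Rightarrow> 'b hecke_clifford_elem" where
  "dirac \<Phi> Rp \<Delta> c ip I e e' =
     (\<Oplus>\<^bsub>hecke_clifford \<Phi> \<Delta> c ip\<^esub>i\<in>I.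
        tens (hecke \<Phi> \<Delta> c) (clifford ip) (hecke_tilde \<Phi> Rp \<Delta> c (of_real_vec (e i)))
          (clifford_vec ip (of_real_vec (e' i))))"

end

theory Submission
  imports Defs
begin

text \<open>
  Write \<open>\<D> = E - T\<close> with \<open>E = \<Sum> \<omega>\<^sub>i \<otimes> \<omega>\<^sup>i\<close> and
  \<open>T = \<onehalf> \<Sum>\<^sub>\<beta>\<^sub>>\<^sub>0 c\<^sub>\<beta> |\<beta>| t\<^sub>\<beta> \<otimes> f\<^sub>\<beta>\<close>.  The \<open>\<omega>\<^sub>i\<close> commute, so the Clifford relation gives
  \<open>E\<^sup>2 = - \<Omega> \<otimes> 1\<close>.  Conjugation by \<open>t\<^sub>\<beta>\<close> maps the tilde element of \<open>\<omega>\<close> to that of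
  \<open>s\<^sub>\<beta>(\<omega>)\<close> (directly for simple \<open>\<beta>\<close>, and every positive root is conjugate to a simple one), while \<open>f\<^sub>\<beta> \<omega> = - s\<^sub>\<beta>(\<omega>) f\<^sub>\<beta>\<close>.  Hence
  \<open>t\<^sub>\<beta> \<otimes> f\<^sub>\<beta>\<close> anticommutes with \<open>\<D>\<close>, so \<open>\<D>T + T\<D> = 0\<close> and \<open>\<D>\<^sup>2 = E\<^sup>2 - T\<^sup>2\<close>.  Finally the pairs with
  \<open>s\<^sub>\<alpha>(\<beta>) > 0\<close> cancel in \<open>T\<^sup>2\<close>, because \<open>t\<^sub>\<alpha> t\<^sub>\<beta> = t\<^sub>\<gamma> t\<^sub>\<alpha>\<close> and \<open>f\<^sub>\<alpha> f\<^sub>\<beta> = - f\<^sub>\<gamma> f\<^sub>\<alpha>\<close> for \<open>\<gamma> = s\<^sub>\<alpha>(\<beta>)\<close>.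
  The projection of the double cover is only determined once \<open>V\<^sup>\<or>\<close> is known to embed into the Clifford
  algebra, which reduces to \<open>1 \<noteq> 0\<close> there.
\<close>

text \<open>Expanding \<open>E = D + T\<close> rather than \<open>D = E - T\<close> leaves only the
  cross terms \<open>T D + D T\<close>, so a single anticommutation does all the work. The tilde
  correction is tuned for it: for a simple root \<alpha> the Hecke relation has the defect
  c(\<alpha>) (\<alpha>, \<omega>). The correction has the same defect, because s_\<alpha> permutes
  the other positive roots while the term of \<alpha> itself, which carries a factor 1/2, changes
  sign. The factor |\<beta>| in \<open>T\<close> appears because the vector representing \<beta>
  under the inner product is |\<beta>| times the unit coroot. The cancellation in the square of
  \<open>T\<close> needs care: (\<alpha>, \<beta>) to (s_\<alpha>(\<beta>), \<alpha>) is no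
  involution and can leave the set of pairs with positive reflection, as it does for the two simple
  roots of type A2. Two branches repair this. In the group algebra of the cover different pairs can
  give the same element (every (\<alpha>, \<alpha>) gives -1), so \<open>rho\<close> sees collected
  coefficients. Finally 1 \<noteq> 0 in the Clifford algebra, known there only by generators and
  relations, comes from an explicit representation.\<close>

section \<open>Complex algebras and finite sums in them\<close>

locale complex_algebra = ring A for A :: "(complex, 'x) module" (structure) +
  assumes smult_closed [simp, intro]: "x \<in> carrier A \<Longrightarrow> z \<odot> x \<in> carrier A"
    and smult_l_distr: "x \<in> carrier A \<Longrightarrow> (z + w) \<odot> x = z \<odot> x \<oplus> w \<odot> x"
    and smult_r_distr: "x \<in> carrier A \<Longrightarrow> y \<in> carrier A \<Longrightarrow> z \<odot> (x \<oplus> y) = z \<odot> x \<oplus> z \<odot> y"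
    and smult_smult: "x \<in> carrier A \<Longrightarrow> z \<odot> (w \<odot> x) = (z * w) \<odot> x"
    and smult_one [simp]: "x \<in> carrier A \<Longrightarrow> 1 \<odot> x = x"
    and smult_mult_l: "x \<in> carrier A \<Longrightarrow> y \<in> carrier A \<Longrightarrow> (z \<odot> x) \<otimes> y = z \<odot> (x \<otimes> y)"
    and smult_mult_r: "x \<in> carrier A \<Longrightarrow> y \<in> carrier A \<Longrightarrow> x \<otimes> (z \<odot> y) = z \<odot> (x \<otimes> y)"
begin

lemma smult_zero_l [simp]: "x \<in> carrier A \<Longrightarrow> 0 \<odot> x = \<zero>"
  using smult_l_distr[of x 0 0] by (metis add.r_cancel_one' add_0 smult_closed)

lemma smult_zero_r [simp]: "z \<odot> \<zero> = \<zero>"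
  using smult_r_distr[of \<zero> \<zero> z] by (metis add.r_cancel_one' r_zero smult_closed zero_closed)

lemma smult_minus_one: "x \<in> carrier A \<Longrightarrow> (-1) \<odot> x = \<ominus> x"
  using smult_l_distr[of x "-1" 1]
  by (metis add.inv_equality ab_left_minus smult_closed smult_one smult_zero_l)

lemma smult_minus: "x \<in> carrier A \<Longrightarrow> z \<odot> (\<ominus> x) = \<ominus> (z \<odot> x)"
  by (metis mult.commute smult_closed smult_minus_one smult_smult)

lemma smult_uminus: "x \<in> carrier A \<Longrightarrow> (- z) \<odot> x = \<ominus> (z \<odot> x)"
  by (metis mult_minus1 smult_closed smult_minus_one smult_smult)

text \<open>Division by 2 is available. A sum reversed by an involution therefore vanishes, without
  any discussion of fixed points.\<close>

lemma eq_neg_imp_zero: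
  assumes "x \<in> carrier A" "x = \<ominus> x"
  shows "x = \<zero>"
proof -
  have "2 \<odot> x = \<zero>"
    using assms smult_l_distr[of x 1 1] by (metis one_add_one r_neg smult_one)
  then have "(1/2) \<odot> (2 \<odot> x) = \<zero>" by simp
  then show ?thesis using assms(1) by (simp add: smult_smult)
qed

lemma finsum_smult:
  "f \<in> S \<rightarrow> carrier A \<Longrightarrow> z \<odot> finsum A f S = (\<Oplus>i\<in>S. z \<odot> f i)"
proof (induction S rule: infinite_finite_induct)
  case (insert i S)
  then show ?case by (simp add: smult_r_distr Pi_def)
qed simp_all

lemma finsum_neg:
  "f \<in> S \<rightarrow> carrier A \<Longrightarrow> \<ominus> finsum A f S = (\<Oplus>i\<in>S. \<ominus> f i)"
proof (induction S rule: infinite_finite_induct)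
  case (insert i S)
  then show ?case by (simp add: minus_add Pi_def)
qed simp_all

lemma finsum_swap:
  assumes "finite I" "finite J" "\<And>i j. i \<in> I \<Longrightarrow> j \<in> J \<Longrightarrow> f i j \<in> carrier A"
  shows "(\<Oplus>i\<in>I. \<Oplus>j\<in>J. f i j) = (\<Oplus>j\<in>J. \<Oplus>i\<in>I. f i j)"
  using assms(1,3)
proof (induction I rule: finite_induct)
  case empty
  then show ?case by simp
next
  case (insert i I)
  have "(\<Oplus>i\<in>insert i I. \<Oplus>j\<in>J. f i j) = (\<Oplus>j\<in>J. f i j) \<oplus> (\<Oplus>j\<in>J. \<Oplus>i\<in>I. f i j)"
    using insert by (subst finsum_insert) (auto intro!: finsum_closed)
  also have "\<dots> = (\<Oplus>j\<in>J. f i j \<oplus> (\<Oplus>i\<in>I. f i j))"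
    using insert by (subst finsum_addf) (auto intro!: finsum_closed)
  also have "\<dots> = (\<Oplus>j\<in>J. \<Oplus>i\<in>insert i I. f i j)"
    using insert by (intro finsum_cong') (auto intro!: finsum_closed)
  finally show ?case .
qed

lemma finsum_product_set:
  assumes "finite I" "finite J" "\<And>i j. i \<in> I \<Longrightarrow> j \<in> J \<Longrightarrow> f i j \<in> carrier A"
  shows "(\<Oplus>i\<in>I. \<Oplus>j\<in>J. f i j) = (\<Oplus>p\<in>I \<times> J. f (fst p) (snd p))"
  using assms(1,3)
proof (induction I rule: finite_induct)
  case empty
  then show ?case by simp
next
  case (insert i I)
  have eq: "insert i I \<times> J = Pair i ` J \<union> I \<times> J" by auto
  have "(\<Oplus>p\<in>insert i I \<times> J. f (fst p) (snd p)) =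
      (\<Oplus>p\<in>Pair i ` J. f (fst p) (snd p)) \<oplus> (\<Oplus>p\<in>I \<times> J. f (fst p) (snd p))"
    unfolding eq using insert assms(2) by (intro finsum_Un_disjoint) auto
  also have "(\<Oplus>p\<in>Pair i ` J. f (fst p) (snd p)) = (\<Oplus>j\<in>J. f i j)"
    using insert by (subst finsum_reindex) (auto simp: inj_on_def)
  finally show ?case
    using insert by (subst finsum_insert) (auto intro!: finsum_closed)
qed

lemma finsum_mult_finsum:
  assumes "finite I" "finite J" "\<And>i. i \<in> I \<Longrightarrow> f i \<in> carrier A" "\<And>j. j \<in> J \<Longrightarrow> g j \<in> carrier A"
  shows "finsum A f I \<otimes> finsum A g J = (\<Oplus>i\<in>I. \<Oplus>j\<in>J. f i \<otimes> g j)"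
proof -
  have "finsum A f I \<otimes> finsum A g J = (\<Oplus>i\<in>I. f i \<otimes> finsum A g J)"
    using assms by (intro finsum_ldistr) (auto intro!: finsum_closed)
  also have "\<dots> = (\<Oplus>i\<in>I. \<Oplus>j\<in>J. f i \<otimes> g j)"
    using assms by (intro finsum_cong') (auto intro!: finsum_closed finsum_rdistr)
  finally show ?thesis .
qed

end

text \<open>An infinite \<open>S\<close> is harmless: both sums then take the default value zero,
  which an additive map preserves.\<close>

lemma additive_finsum:
  assumes "abelian_group A" "abelian_group B"
    and "\<And>x. x \<in> carrier A \<Longrightarrow> h x \<in> carrier B"
    and "\<And>x y. x \<in> carrier A \<Longrightarrow> y \<in> carrier A \<Longrightarrow> h (x \<oplus>\<^bsub>A\<^esub> y) = h x \<oplus>\<^bsub>B\<^esub> h y"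
    and "\<And>i. i \<in> S \<Longrightarrow> f i \<in> carrier A"
  shows "h (finsum A f S) = (\<Oplus>\<^bsub>B\<^esub>i\<in>S. h (f i))"
proof -
  interpret A: abelian_group A by fact
  interpret B: abelian_group B by fact
  have h0: "h \<zero>\<^bsub>A\<^esub> = \<zero>\<^bsub>B\<^esub>"
    using assms(3,4)[of "\<zero>\<^bsub>A\<^esub>" ] assms(4)[of "\<zero>\<^bsub>A\<^esub>" "\<zero>\<^bsub>A\<^esub>"]
    by (metis A.r_zero A.zero_closed B.add.r_cancel_one')
  show ?thesis
    using assms(5)
  proof (induction S rule: infinite_finite_induct)
    case (insert i S)
    then show ?case
      using assms(3,4) by (simp add: Pi_def A.finsum_closed)
  qed (simp_all add: h0)
qed

section \<open>Monoid algebras\<close>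

text \<open>The linear functional with value \<open>h a\<close> at the basis element
  \<open>a\<close>. Such functionals separate points and turn convolution into iterated evaluation,
  so identities in monoid algebras are checked by applying them.\<close>

definition lin_ext :: "('g \<Rightarrow> complex) \<Rightarrow> ('g \<Rightarrow>\<^sub>0 complex) \<Rightarrow> complex" where
  "lin_ext h f = (\<Sum>w\<in>Poly_Mapping.keys f. Poly_Mapping.lookup f w * h w)"

lemma lin_ext_superset:
  "finite B \<Longrightarrow> Poly_Mapping.keys f \<subseteq> B \<Longrightarrow> lin_ext h f = (\<Sum>w\<in>B. Poly_Mapping.lookup f w * h w)"
  unfolding lin_ext_def by (intro sum.mono_neutral_left) (auto simp: in_keys_iff)

lemma lin_ext_zero [simp]: "lin_ext h 0 = 0"
  by (simp add: lin_ext_def)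

lemma lin_ext_add: "lin_ext h (f + g) = lin_ext h f + lin_ext h g"
proof -
  let ?B = "Poly_Mapping.keys f \<union> Poly_Mapping.keys g"
  have "Poly_Mapping.keys (f + g) \<subseteq> ?B" by (rule keys_add)
  then show ?thesis
    by (simp add: lin_ext_superset[of ?B] lookup_add sum.distrib distrib_right)
qed

lemma lin_ext_uminus: "lin_ext h (- f) = - lin_ext h f"
  using lin_ext_add[of h f "- f"] by (simp add: eq_neg_iff_add_eq_0 add.commute)

lemma lin_ext_diff: "lin_ext h (f - g) = lin_ext h f - lin_ext h g"
  using lin_ext_add[of h f "- g"] by (simp add: lin_ext_uminus)

lemma lin_ext_sum: "lin_ext h (sum F S) = (\<Sum>i\<in>S. lin_ext h (F i))"
  by (induction S rule: infinite_finite_induct) (simp_all add: lin_ext_add)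

lemma lin_ext_single [simp]: "lin_ext h (Poly_Mapping.single a z) = z * h a"
  by (cases "z = 0") (simp_all add: lin_ext_def)

lemma lookup_map_times: "Poly_Mapping.lookup (Poly_Mapping.map ((*) z) f) k = z * Poly_Mapping.lookup f k"
  for f :: "'g \<Rightarrow>\<^sub>0 complex"
  by (simp add: map.rep_eq when_def)

lemma lin_ext_map: "lin_ext h (Poly_Mapping.map ((*) z) f) = z * lin_ext h f"
proof -
  have "Poly_Mapping.keys (Poly_Mapping.map ((*) z) f) \<subseteq> Poly_Mapping.keys f"
    by (auto simp: in_keys_iff lookup_map_times)
  then have "lin_ext h (Poly_Mapping.map ((*) z) f) =
      (\<Sum>w\<in>Poly_Mapping.keys f. Poly_Mapping.lookup (Poly_Mapping.map ((*) z) f) w * h w)"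
    by (intro lin_ext_superset) auto
  then show ?thesis
    by (simp add: lookup_map_times lin_ext_def sum_distrib_left mult.assoc)
qed

lemma lin_ext_fun_add: "lin_ext (\<lambda>a. h a + k a) f = lin_ext h f + lin_ext k f"
  by (simp add: lin_ext_def sum.distrib distrib_left)

lemma lin_ext_fun_scale: "lin_ext (\<lambda>a. z * h a) f = z * lin_ext h f"
  by (simp add: lin_ext_def sum_distrib_left mult.left_commute)

lemma lin_ext_cong: "(\<And>a. a \<in> Poly_Mapping.keys f \<Longrightarrow> h a = k a) \<Longrightarrow> lin_ext h f = lin_ext k f"
  by (simp add: lin_ext_def)

lemma lin_ext_swap:
  "lin_ext (\<lambda>a. lin_ext (\<lambda>b. h a b) g) f = lin_ext (\<lambda>b. lin_ext (\<lambda>a. h a b) f) g"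
  unfolding lin_ext_def sum_distrib_left by (subst sum.swap) (simp add: mult.left_commute)

lemma lin_ext_delta: "lin_ext (\<lambda>a. if a = k then 1 else 0) f = Poly_Mapping.lookup f k"
  by (simp add: lin_ext_def in_keys_iff if_distrib[of "(*) _"] sum.delta cong: if_cong)

text \<open>Indicator functions for \<open>h\<close> already read off every coefficient.\<close>

lemma lin_ext_eqI: "(\<And>h. lin_ext h f = lin_ext h g) \<Longrightarrow> f = g"
  by (metis lin_ext_delta poly_mapping_eqI)

lemma monoid_algebra_simps [simp]:
  "carrier (monoid_algebra G) = {f. Poly_Mapping.keys f \<subseteq> carrier G}"
  "one (monoid_algebra G) = Poly_Mapping.single \<one>\<^bsub>G\<^esub> 1"
  "zero (monoid_algebra G) = 0"
  "add (monoid_algebra G) = (+)"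
  "smult (monoid_algebra G) = (\<lambda>z. Poly_Mapping.map ((*) z))"
  by (simp_all add: monoid_algebra_def)

lemma lin_ext_mult:
  "lin_ext h (f \<otimes>\<^bsub>monoid_algebra G\<^esub> g) = lin_ext (\<lambda>a. lin_ext (\<lambda>b. h (a \<otimes>\<^bsub>G\<^esub> b)) g) f"
  by (simp add: monoid_algebra_def lin_ext_sum)
    (simp add: lin_ext_def sum_distrib_left mult.assoc)

lemma single_mult_single [simp]:
  "Poly_Mapping.single a z \<otimes>\<^bsub>monoid_algebra G\<^esub> Poly_Mapping.single b w =
    Poly_Mapping.single (a \<otimes>\<^bsub>G\<^esub> b) (z * w)"
  by (rule lin_ext_eqI) (simp add: lin_ext_mult mult.assoc)

lemma keys_monoid_algebra_mult:
  "Poly_Mapping.keys (f \<otimes>\<^bsub>monoid_algebra G\<^esub> g)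
    \<subseteq> (\<lambda>(a, b). a \<otimes>\<^bsub>G\<^esub> b) ` (Poly_Mapping.keys f \<times> Poly_Mapping.keys g)"
proof
  fix k assume "k \<in> Poly_Mapping.keys (f \<otimes>\<^bsub>monoid_algebra G\<^esub> g)"
  \<comment> \<open>Testing against the indicator of \<open>k\<close> gives the coefficient of the
    product at \<open>k\<close>; a nonzero double sum must contain a nonzero term.\<close>
  then have "lin_ext (\<lambda>a. lin_ext (\<lambda>b. if a \<otimes>\<^bsub>G\<^esub> b = k then 1 else 0) g) f \<noteq> 0"
    by (simp add: in_keys_iff lin_ext_delta flip: lin_ext_mult[where h = "\<lambda>a. if a = k then 1 else 0"])
  then obtain a b where "a \<in> Poly_Mapping.keys f" "b \<in> Poly_Mapping.keys g" "a \<otimes>\<^bsub>G\<^esub> b = k"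
    unfolding lin_ext_def by (auto elim!: sum.not_neutral_contains_not_neutral split: if_splits)
  then show "k \<in> (\<lambda>(a, b). a \<otimes>\<^bsub>G\<^esub> b) ` (Poly_Mapping.keys f \<times> Poly_Mapping.keys g)"
    by force
qed

lemma complex_algebra_monoid_algebra:
  assumes "monoid G"
  shows "complex_algebra (monoid_algebra G)"
proof -
  interpret monoid G by fact
  let ?A = "monoid_algebra G"
  have mult_closed: "Poly_Mapping.keys (f \<otimes>\<^bsub>?A\<^esub> g) \<subseteq> carrier G"
    if "Poly_Mapping.keys f \<subseteq> carrier G" "Poly_Mapping.keys g \<subseteq> carrier G" for f g
    using that keys_monoid_algebra_mult[of G f g] by fastforce
  have map_closed: "Poly_Mapping.keys (Poly_Mapping.map ((*) z) f) \<subseteq> carrier G"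
    if "Poly_Mapping.keys f \<subseteq> carrier G" for f and z :: complex
    using that by (auto simp: in_keys_iff lookup_map_times)
  have "ring ?A"
  proof (rule ringI)
    show "abelian_group ?A"
    proof (rule abelian_groupI)
      fix x y assume "x \<in> carrier ?A" "y \<in> carrier ?A"
      then show "x \<oplus>\<^bsub>?A\<^esub> y \<in> carrier ?A"
        using keys_add[of x y] by auto
    next
      fix x assume "x \<in> carrier ?A"
      then show "\<exists>y\<in>carrier ?A. y \<oplus>\<^bsub>?A\<^esub> x = \<zero>\<^bsub>?A\<^esub>"
        by (intro bexI[of _ "- x"]) (auto simp: in_keys_iff)
    qed (auto simp: ac_simps)
    show "monoid ?A"
    proof (rule monoidI)
      fix f g h assume "f \<in> carrier ?A" "g \<in> carrier ?A" "h \<in> carrier ?A"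
      then show "f \<otimes>\<^bsub>?A\<^esub> g \<otimes>\<^bsub>?A\<^esub> h = f \<otimes>\<^bsub>?A\<^esub> (g \<otimes>\<^bsub>?A\<^esub> h)"
        by (intro lin_ext_eqI) (auto simp: lin_ext_mult m_assoc subset_iff intro!: lin_ext_cong)
    next
      fix f assume f: "f \<in> carrier ?A"
      show "\<one>\<^bsub>?A\<^esub> \<otimes>\<^bsub>?A\<^esub> f = f"
        by (rule lin_ext_eqI) (use f in \<open>auto simp: lin_ext_mult subset_iff intro!: lin_ext_cong\<close>)
      show "f \<otimes>\<^bsub>?A\<^esub> \<one>\<^bsub>?A\<^esub> = f"
        by (rule lin_ext_eqI) (use f in \<open>auto simp: lin_ext_mult subset_iff intro!: lin_ext_cong\<close>)
    qed (auto simp: mult_closed)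
    fix f g h
    show "(f \<oplus>\<^bsub>?A\<^esub> g) \<otimes>\<^bsub>?A\<^esub> h = f \<otimes>\<^bsub>?A\<^esub> h \<oplus>\<^bsub>?A\<^esub> g \<otimes>\<^bsub>?A\<^esub> h"
      by (intro lin_ext_eqI) (simp add: lin_ext_mult lin_ext_add)
    show "h \<otimes>\<^bsub>?A\<^esub> (f \<oplus>\<^bsub>?A\<^esub> g) = h \<otimes>\<^bsub>?A\<^esub> f \<oplus>\<^bsub>?A\<^esub> h \<otimes>\<^bsub>?A\<^esub> g"
      by (intro lin_ext_eqI) (simp add: lin_ext_mult lin_ext_add lin_ext_fun_add)
  qed
  then show ?thesis
  proof (rule complex_algebra.intro, unfold_locales, goal_cases)
    case (1 x z)
    then show ?case using map_closed by simp
  qed (auto intro!: lin_ext_eqI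
      simp: lin_ext_map lin_ext_mult lin_ext_add lin_ext_fun_scale distrib_left distrib_right)
qed

section \<open>Quotients, presentations and tensor products\<close>

text \<open>Scaling by \<open>z\<close> is multiplication by the algebra element \<open>z\<close>
  times one, so a ring ideal is automatically a complex subspace.\<close>

lemma (in complex_algebra) ideal_smult_closed:
  assumes "ideal J A" "j \<in> J"
  shows "z \<odot> j \<in> J"
proof -
  interpret J: ideal J A by fact
  have "z \<odot> j = (z \<odot> \<one>) \<otimes> j"
    using J.Icarr[OF assms(2)] by (simp add: smult_mult_l)
  then show ?thesis using assms(2) J.I_l_closed by auto
qed

lemma quot_algebra_simps [simp]:
  "carrier (quot_algebra A J) = a_rcosets\<^bsub>A\<^esub> J"
  "mult (quot_algebra A J) = rcoset_mult A J"
  "one (quot_algebra A J) = J +>\<^bsub>A\<^esub> \<one>\<^bsub>A\<^esub>"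
  "zero (quot_algebra A J) = J"
  "add (quot_algebra A J) = set_add A"
  by (simp_all add: quot_algebra_def ring.defs module.defs FactRing_def)

lemma quot_algebra_smult:
  "smult (quot_algebra A J) z X = (\<Union>x\<in>X. J +>\<^bsub>A\<^esub> (z \<odot>\<^bsub>A\<^esub> x))"
  by (simp add: quot_algebra_def ring.defs module.defs)

context complex_algebra begin

text \<open>The union in the definition of the scalar action collapses: all representatives of a
  coset scale into the same coset, because the ideal is a subspace.\<close>

lemma quot_smult_coset:
  assumes "ideal J A" "x \<in> carrier A"
  shows "z \<odot>\<^bsub>quot_algebra A J\<^esub> (J +> x) = J +> (z \<odot> x)"
proof -
  interpret J: ideal J A by fact
  have "J +> (z \<odot> y) = J +> (z \<odot> x)" if y: "y \<in> J +> x" for y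
  proof -
    obtain j where j: "j \<in> J" "y = j \<oplus> x" using y by (auto simp: a_r_coset_def')
    then have "z \<odot> y = z \<odot> j \<oplus> z \<odot> x"
      using J.Icarr assms(2) by (simp add: smult_r_distr)
    then have "z \<odot> y \<in> J +> (z \<odot> x)"
      using ideal_smult_closed[OF assms(1)] j by (auto simp: a_r_coset_def')
    then show ?thesis using J.a_repr_independence' assms(2) by (metis smult_closed)
  qed
  moreover have "x \<in> J +> x" using J.a_rcos_self assms(2) by blast
  ultimately show ?thesis unfolding quot_algebra_smult by (metis (no_types, lifting) SUP_eq_const empty_iff)
qed

lemma quot_coset_mem: "x \<in> carrier A \<Longrightarrow> J +> x \<in> carrier (quot_algebra A J)"
  by (auto simp: A_RCOSETS_def')

lemma quot_carrierE:
  assumes "X \<in> carrier (quot_algebra A J)"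
  obtains x where "x \<in> carrier A" "X = J +> x"
  using assms by (auto simp: A_RCOSETS_def')

lemma quot_coset_add:
  "ideal J A \<Longrightarrow> x \<in> carrier A \<Longrightarrow> y \<in> carrier A \<Longrightarrow>
    (J +> x) \<oplus>\<^bsub>quot_algebra A J\<^esub> (J +> y) = J +> (x \<oplus> y)"
  by (simp add: ideal.a_rcos_sum)

lemma quot_coset_mult:
  "ideal J A \<Longrightarrow> x \<in> carrier A \<Longrightarrow> y \<in> carrier A \<Longrightarrow>
    (J +> x) \<otimes>\<^bsub>quot_algebra A J\<^esub> (J +> y) = J +> (x \<otimes> y)"
  by (simp add: ideal.rcoset_mult_add)

lemma ring_quot_algebra:
  assumes "ideal J A"
  shows "ring (quot_algebra A J)"
proof -
  have "ring (A Quot J)" using assms by (rule ideal.quotient_is_ring)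
  then show ?thesis
    \<comment> \<open>The two records differ only in the scalar multiplication, which no ring axiom
      mentions; after unfolding to the common fields the two statements coincide.\<close>
    unfolding ring_def abelian_group_def abelian_monoid_def abelian_group_axioms_def
      comm_monoid_def comm_monoid_axioms_def comm_group_def group_def group_axioms_def Units_def monoid_def ring_axioms_def
      FactRing_def quot_algebra_simps partial_object.simps monoid.simps ring.simps .
qed

lemma complex_algebra_quot:
  assumes J: "ideal J A"
  shows "complex_algebra (quot_algebra A J)"
proof (rule complex_algebra.intro[OF ring_quot_algebra[OF J]], unfold_locales, goal_cases)
  case (1 x z)
  then show ?case by (metis J quot_carrierE quot_coset_mem quot_smult_coset smult_closed)
next
  case (2 x z w)
  then obtain a where "a \<in> carrier A" "x = J +> a" by (rule quot_carrierE)
  then show ?case using J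
    by (simp add: quot_smult_coset quot_coset_add smult_l_distr del: quot_algebra_simps)
next
  case (3 x y z)
  obtain a where "a \<in> carrier A" "x = J +> a" using 3(1) by (rule quot_carrierE)
  moreover obtain b where "b \<in> carrier A" "y = J +> b" using 3(2) by (rule quot_carrierE)
  ultimately show ?case using J
    by (simp add: quot_smult_coset quot_coset_add smult_r_distr del: quot_algebra_simps)
next
  case (4 x z w)
  then obtain a where "a \<in> carrier A" "x = J +> a" by (rule quot_carrierE)
  then show ?case using J by (simp add: quot_smult_coset smult_smult)
next
  case (5 x)
  then obtain a where "a \<in> carrier A" "x = J +> a" by (rule quot_carrierE)
  then show ?case using J by (simp add: quot_smult_coset)
next
  case (6 x y z)
  obtain a where "a \<in> carrier A" "x = J +> a" using 6(1) by (rule quot_carrierE)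
  moreover obtain b where "b \<in> carrier A" "y = J +> b" using 6(2) by (rule quot_carrierE)
  ultimately show ?case using J
    by (simp add: quot_smult_coset quot_coset_mult smult_mult_l del: quot_algebra_simps)
next
  case (7 x y z)
  obtain a where "a \<in> carrier A" "x = J +> a" using 7(1) by (rule quot_carrierE)
  moreover obtain b where "b \<in> carrier A" "y = J +> b" using 7(2) by (rule quot_carrierE)
  ultimately show ?case using J
    by (simp add: quot_smult_coset quot_coset_mult smult_mult_r del: quot_algebra_simps)
qed

end

lemma free_monoid_simps [simp]:
  "carrier (free_monoid S) = lists S" "x \<otimes>\<^bsub>free_monoid S\<^esub> y = x @ y" "\<one>\<^bsub>free_monoid S\<^esub> = []"
  by (simp_all add: free_monoid_def)

lemma monoid_free_monoid: "monoid (free_monoid S)"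
  by (rule monoidI) auto

lemma complex_algebra_free_algebra: "complex_algebra (free_algebra S)"
  by (rule complex_algebra_monoid_algebra[OF monoid_free_monoid])

lemma map_times_single [simp]:
  "Poly_Mapping.map ((*) z) (Poly_Mapping.single a w) = Poly_Mapping.single a (z * w)" for z w :: complex
  by (rule lin_ext_eqI) (simp add: lin_ext_map mult.assoc)

lemma single_mem_monoid_algebra:
  "a \<in> carrier G \<Longrightarrow> Poly_Mapping.single a z \<in> carrier (monoid_algebra G)"
  by simp

lemma diff_mem_monoid_algebra:
  "f \<in> carrier (monoid_algebra G) \<Longrightarrow> g \<in> carrier (monoid_algebra G) \<Longrightarrow>
    f - g \<in> carrier (monoid_algebra G)"
  using keys_diff[of f g] by auto

lemma add_mem_monoid_algebra:
  "f \<in> carrier (monoid_algebra G) \<Longrightarrow> g \<in> carrier (monoid_algebra G) \<Longrightarrow>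
    f + g \<in> carrier (monoid_algebra G)"
  using keys_add[of f g] by auto

lemma coset_eq_if_diff_mem:
  assumes "monoid G" "ideal J (monoid_algebra G)" "f - g \<in> J" "g \<in> carrier (monoid_algebra G)"
  shows "J +>\<^bsub>monoid_algebra G\<^esub> f = J +>\<^bsub>monoid_algebra G\<^esub> g"
proof -
  interpret J: ideal J "monoid_algebra G" by fact
  have "f \<in> J +>\<^bsub>monoid_algebra G\<^esub> g"
    using assms(3) by (auto simp: a_r_coset_def' intro!: bexI[of _ "f - g"])
  then show ?thesis using J.a_repr_independence' assms(4) by metis
qed

locale presentation =
  fixes S :: "'g set" and rels :: "('g list \<Rightarrow>\<^sub>0 complex) set"
  assumes rels_subset: "rels \<subseteq> carrier (free_algebra S)"
begin

sublocale F: complex_algebra "free_algebra S"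
  by (rule complex_algebra_free_algebra)

abbreviation J where "J \<equiv> Idl\<^bsub>free_algebra S\<^esub> rels"
abbreviation cls where "cls \<equiv> presented_class S rels"

lemma ideal_J: "ideal J (free_algebra S)"
  by (rule F.genideal_ideal[OF rels_subset])

sublocale Q: complex_algebra "presented_algebra S rels"
  unfolding presented_algebra_def by (rule F.complex_algebra_quot[OF ideal_J])

lemma cls_mem: "f \<in> carrier (free_algebra S) \<Longrightarrow> cls f \<in> carrier (presented_algebra S rels)"
  unfolding presented_algebra_def presented_class_def by (rule F.quot_coset_mem)

lemma cls_add:
  "f \<in> carrier (free_algebra S) \<Longrightarrow> g \<in> carrier (free_algebra S) \<Longrightarrow>
    cls (f + g) = cls f \<oplus>\<^bsub>presented_algebra S rels\<^esub> cls g"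
  unfolding presented_algebra_def presented_class_def
  by (subst F.quot_coset_add[OF ideal_J]) simp_all

lemma cls_mult:
  "f \<in> carrier (free_algebra S) \<Longrightarrow> g \<in> carrier (free_algebra S) \<Longrightarrow>
    cls (f \<otimes>\<^bsub>free_algebra S\<^esub> g) = cls f \<otimes>\<^bsub>presented_algebra S rels\<^esub> cls g"
  unfolding presented_algebra_def presented_class_def
  by (subst F.quot_coset_mult[OF ideal_J]) simp_all

lemma cls_smult:
  "f \<in> carrier (free_algebra S) \<Longrightarrow>
    cls (z \<odot>\<^bsub>free_algebra S\<^esub> f) = z \<odot>\<^bsub>presented_algebra S rels\<^esub> cls f"
  unfolding presented_algebra_def presented_class_def
  by (subst F.quot_smult_coset[OF ideal_J]) simp_all

lemma cls_one: "cls (word []) = \<one>\<^bsub>presented_algebra S rels\<^esub>"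
  by (simp add: presented_algebra_def presented_class_def)

lemma cls_eqI:
  "f - g \<in> rels \<Longrightarrow> g \<in> carrier (free_algebra S) \<Longrightarrow> cls f = cls g"
  unfolding presented_class_def
  using F.genideal_self[OF rels_subset]
  by (intro coset_eq_if_diff_mem[OF monoid_free_monoid ideal_J]) auto

lemma cls_word_append:
  "u \<in> lists S \<Longrightarrow> v \<in> lists S \<Longrightarrow>
    cls (word (u @ v)) = cls (word u) \<otimes>\<^bsub>presented_algebra S rels\<^esub> cls (word v)"
  by (subst cls_mult[symmetric]) simp_all

lemma cls_single:
  "u \<in> lists S \<Longrightarrow>
    cls (Poly_Mapping.single u z) = z \<odot>\<^bsub>presented_algebra S rels\<^esub> cls (word u)"
  by (subst cls_smult[symmetric]) simp_all

end

text \<open>The subtracted terms are grouped so that the relation reads as one element minus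
  another, which is what equality of cosets asks for.\<close>

lemma tensor_rels_add_l:
  "a \<in> carrier A \<Longrightarrow> a' \<in> carrier A \<Longrightarrow> b \<in> carrier B \<Longrightarrow>
    Poly_Mapping.single (a \<oplus>\<^bsub>A\<^esub> a', b) 1
      - (Poly_Mapping.single (a, b) 1 + Poly_Mapping.single (a', b) 1) \<in> tensor_rels A B"
  unfolding tensor_rels_def diff_diff_eq[symmetric] by blast

lemma tensor_rels_add_r:
  "a \<in> carrier A \<Longrightarrow> b \<in> carrier B \<Longrightarrow> b' \<in> carrier B \<Longrightarrow>
    Poly_Mapping.single (a, b \<oplus>\<^bsub>B\<^esub> b') 1
      - (Poly_Mapping.single (a, b) 1 + Poly_Mapping.single (a, b') 1) \<in> tensor_rels A B"
  unfolding tensor_rels_def diff_diff_eq[symmetric] by blast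

lemma tensor_rels_smult_l:
  "a \<in> carrier A \<Longrightarrow> b \<in> carrier B \<Longrightarrow>
    Poly_Mapping.single (z \<odot>\<^bsub>A\<^esub> a, b) 1 - Poly_Mapping.single (a, b) z \<in> tensor_rels A B"
  unfolding tensor_rels_def by blast

lemma tensor_rels_smult_r:
  "a \<in> carrier A \<Longrightarrow> b \<in> carrier B \<Longrightarrow>
    Poly_Mapping.single (a, z \<odot>\<^bsub>B\<^esub> b) 1 - Poly_Mapping.single (a, b) z \<in> tensor_rels A B"
  unfolding tensor_rels_def by blast

locale complex_algebra_pair = A: complex_algebra A + B: complex_algebra B
  for A :: "(complex, 'x) module" and B :: "(complex, 'y) module"
begin

abbreviation pairs where "pairs \<equiv> monoid_algebra (A \<times>\<times> B)"
abbreviation K where "K \<equiv> Idl\<^bsub>pairs\<^esub> (tensor_rels A B)"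
abbreviation AB where "AB \<equiv> tensor_algebra A B"
abbreviation tn where "tn \<equiv> tens A B"

lemma monoid_pairs: "monoid (A \<times>\<times> B)"
  by (rule DirProd_monoid) unfold_locales

sublocale P: complex_algebra pairs
  by (rule complex_algebra_monoid_algebra[OF monoid_pairs])

lemma tensor_rels_subset: "tensor_rels A B \<subseteq> carrier pairs"
  unfolding tensor_rels_def
  by (auto simp del: monoid_algebra_simps
      intro!: diff_mem_monoid_algebra single_mem_monoid_algebra)

lemma ideal_K: "ideal K pairs"
  by (rule P.genideal_ideal[OF tensor_rels_subset])

sublocale AB: complex_algebra AB
  unfolding tensor_algebra_def by (rule P.complex_algebra_quot[OF ideal_K])

lemma single_pair_mem:
  "a \<in> carrier A \<Longrightarrow> b \<in> carrier B \<Longrightarrow> Poly_Mapping.single (a, b) z \<in> carrier pairs"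
  by (intro single_mem_monoid_algebra) simp

lemma tens_mem [simp, intro]: "a \<in> carrier A \<Longrightarrow> b \<in> carrier B \<Longrightarrow> tn a b \<in> carrier AB"
  unfolding tensor_algebra_def tens_def by (intro P.quot_coset_mem single_pair_mem)

lemma tens_mult:
  "a \<in> carrier A \<Longrightarrow> b \<in> carrier B \<Longrightarrow> a' \<in> carrier A \<Longrightarrow> b' \<in> carrier B \<Longrightarrow>
    tn a b \<otimes>\<^bsub>AB\<^esub> tn a' b' = tn (a \<otimes>\<^bsub>A\<^esub> a') (b \<otimes>\<^bsub>B\<^esub> b')"
  unfolding tensor_algebra_def tens_def
  by (subst P.quot_coset_mult[OF ideal_K single_pair_mem single_pair_mem]) simp_all

lemma coset_eq_if_tensor_rel:
  "f - g \<in> tensor_rels A B \<Longrightarrow> g \<in> carrier pairs \<Longrightarrow> K +>\<^bsub>pairs\<^esub> f = K +>\<^bsub>pairs\<^esub> g"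
  using P.genideal_self[OF tensor_rels_subset]
  by (intro coset_eq_if_diff_mem[OF monoid_pairs ideal_K]) auto

lemma tens_add_l:
  assumes "a \<in> carrier A" "a' \<in> carrier A" "b \<in> carrier B"
  shows "tn (a \<oplus>\<^bsub>A\<^esub> a') b = tn a b \<oplus>\<^bsub>AB\<^esub> tn a' b"
proof -
  have "K +>\<^bsub>pairs\<^esub> Poly_Mapping.single (a \<oplus>\<^bsub>A\<^esub> a', b) 1 = K +>\<^bsub>pairs\<^esub> (Poly_Mapping.single (a, b) 1 + Poly_Mapping.single (a', b) 1)"
  proof (rule coset_eq_if_tensor_rel)
    show "Poly_Mapping.single (a \<oplus>\<^bsub>A\<^esub> a', b) 1 - (Poly_Mapping.single (a, b) 1 + Poly_Mapping.single (a', b) 1) \<in> tensor_rels A B"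
      using assms by (rule tensor_rels_add_l)
    show "Poly_Mapping.single (a, b) 1 + Poly_Mapping.single (a', b) 1 \<in> carrier pairs"
      using assms by (intro add_mem_monoid_algebra single_pair_mem)
  qed
  then show ?thesis
    unfolding tensor_algebra_def tens_def
    by (simp only: P.quot_coset_add[OF ideal_K single_pair_mem single_pair_mem] assms monoid_algebra_simps)
qed

lemma tens_add_r:
  assumes "a \<in> carrier A" "b \<in> carrier B" "b' \<in> carrier B"
  shows "tn a (b \<oplus>\<^bsub>B\<^esub> b') = tn a b \<oplus>\<^bsub>AB\<^esub> tn a b'"
proof -
  have "K +>\<^bsub>pairs\<^esub> Poly_Mapping.single (a, b \<oplus>\<^bsub>B\<^esub> b') 1 = K +>\<^bsub>pairs\<^esub> (Poly_Mapping.single (a, b) 1 + Poly_Mapping.single (a, b') 1)"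
  proof (rule coset_eq_if_tensor_rel)
    show "Poly_Mapping.single (a, b \<oplus>\<^bsub>B\<^esub> b') 1 - (Poly_Mapping.single (a, b) 1 + Poly_Mapping.single (a, b') 1) \<in> tensor_rels A B"
      using assms by (rule tensor_rels_add_r)
    show "Poly_Mapping.single (a, b) 1 + Poly_Mapping.single (a, b') 1 \<in> carrier pairs"
      using assms by (intro add_mem_monoid_algebra single_pair_mem)
  qed
  then show ?thesis
    unfolding tensor_algebra_def tens_def
    by (simp only: P.quot_coset_add[OF ideal_K single_pair_mem single_pair_mem] assms monoid_algebra_simps)
qed

lemma coset_single:
  assumes "a \<in> carrier A" "b \<in> carrier B"
  shows "K +>\<^bsub>pairs\<^esub> Poly_Mapping.single (a, b) z = z \<odot>\<^bsub>AB\<^esub> tn a b"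
  unfolding tensor_algebra_def tens_def
  using assms by (subst P.quot_smult_coset[OF ideal_K single_pair_mem]) simp_all

lemma tens_smult_l:
  assumes "a \<in> carrier A" "b \<in> carrier B"
  shows "tn (z \<odot>\<^bsub>A\<^esub> a) b = z \<odot>\<^bsub>AB\<^esub> tn a b"
proof -
  have "K +>\<^bsub>pairs\<^esub> Poly_Mapping.single (z \<odot>\<^bsub>A\<^esub> a, b) 1 = K +>\<^bsub>pairs\<^esub> Poly_Mapping.single (a, b) z"
    using assms by (intro coset_eq_if_tensor_rel single_pair_mem tensor_rels_smult_l)
  then show ?thesis unfolding coset_single[OF assms] by (subst tens_def)
qed

lemma tens_smult_r:
  assumes "a \<in> carrier A" "b \<in> carrier B"
  shows "tn a (z \<odot>\<^bsub>B\<^esub> b) = z \<odot>\<^bsub>AB\<^esub> tn a b"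
proof -
  have "K +>\<^bsub>pairs\<^esub> Poly_Mapping.single (a, z \<odot>\<^bsub>B\<^esub> b) 1 = K +>\<^bsub>pairs\<^esub> Poly_Mapping.single (a, b) z"
    using assms by (intro coset_eq_if_tensor_rel single_pair_mem tensor_rels_smult_r)
  then show ?thesis unfolding coset_single[OF assms] by (subst tens_def)
qed

lemma tens_finsum_l:
  assumes "\<And>i. i \<in> S \<Longrightarrow> f i \<in> carrier A" "b \<in> carrier B"
  shows "tn (finsum A f S) b = (\<Oplus>\<^bsub>AB\<^esub>i\<in>S. tn (f i) b)"
  using assms
  by (intro additive_finsum[where h = "\<lambda>a. tn a b"] A.abelian_group_axioms AB.abelian_group_axioms)
    (auto simp: tens_add_l)

lemma tens_finsum_r:
  assumes "a \<in> carrier A" "\<And>i. i \<in> S \<Longrightarrow> f i \<in> carrier B"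
  shows "tn a (finsum B f S) = (\<Oplus>\<^bsub>AB\<^esub>i\<in>S. tn a (f i))"
  using assms
  by (intro additive_finsum[where h = "\<lambda>b. tn a b"] B.abelian_group_axioms AB.abelian_group_axioms)
    (auto simp: tens_add_r)

lemma tens_neg_r: "a \<in> carrier A \<Longrightarrow> b \<in> carrier B \<Longrightarrow> tn a (\<ominus>\<^bsub>B\<^esub> b) = \<ominus>\<^bsub>AB\<^esub> tn a b"
  by (simp add: tens_smult_r flip: B.smult_minus_one AB.smult_minus_one)

end

section \<open>Real-linear maps into complex algebras\<close>

text \<open>The dual bases are real, so the Dirac sums involve vectors, correction terms and tilde
  elements only at real arguments. This one notion covers the maps into both tensor factors.\<close>

definition rlin :: "(complex, 'x) module \<Rightarrow> ('b::real_vector \<Rightarrow> 'x) \<Rightarrow> bool" where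
  "rlin A f \<longleftrightarrow> (\<forall>v. f v \<in> carrier A) \<and> (\<forall>v w. f (v + w) = f v \<oplus>\<^bsub>A\<^esub> f w) \<and>
     (\<forall>r v. f (r *\<^sub>R v) = complex_of_real r \<odot>\<^bsub>A\<^esub> f v)"

lemma rlin_mem: "rlin A f \<Longrightarrow> f v \<in> carrier A"
  and rlin_add: "rlin A f \<Longrightarrow> f (v + w) = f v \<oplus>\<^bsub>A\<^esub> f w"
  and rlin_scale: "rlin A f \<Longrightarrow> f (r *\<^sub>R v) = complex_of_real r \<odot>\<^bsub>A\<^esub> f v"
  by (simp_all add: rlin_def)

context complex_algebra begin

lemma rlin_zero:
  assumes "rlin A f" shows "f 0 = \<zero>"
  using rlin_scale[OF assms, of 0 0] rlin_mem[OF assms] by simp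

lemma rlin_sum:
  assumes "rlin A f"
  shows "f (\<Sum>i\<in>S. r i *\<^sub>R v i) = (\<Oplus>i\<in>S. complex_of_real (r i) \<odot> f (v i))"
proof (induction S rule: infinite_finite_induct)
  case (insert i S)
  then show ?case
    using assms by (simp add: rlin_add rlin_scale Pi_def rlin_mem)
qed (simp_all add: rlin_zero[OF assms])

end

section \<open>Geometry of the root system\<close>

locale root_setup =
  fixes \<Phi> :: "('a::real_vector, 'b::real_vector) root_datum"
    and Rp \<Delta> :: "'a set"
    and c :: "'a \<Rightarrow> real"
    and ip :: "'b \<Rightarrow> 'b \<Rightarrow> real"
  assumes root_system: "reduced_root_system \<Phi>"
    and positive: "positive_roots_with_simple \<Phi> Rp \<Delta>"
    and parameter: "weyl_invariant_parameter \<Phi> c"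
    and inner: "weyl_invariant_inner_product \<Phi> ip"
begin

lemma linear_pairing_r: "linear (pairing \<Phi> v)" and linear_pairing_l: "linear (\<lambda>v. pairing \<Phi> v y)"
  using root_system by (auto simp: reduced_root_system_def perfect_pairing_def)

lemmas pairing_simps =
  linear_add[OF linear_pairing_r] linear_diff[OF linear_pairing_r] linear_scale[OF linear_pairing_r]
  linear_add[OF linear_pairing_l] linear_diff[OF linear_pairing_l] linear_scale[OF linear_pairing_l]

lemma linear_ip_r: "linear (ip x)" and ip_commute: "ip x y = ip y x"
  and ip_pos: "x \<noteq> 0 \<Longrightarrow> 0 < ip x x"
  and ip_weyl: "w \<in> carrier (weyl \<Phi>) \<Longrightarrow> ip (w x) (w y) = ip x y"
  using inner by (auto simp: weyl_invariant_inner_product_def)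

lemma linear_ip_l: "linear (\<lambda>x. ip x y)"
  unfolding ip_commute[of _ y] by (rule linear_ip_r)

lemmas ip_simps =
  linear_add[OF linear_ip_r] linear_diff[OF linear_ip_r] linear_scale[OF linear_ip_r]
  linear_add[OF linear_ip_l] linear_diff[OF linear_ip_l] linear_scale[OF linear_ip_l]

lemma ip_eqI:
  assumes "\<And>z. ip x z = ip y z" shows "x = y"
proof (rule ccontr)
  assume "x \<noteq> y"
  then have "0 < ip (x - y) (x - y)" by (intro ip_pos) simp
  then show False using assms by (simp add: linear_diff[OF linear_ip_l])
qed

lemma pairing_coroot_self: "\<alpha> \<in> roots \<Phi> \<Longrightarrow> pairing \<Phi> \<alpha> (coroot \<Phi> \<alpha>) = 2"
  using root_system by (auto simp: reduced_root_system_def)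

lemma finite_roots: "finite (roots \<Phi>)"
  using root_system by (auto simp: reduced_root_system_def)

lemma refl_mem: "\<alpha> \<in> roots \<Phi> \<Longrightarrow> \<beta> \<in> roots \<Phi> \<Longrightarrow> refl \<Phi> \<alpha> \<beta> \<in> roots \<Phi>"
  using root_system unfolding reduced_root_system_def by blast

lemma reduced: "\<alpha> \<in> roots \<Phi> \<Longrightarrow> r *\<^sub>R \<alpha> \<in> roots \<Phi> \<Longrightarrow> r = 1 \<or> r = -1"
  using root_system by (auto simp: reduced_root_system_def)

lemma coroot_nonzero: "\<alpha> \<in> roots \<Phi> \<Longrightarrow> coroot \<Phi> \<alpha> \<noteq> 0"
  using pairing_coroot_self[of \<alpha>] linear_0[OF linear_pairing_r] by auto

lemma ip_coroot_pos: "\<alpha> \<in> roots \<Phi> \<Longrightarrow> 0 < ip (coroot \<Phi> \<alpha>) (coroot \<Phi> \<alpha>)"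
  by (intro ip_pos coroot_nonzero)

lemma linear_corefl: "linear (corefl \<Phi> \<alpha>)"
  by (rule linearI) (simp_all add: corefl_def pairing_simps algebra_simps)

lemma corefl_corefl: "\<alpha> \<in> roots \<Phi> \<Longrightarrow> corefl \<Phi> \<alpha> (corefl \<Phi> \<alpha> y) = y"
  by (simp add: corefl_def pairing_simps pairing_coroot_self algebra_simps)

lemma refl_refl: "\<alpha> \<in> roots \<Phi> \<Longrightarrow> refl \<Phi> \<alpha> (refl \<Phi> \<alpha> v) = v"
  by (simp add: refl_def pairing_simps pairing_coroot_self algebra_simps)

lemma corefl_coroot: "\<alpha> \<in> roots \<Phi> \<Longrightarrow> corefl \<Phi> \<alpha> (coroot \<Phi> \<alpha>) = - coroot \<Phi> \<alpha>"
  by (simp add: corefl_def pairing_coroot_self scaleR_2)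

lemma refl_self: "\<alpha> \<in> roots \<Phi> \<Longrightarrow> refl \<Phi> \<alpha> \<alpha> = - \<alpha>"
  by (simp add: refl_def pairing_coroot_self scaleR_2)

lemma pairing_refl_corefl:
  "\<alpha> \<in> roots \<Phi> \<Longrightarrow> pairing \<Phi> (refl \<Phi> \<alpha> v) (corefl \<Phi> \<alpha> y) = pairing \<Phi> v y"
  by (simp add: refl_def corefl_def pairing_simps pairing_coroot_self algebra_simps)

lemma pairing_corefl: "\<alpha> \<in> roots \<Phi> \<Longrightarrow> pairing \<Phi> v (corefl \<Phi> \<alpha> y) = pairing \<Phi> (refl \<Phi> \<alpha> v) y"
  using pairing_refl_corefl[of \<alpha> "refl \<Phi> \<alpha> v" y] by (simp add: refl_refl)

lemma corefl_Bij: "\<alpha> \<in> roots \<Phi> \<Longrightarrow> corefl \<Phi> \<alpha> \<in> carrier (BijGroup UNIV)"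
  by (auto simp: BijGroup_def Bij_def corefl_corefl intro!: o_bij[of "corefl \<Phi> \<alpha>"])

lemma corefl_weyl: "\<alpha> \<in> roots \<Phi> \<Longrightarrow> corefl \<Phi> \<alpha> \<in> carrier (weyl \<Phi>)"
  unfolding weyl_def by (simp add: generate.incl)

lemma weyl_one: "\<one>\<^bsub>weyl \<Phi>\<^esub> \<in> carrier (weyl \<Phi>)"
  unfolding weyl_def by (simp add: generate.one)

text \<open>The product of \<open>BijGroup\<close> is composition restricted to bijections;
  membership in \<open>Bij UNIV\<close> is what turns it into plain \<open>\<circ>\<close>.\<close>

lemma weyl_subset: "carrier (weyl \<Phi>) \<subseteq> Bij UNIV"
proof -
  interpret group "BijGroup UNIV :: ('b \<Rightarrow> 'b) monoid" by (rule group_BijGroup)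
  have "generate (BijGroup UNIV) (corefl \<Phi> ` roots \<Phi>) \<subseteq> carrier (BijGroup UNIV)"
    by (rule generate_incl) (auto simp: corefl_Bij)
  then show ?thesis by (simp add: weyl_def BijGroup_def)
qed

lemma weyl_mult:
  "u \<in> carrier (weyl \<Phi>) \<Longrightarrow> v \<in> carrier (weyl \<Phi>) \<Longrightarrow> u \<otimes>\<^bsub>weyl \<Phi>\<^esub> v = u \<circ> v"
  using weyl_subset by (auto simp: weyl_def BijGroup_def compose_def)

lemma weyl_mult_closed:
  "u \<in> carrier (weyl \<Phi>) \<Longrightarrow> v \<in> carrier (weyl \<Phi>) \<Longrightarrow> u \<circ> v \<in> carrier (weyl \<Phi>)"
  by (subst weyl_mult[symmetric]) (auto simp: weyl_def intro: generate.eng)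

lemma weyl_one_eq: "\<one>\<^bsub>weyl \<Phi>\<^esub> = id"
  by (auto simp: weyl_def BijGroup_def)

lemma ip_corefl: "\<alpha> \<in> roots \<Phi> \<Longrightarrow> ip (corefl \<Phi> \<alpha> x) (corefl \<Phi> \<alpha> y) = ip x y"
  by (rule ip_weyl[OF corefl_weyl])

lemma ip_corefl_l: "\<alpha> \<in> roots \<Phi> \<Longrightarrow> ip (corefl \<Phi> \<alpha> x) y = ip x (corefl \<Phi> \<alpha> y)"
  using ip_corefl[of \<alpha> x "corefl \<Phi> \<alpha> y"] by (simp add: corefl_corefl)

text \<open>The reflection is orthogonal and negates its coroot. Comparing both facts shows that the
  coroot represents \<alpha> up to a positive factor.\<close>

lemma ip_coroot:
  assumes "\<alpha> \<in> roots \<Phi>"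
  shows "ip (coroot \<Phi> \<alpha>) y = ip (coroot \<Phi> \<alpha>) (coroot \<Phi> \<alpha>) / 2 * pairing \<Phi> \<alpha> y"
proof -
  have "ip (coroot \<Phi> \<alpha>) y = ip (- coroot \<Phi> \<alpha>) (corefl \<Phi> \<alpha> y)"
    using ip_corefl[OF assms, of "coroot \<Phi> \<alpha>" y] by (simp add: corefl_coroot[OF assms])
  also have "\<dots> = - ip (coroot \<Phi> \<alpha>) y + pairing \<Phi> \<alpha> y * ip (coroot \<Phi> \<alpha>) (coroot \<Phi> \<alpha>)"
    by (simp add: corefl_def linear_neg[OF linear_ip_l] ip_simps)
  finally show ?thesis by (simp add: mult.commute)
qed

text \<open>Equivariance of the coroot map is not an axiom. Both sides represent the root
  \<open>refl \<Phi> \<alpha> \<beta>\<close> under the inner product up to a factor, hence are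
  proportional, and both pair to 2 with that root.\<close>

lemma coroot_refl:
  assumes "\<alpha> \<in> roots \<Phi>" "\<beta> \<in> roots \<Phi>"
  shows "coroot \<Phi> (refl \<Phi> \<alpha> \<beta>) = corefl \<Phi> \<alpha> (coroot \<Phi> \<beta>)"
proof -
  define x where "x = coroot \<Phi> (refl \<Phi> \<alpha> \<beta>)"
  define y where "y = corefl \<Phi> \<alpha> (coroot \<Phi> \<beta>)"
  have g: "refl \<Phi> \<alpha> \<beta> \<in> roots \<Phi>" using assms by (rule refl_mem)
  have yy: "ip y y = ip (coroot \<Phi> \<beta>) (coroot \<Phi> \<beta>)"
    unfolding y_def using assms(1) by (rule ip_corefl)
  have x: "ip x z = ip x x / 2 * pairing \<Phi> (refl \<Phi> \<alpha> \<beta>) z" for z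
    unfolding x_def by (rule ip_coroot[OF g])
  have y: "ip y z = ip y y / 2 * pairing \<Phi> (refl \<Phi> \<alpha> \<beta>) z" for z
    unfolding yy using ip_coroot[OF assms(2), of "corefl \<Phi> \<alpha> z"] assms(1)
    by (simp add: y_def ip_corefl_l pairing_corefl)
  have eq: "ip y y *\<^sub>R x = ip x x *\<^sub>R y"
    proof (rule ip_eqI)
    fix z
    show "ip (ip y y *\<^sub>R x) z = ip (ip x x *\<^sub>R y) z"
      unfolding ip_simps by (subst x, subst y) simp
  qed
  have "pairing \<Phi> (refl \<Phi> \<alpha> \<beta>) x = 2" "pairing \<Phi> (refl \<Phi> \<alpha> \<beta>) y = 2"
    unfolding x_def y_def using g assms by (simp_all add: pairing_coroot_self pairing_refl_corefl)
  with arg_cong[OF eq, of "pairing \<Phi> (refl \<Phi> \<alpha> \<beta>)"] have "ip y y = ip x x"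
    by (simp add: pairing_simps)
  moreover have "0 < ip x x" unfolding x_def by (rule ip_coroot_pos[OF g])
  ultimately show ?thesis using eq by (simp add: x_def y_def)
qed

lemma corefl_refl:
  assumes "\<alpha> \<in> roots \<Phi>" "\<beta> \<in> roots \<Phi>"
  shows "corefl \<Phi> (refl \<Phi> \<alpha> \<beta>) y = corefl \<Phi> \<alpha> (corefl \<Phi> \<beta> (corefl \<Phi> \<alpha> y))"
proof -
  have "corefl \<Phi> \<alpha> (corefl \<Phi> \<beta> (corefl \<Phi> \<alpha> y)) =
      corefl \<Phi> \<alpha> (corefl \<Phi> \<alpha> y) - pairing \<Phi> \<beta> (corefl \<Phi> \<alpha> y) *\<^sub>R corefl \<Phi> \<alpha> (coroot \<Phi> \<beta>)"
    by (simp add: corefl_def[of _ \<beta>] linear_diff[OF linear_corefl] linear_scale[OF linear_corefl])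
  then show ?thesis
    using assms by (simp add: corefl_corefl pairing_corefl corefl_def[of _ "refl \<Phi> \<alpha> \<beta>"] coroot_refl)
qed

lemma corefl_comp_swap:
  assumes "\<alpha> \<in> roots \<Phi>" "\<beta> \<in> roots \<Phi>"
  shows "corefl \<Phi> \<alpha> \<circ> corefl \<Phi> \<beta> = corefl \<Phi> (refl \<Phi> \<alpha> \<beta>) \<circ> corefl \<Phi> \<alpha>"
  using assms by (auto simp: corefl_refl corefl_corefl)

lemma c_refl: "\<alpha> \<in> roots \<Phi> \<Longrightarrow> \<beta> \<in> roots \<Phi> \<Longrightarrow> c (refl \<Phi> \<alpha> \<beta>) = c \<beta>"
  using parameter unfolding weyl_invariant_parameter_def weyl_on_roots_def
  by (simp add: generate.incl)

text \<open>Both pairings are positive multiples of the inner product of the two coroots.\<close>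

lemma pairing_coroot_symmetric:
  assumes "\<alpha> \<in> roots \<Phi>" "\<beta> \<in> roots \<Phi>"
  shows pairing_coroot_pos_iff:
      "0 < pairing \<Phi> \<alpha> (coroot \<Phi> \<beta>) \<longleftrightarrow> 0 < pairing \<Phi> \<beta> (coroot \<Phi> \<alpha>)"
    and pairing_coroot_zero_iff:
      "pairing \<Phi> \<alpha> (coroot \<Phi> \<beta>) = 0 \<longleftrightarrow> pairing \<Phi> \<beta> (coroot \<Phi> \<alpha>) = 0"
proof -
  define a where "a = ip (coroot \<Phi> \<alpha>) (coroot \<Phi> \<alpha>)"
  define b where "b = ip (coroot \<Phi> \<beta>) (coroot \<Phi> \<beta>)"
  have eq: "a / 2 * pairing \<Phi> \<alpha> (coroot \<Phi> \<beta>) = b / 2 * pairing \<Phi> \<beta> (coroot \<Phi> \<alpha>)"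
    unfolding a_def b_def ip_coroot[OF assms(1), symmetric] ip_coroot[OF assms(2), symmetric]
    by (rule ip_commute)
  have pos: "0 < a / 2" "0 < b / 2" unfolding a_def b_def using assms by (auto intro: ip_coroot_pos)
  show "0 < pairing \<Phi> \<alpha> (coroot \<Phi> \<beta>) \<longleftrightarrow> 0 < pairing \<Phi> \<beta> (coroot \<Phi> \<alpha>)"
    using eq pos by (metis zero_less_mult_pos mult_pos_pos)
  show "pairing \<Phi> \<alpha> (coroot \<Phi> \<beta>) = 0 \<longleftrightarrow> pairing \<Phi> \<beta> (coroot \<Phi> \<alpha>) = 0"
    using eq pos by (metis less_irrefl mult_eq_0_iff)
qed

section \<open>Simple roots, positivity and height\<close>

definition coord :: "'a \<Rightarrow> 'a \<Rightarrow> real" where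
  "coord v \<alpha> = representation \<Delta> v \<alpha>"

lemma simple_subset: "\<Delta> \<subseteq> roots \<Phi>" and indep: "independent \<Delta>" and span_simple: "span \<Delta> = UNIV"
  and roots_eq: "roots \<Phi> = Rp \<union> uminus ` Rp"
  using positive unfolding positive_roots_with_simple_def by argo+

lemma finite_simple: "finite \<Delta>"
  using finite_roots simple_subset by (rule rev_finite_subset)

lemma coord_add: "coord (v + w) \<alpha> = coord v \<alpha> + coord w \<alpha>"
  and coord_diff: "coord (v - w) \<alpha> = coord v \<alpha> - coord w \<alpha>"
  and coord_neg: "coord (- v) \<alpha> = - coord v \<alpha>"
  and coord_scale: "coord (r *\<^sub>R v) \<alpha> = r * coord v \<alpha>"
  by (simp_all add: coord_def span_simple representation_add[OF indep] representation_diff[OF indep]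
      representation_neg[OF indep] representation_scale[OF indep])

lemma coord_simple: "\<alpha> \<in> \<Delta> \<Longrightarrow> coord \<alpha> \<gamma> = (if \<gamma> = \<alpha> then 1 else 0)"
  by (auto simp: coord_def representation_basis[OF indep])

lemma sum_coord: "(\<Sum>\<alpha>\<in>\<Delta>. coord v \<alpha> *\<^sub>R \<alpha>) = v"
  unfolding coord_def by (rule sum_representation_eq[OF indep]) (auto simp: span_simple finite_simple)

lemma coord_sum:
  assumes "\<alpha> \<in> \<Delta>"
  shows "coord (\<Sum>\<gamma>\<in>\<Delta>. k \<gamma> *\<^sub>R \<gamma>) \<alpha> = k \<alpha>"
proof -
  have "linear (\<lambda>v. coord v \<alpha>)"
    by (rule linearI) (simp_all add: coord_add coord_scale)
  then have "coord (\<Sum>\<gamma>\<in>\<Delta>. k \<gamma> *\<^sub>R \<gamma>) \<alpha> = (\<Sum>\<gamma>\<in>\<Delta>. k \<gamma> * coord \<gamma> \<alpha>)"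
    by (simp add: linear_sum[of "\<lambda>v. coord v \<alpha>"] coord_scale)
  also have "\<dots> = (\<Sum>\<gamma>\<in>\<Delta>. if \<gamma> = \<alpha> then k \<alpha> else 0)"
    by (rule sum.cong) (auto simp: coord_simple)
  finally show ?thesis using assms finite_simple by simp
qed

text \<open>Independence of the simple roots makes the coefficients unique, so positivity becomes a
  sign condition on coordinates.\<close>

lemma positive_iff: "\<beta> \<in> Rp \<longleftrightarrow> \<beta> \<in> roots \<Phi> \<and> (\<forall>\<alpha>\<in>\<Delta>. 0 \<le> coord \<beta> \<alpha>)"
proof -
  have "Rp = {\<beta> \<in> roots \<Phi>. \<exists>k. (\<forall>\<alpha>\<in>\<Delta>. 0 \<le> k \<alpha>) \<and> \<beta> = (\<Sum>\<alpha>\<in>\<Delta>. k \<alpha> *\<^sub>R \<alpha>)}"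
    using positive unfolding positive_roots_with_simple_def by (elim conjE)
  then have "\<beta> \<in> Rp \<longleftrightarrow> \<beta> \<in> roots \<Phi> \<and>
      (\<exists>k. (\<forall>\<alpha>\<in>\<Delta>. 0 \<le> k \<alpha>) \<and> \<beta> = (\<Sum>\<alpha>\<in>\<Delta>. k \<alpha> *\<^sub>R \<alpha>))" by blast
  also have "(\<exists>k. (\<forall>\<alpha>\<in>\<Delta>. 0 \<le> k \<alpha>) \<and> \<beta> = (\<Sum>\<alpha>\<in>\<Delta>. k \<alpha> *\<^sub>R \<alpha>)) \<longleftrightarrow>
      (\<forall>\<alpha>\<in>\<Delta>. 0 \<le> coord \<beta> \<alpha>)"
  proof
    assume "\<exists>k. (\<forall>\<alpha>\<in>\<Delta>. 0 \<le> k \<alpha>) \<and> \<beta> = (\<Sum>\<alpha>\<in>\<Delta>. k \<alpha> *\<^sub>R \<alpha>)"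
    then show "\<forall>\<alpha>\<in>\<Delta>. 0 \<le> coord \<beta> \<alpha>" by (auto simp: coord_sum)
  next
    assume "\<forall>\<alpha>\<in>\<Delta>. 0 \<le> coord \<beta> \<alpha>"
    then show "\<exists>k. (\<forall>\<alpha>\<in>\<Delta>. 0 \<le> k \<alpha>) \<and> \<beta> = (\<Sum>\<alpha>\<in>\<Delta>. k \<alpha> *\<^sub>R \<alpha>)"
      by (intro exI[of _ "coord \<beta>"] conjI sum_coord[symmetric])
  qed
  finally show ?thesis .
qed

lemma positive_roots: "\<beta> \<in> Rp \<Longrightarrow> \<beta> \<in> roots \<Phi>"
  by (simp add: positive_iff)

lemma finite_positive: "finite Rp"
  using finite_roots by (rule rev_finite_subset) (auto simp: positive_roots)

lemma simple_positive: "\<alpha> \<in> \<Delta> \<Longrightarrow> \<alpha> \<in> Rp"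
  using simple_subset by (auto simp: positive_iff coord_simple)

lemma positive_combination:
  "\<gamma> \<in> roots \<Phi> \<Longrightarrow> \<gamma> = \<alpha> + r *\<^sub>R \<beta> \<Longrightarrow> \<alpha> \<in> Rp \<Longrightarrow> \<beta> \<in> Rp \<Longrightarrow> 0 \<le> r \<Longrightarrow> \<gamma> \<in> Rp"
  by (auto simp: positive_iff coord_add coord_scale)

lemma root_nonzero: "\<beta> \<in> roots \<Phi> \<Longrightarrow> \<beta> \<noteq> 0"
  using root_system by (auto simp: reduced_root_system_def)

lemma neg_positive_iff:
  assumes "\<beta> \<in> roots \<Phi>"
  shows "- \<beta> \<in> Rp \<longleftrightarrow> \<beta> \<notin> Rp"
proof
  assume neg: "- \<beta> \<in> Rp"
  show "\<beta> \<notin> Rp"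
  proof
    assume "\<beta> \<in> Rp"
    then have "coord \<beta> \<alpha> = 0" if "\<alpha> \<in> \<Delta>" for \<alpha>
      using that neg positive_iff[of \<beta>] positive_iff[of "- \<beta>"] coord_neg by (smt (verit))
    then have "(\<Sum>\<alpha>\<in>\<Delta>. coord \<beta> \<alpha> *\<^sub>R \<alpha>) = 0" by (intro sum.neutral) auto
    then have "\<beta> = 0" by (simp only: sum_coord)
    then show False using assms root_nonzero by blast
  qed
next
  assume "\<beta> \<notin> Rp"
  then show "- \<beta> \<in> Rp" using assms roots_eq by auto
qed

text \<open>The reflection in \<alpha> changes only the coordinate at \<alpha>. A positive root
  other than \<alpha> has a positive coordinate at some other simple root, which survives and
  excludes a negative image.\<close>

lemma refl_simple_positive:
  assumes "\<alpha> \<in> \<Delta>" "\<beta> \<in> Rp" "\<beta> \<noteq> \<alpha>"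
  shows "refl \<Phi> \<alpha> \<beta> \<in> Rp"
proof -
  have \<alpha>: "\<alpha> \<in> roots \<Phi>" using assms(1) simple_subset by auto
  have \<beta>: "\<beta> \<in> roots \<Phi>" using assms(2) by (rule positive_roots)
  have "\<exists>\<gamma>\<in>\<Delta>. \<gamma> \<noteq> \<alpha> \<and> 0 < coord \<beta> \<gamma>"
  proof (rule ccontr)
    assume no: "\<not> ?thesis"
    have z: "coord \<beta> \<gamma> = 0" if "\<gamma> \<in> \<Delta>" "\<gamma> \<noteq> \<alpha>" for \<gamma>
      using that no assms(2) by (force simp: positive_iff)
    have "(\<Sum>\<gamma>\<in>\<Delta>. coord \<beta> \<gamma> *\<^sub>R \<gamma>) = (\<Sum>\<gamma>\<in>\<Delta>. if \<gamma> = \<alpha> then coord \<beta> \<alpha> *\<^sub>R \<alpha> else 0)"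
      by (rule sum.cong) (auto simp: z)
    then have "\<beta> = (\<Sum>\<gamma>\<in>\<Delta>. if \<gamma> = \<alpha> then coord \<beta> \<alpha> *\<^sub>R \<alpha> else 0)"
      by (simp only: sum_coord)
    then have eq: "\<beta> = coord \<beta> \<alpha> *\<^sub>R \<alpha>" using assms(1) finite_simple by simp
    \<comment> \<open>Reducedness for arbitrary real multiples enters here: a root supported on
      \<alpha> alone is \<alpha> or its negative.\<close>
    then have "coord \<beta> \<alpha> = 1 \<or> coord \<beta> \<alpha> = -1" using reduced[OF \<alpha>] \<beta> by metis
    moreover have "0 \<le> coord \<beta> \<alpha>" using assms by (simp add: positive_iff)
    ultimately show False using eq assms(3) by auto
  qed
  then obtain \<gamma> where \<gamma>: "\<gamma> \<in> \<Delta>" "\<gamma> \<noteq> \<alpha>" "0 < coord \<beta> \<gamma>" by blast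
  then have "0 < coord (refl \<Phi> \<alpha> \<beta>) \<gamma>"
    using assms(1) by (simp add: refl_def coord_diff coord_scale coord_simple)
  then have "- refl \<Phi> \<alpha> \<beta> \<notin> Rp" using \<gamma>(1) by (auto simp: positive_iff coord_neg not_le)
  then show ?thesis using neg_positive_iff refl_mem[OF \<alpha> \<beta>] by blast
qed

definition height :: "'a \<Rightarrow> real" where
  "height v = (\<Sum>\<alpha>\<in>\<Delta>. coord v \<alpha>)"

text \<open>Induction on the height, which a simple reflection lowers on every positive root that pairs
  positively with it.\<close>

lemma positive_root_induct [consumes 1, case_names simple refl]:
  assumes "\<beta> \<in> Rp"
    and simple: "\<And>\<alpha>. \<alpha> \<in> \<Delta> \<Longrightarrow> P \<alpha>"
    and refl: "\<And>\<alpha> \<beta>. \<alpha> \<in> \<Delta> \<Longrightarrow> \<beta> \<in> Rp \<Longrightarrow> P \<beta> \<Longrightarrow> P (refl \<Phi> \<alpha> \<beta>)"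
  shows "P \<beta>"
  using assms(1)
\<comment> \<open>Heights are real numbers, so the induction counts the positive roots of smaller
  height instead.\<close>
proof (induction "card {\<gamma> \<in> Rp. height \<gamma> < height \<beta>}" arbitrary: \<beta> rule: less_induct)
  case less
  show ?case
  proof (cases "\<beta> \<in> \<Delta>")
    case True
    then show ?thesis by (rule simple)
  next
    case False
    have \<beta>: "\<beta> \<in> roots \<Phi>" using less.prems by (rule positive_roots)
    \<comment> \<open>Expanding \<beta> in simple roots, the value 2 of its pairing with its own
      coroot forces a positive summand, hence a simple root that pairs positively.\<close>
    have "2 = pairing \<Phi> (\<Sum>\<alpha>\<in>\<Delta>. coord \<beta> \<alpha> *\<^sub>R \<alpha>) (coroot \<Phi> \<beta>)"
      using pairing_coroot_self[OF \<beta>] by (simp add: sum_coord)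
    also have "\<dots> = (\<Sum>\<alpha>\<in>\<Delta>. coord \<beta> \<alpha> * pairing \<Phi> \<alpha> (coroot \<Phi> \<beta>))"
      by (simp add: linear_sum[OF linear_pairing_l] pairing_simps)
    finally have "\<not> (\<Sum>\<alpha>\<in>\<Delta>. coord \<beta> \<alpha> * pairing \<Phi> \<alpha> (coroot \<Phi> \<beta>)) \<le> 0" by simp
    then obtain \<alpha> where \<alpha>: "\<alpha> \<in> \<Delta>" "0 < coord \<beta> \<alpha> * pairing \<Phi> \<alpha> (coroot \<Phi> \<beta>)"
      by (meson not_le sum_nonpos)
    then have "0 < pairing \<Phi> \<alpha> (coroot \<Phi> \<beta>)"
      using less.prems by (auto simp: positive_iff zero_less_mult_iff)
    then have pos: "0 < pairing \<Phi> \<beta> (coroot \<Phi> \<alpha>)"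
      using pairing_coroot_pos_iff \<alpha>(1) simple_subset \<beta> by blast
    have \<gamma>: "refl \<Phi> \<alpha> \<beta> \<in> Rp" using refl_simple_positive \<alpha>(1) less.prems False by blast
    have "height (refl \<Phi> \<alpha> \<beta>) = height \<beta> - pairing \<Phi> \<beta> (coroot \<Phi> \<alpha>)"
      using \<alpha>(1) finite_simple
      by (simp add: height_def refl_def coord_diff coord_scale coord_simple sum_subtractf
          sum_distrib_left[symmetric])
    then have lt: "height (refl \<Phi> \<alpha> \<beta>) < height \<beta>" using pos by simp
    have "card {\<gamma> \<in> Rp. height \<gamma> < height (refl \<Phi> \<alpha> \<beta>)} < card {\<gamma> \<in> Rp. height \<gamma> < height \<beta>}"
    proof (rule psubset_card_mono)
      show "{\<gamma> \<in> Rp. height \<gamma> < height (refl \<Phi> \<alpha> \<beta>)} \<subset> {\<gamma> \<in> Rp. height \<gamma> < height \<beta>}"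
        using lt \<gamma> by fastforce
    qed (simp add: finite_positive)
    then have "P (refl \<Phi> \<alpha> \<beta>)" using \<gamma> by (rule less.hyps)
    then have "P (refl \<Phi> \<alpha> (refl \<Phi> \<alpha> \<beta>))" by (rule refl[OF \<alpha>(1) \<gamma>])
    then show ?thesis using \<alpha>(1) simple_subset by (simp add: refl_refl subset_iff)
  qed
qed

definition unit_coroot :: "'a \<Rightarrow> 'b" where
  "unit_coroot \<beta> = (1 / sqrt (ip (coroot \<Phi> \<beta>) (coroot \<Phi> \<beta>))) *\<^sub>R coroot \<Phi> \<beta>"

lemma ip_unit_coroot: "\<beta> \<in> roots \<Phi> \<Longrightarrow> ip (unit_coroot \<beta>) (unit_coroot \<beta>) = 1"
  using ip_coroot_pos[of \<beta>] by (simp add: unit_coroot_def ip_simps)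

lemma unit_coroot_refl:
  assumes "\<alpha> \<in> roots \<Phi>" "\<beta> \<in> roots \<Phi>"
  shows "unit_coroot (refl \<Phi> \<alpha> \<beta>) = corefl \<Phi> \<alpha> (unit_coroot \<beta>)"
  using assms by (simp add: unit_coroot_def coroot_refl ip_corefl linear_scale[OF linear_corefl])

text \<open>The Euclidean form of the reflection, with the coroot eliminated in favour of the unit
  vector that becomes the Clifford element of \<beta>.\<close>

lemma corefl_unit_coroot:
  assumes "\<beta> \<in> roots \<Phi>"
  shows "corefl \<Phi> \<beta> x = x - (2 * ip (unit_coroot \<beta>) x) *\<^sub>R unit_coroot \<beta>"
  using ip_coroot_pos[OF assms] ip_coroot[OF assms, of x]
  by (simp add: unit_coroot_def corefl_def ip_simps nonzero_eq_divide_eq mult.commute)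

end

section \<open>Dual bases and root lengths\<close>

locale dirac_setup = root_setup \<Phi> Rp \<Delta> c ip
  for \<Phi> :: "('a::real_vector, 'b::real_vector) root_datum"
    and Rp \<Delta> :: "'a set" and c :: "'a \<Rightarrow> real" and ip :: "'b \<Rightarrow> 'b \<Rightarrow> real" +
  fixes I :: "'i set" and e e' :: "'i \<Rightarrow> 'b"
  assumes dual: "dual_bases ip I e e'"
begin

lemma finite_I: "finite I"
  and span_e: "span (e ` I) = UNIV" and span_e': "span (e' ` I) = UNIV"
  and ip_dual: "i \<in> I \<Longrightarrow> j \<in> I \<Longrightarrow> ip (e i) (e' j) = (if i = j then 1 else 0)"
  using dual by (auto simp: dual_bases_def)

lemma dual_expand: "(\<Sum>i\<in>I. ip x (e' i) *\<^sub>R e i) = x"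
proof -
  have "linear (\<lambda>x. \<Sum>i\<in>I. ip x (e' i) *\<^sub>R e i)"
    by (rule linearI) (simp_all add: ip_simps sum.distrib scaleR_sum_right algebra_simps)
  moreover have "(\<Sum>i\<in>I. ip y (e' i) *\<^sub>R e i) = y" if "y \<in> e ` I" for y
    using that finite_I by (auto simp: ip_dual if_distrib[of "\<lambda>r. r *\<^sub>R _"] cong: if_cong)
  ultimately show ?thesis
    using linear_eq_on[of "\<lambda>x. \<Sum>i\<in>I. ip x (e' i) *\<^sub>R e i" "\<lambda>x. x" x "e ` I"] span_e linear_ident by auto
qed

lemma dual_expand': "(\<Sum>i\<in>I. ip x (e i) *\<^sub>R e' i) = x"
proof -
  have "linear (\<lambda>x. \<Sum>i\<in>I. ip x (e i) *\<^sub>R e' i)"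
    by (rule linearI) (simp_all add: ip_simps sum.distrib scaleR_sum_right algebra_simps)
  moreover have "(\<Sum>i\<in>I. ip y (e i) *\<^sub>R e' i) = y" if "y \<in> e' ` I" for y
    using that finite_I
    by (auto simp: ip_commute[of "e' _"] ip_dual if_distrib[of "\<lambda>r. r *\<^sub>R _"] cong: if_cong)
  ultimately show ?thesis
    using linear_eq_on[of "\<lambda>x. \<Sum>i\<in>I. ip x (e i) *\<^sub>R e' i" "\<lambda>x. x" x "e' ` I"] span_e' linear_ident by auto
qed

lemma pairing_eq_ip:
  assumes "\<beta> \<in> roots \<Phi>"
  shows "pairing \<Phi> \<beta> x = ip x ((2 / ip (coroot \<Phi> \<beta>) (coroot \<Phi> \<beta>)) *\<^sub>R coroot \<Phi> \<beta>)"
  using ip_coroot[OF assms, of x] ip_coroot_pos[OF assms] ip_commute[of x "coroot \<Phi> \<beta>"]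
  by (simp add: ip_simps nonzero_eq_divide_eq mult.commute)

text \<open>The inner product identifies \<beta> with its coroot times 2 over the squared length of
  the coroot, so the lengths of a root and its coroot multiply to 2.\<close>

lemma root_norm_eq:
  assumes "\<beta> \<in> roots \<Phi>"
  shows "root_norm \<Phi> I e e' \<beta> = 2 / sqrt (ip (coroot \<Phi> \<beta>) (coroot \<Phi> \<beta>))"
proof -
  define b where "b = (2 / ip (coroot \<Phi> \<beta>) (coroot \<Phi> \<beta>)) *\<^sub>R coroot \<Phi> \<beta>"
  have "dual_ip \<Phi> I e e' \<beta> \<beta> = (\<Sum>i\<in>I. pairing \<Phi> \<beta> (e i) * pairing \<Phi> \<beta> (e' i))"
    by (simp add: dual_ip_def)
  also have "\<dots> = pairing \<Phi> \<beta> (\<Sum>i\<in>I. ip b (e i) *\<^sub>R e' i)"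
    by (simp add: linear_sum[OF linear_pairing_r] pairing_simps ip_commute[of b]
        pairing_eq_ip[OF assms, of "e _"] flip: b_def)
  also have "\<dots> = pairing \<Phi> \<beta> b" by (simp only: dual_expand')
  also have "\<dots> = (2 / sqrt (ip (coroot \<Phi> \<beta>) (coroot \<Phi> \<beta>)))\<^sup>2"
    using ip_coroot_pos[OF assms] by (simp add: b_def pairing_simps pairing_coroot_self[OF assms] power_divide)
  finally show ?thesis
    using ip_coroot_pos[OF assms] by (simp add: root_norm_def real_sqrt_divide)
qed

lemma root_norm_refl:
  "\<alpha> \<in> roots \<Phi> \<Longrightarrow> \<beta> \<in> roots \<Phi> \<Longrightarrow> root_norm \<Phi> I e e' (refl \<Phi> \<alpha> \<beta>) = root_norm \<Phi> I e e' \<beta>"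
  by (simp add: root_norm_eq refl_mem coroot_refl ip_corefl)

text \<open>The left side is the vector representing \<beta> under the inner product. This identity
  produces the elements \<open>fr \<beta>\<close> and the factors |\<beta>| out of the tilde
  corrections.\<close>

lemma sum_pairing_dual:
  assumes "\<beta> \<in> roots \<Phi>"
  shows "(\<Sum>i\<in>I. pairing \<Phi> \<beta> (e i) *\<^sub>R e' i) = root_norm \<Phi> I e e' \<beta> *\<^sub>R unit_coroot \<beta>"
proof -
  have "(\<Sum>i\<in>I. pairing \<Phi> \<beta> (e i) *\<^sub>R e' i) = (2 / ip (coroot \<Phi> \<beta>) (coroot \<Phi> \<beta>)) *\<^sub>R coroot \<Phi> \<beta>"
    by (simp add: pairing_eq_ip[OF assms] ip_commute[of "e _"] dual_expand')
  then show ?thesis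
    using ip_coroot_pos[OF assms] by (simp add: root_norm_eq[OF assms] unit_coroot_def)
qed

end

section \<open>The Clifford algebra\<close>

text \<open>The Jordan--Wigner construction of anticommuting involutions, used to show that \<open>1 \<noteq> 0\<close> in the
  Clifford algebra.\<close>

definition spin_sign :: "('k \<Rightarrow> nat) \<Rightarrow> 'k set \<Rightarrow> 'k \<Rightarrow> ('k \<Rightarrow> bool) \<Rightarrow> complex" where
  "spin_sign r K k s = (\<Prod>j | j \<in> K \<and> r j < r k. if s j then - 1 else 1)"

text \<open>In spin language: a Pauli X at \<open>k\<close> with a string of Pauli Z over the sites
  of smaller \<open>r\<close>.\<close>

definition gamma :: "('k \<Rightarrow> nat) \<Rightarrow> 'k set \<Rightarrow> 'k \<Rightarrow> (('k \<Rightarrow> bool) \<Rightarrow> complex) \<Rightarrow> ('k \<Rightarrow> bool) \<Rightarrow> complex" where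
  "gamma r K k \<phi> s = spin_sign r K k s * \<phi> (s(k := \<not> s k))"

lemma spin_sign_flip:
  assumes "finite K" "l \<in> K"
  shows "spin_sign r K k (s(l := \<not> s l)) = (if r l < r k then - spin_sign r K k s else spin_sign r K k s)"
proof (cases "r l < r k")
  case True
  let ?M = "{j. j \<in> K \<and> r j < r k}"
  have M: "finite ?M" "l \<in> ?M" using assms True by auto
  have "(\<Prod>j\<in>?M - {l}. if (s(l := \<not> s l)) j then - 1 else 1) =
      (\<Prod>j\<in>?M - {l}. if s j then - 1 else (1::complex))"
    by (rule prod.cong) auto
  then show ?thesis
    unfolding spin_sign_def using True by (simp add: prod.remove[OF M])
next
  case False
  then show ?thesis unfolding spin_sign_def by (auto intro!: prod.cong)
qed

lemma spin_sign_square: "spin_sign r K k s * spin_sign r K k s = 1"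
  unfolding spin_sign_def by (subst prod.distrib[symmetric]) (simp add: prod.neutral)

text \<open>For distinct sites exactly one of the two orders of composition meets a flipped site in
  its string and picks up a sign. A site is never in its own string, so each operator squares to
  one.\<close>

lemma gamma_anticommute:
  assumes "finite K" "inj_on r K" "k \<in> K" "l \<in> K"
  shows "gamma r K k (gamma r K l \<phi>) s + gamma r K l (gamma r K k \<phi>) s = (if k = l then 2 * \<phi> s else 0)"
proof (cases "k = l")
  case True
  then show ?thesis
    using assms by (simp add: gamma_def spin_sign_flip mult.assoc[symmetric] spin_sign_square)
next
  case False
  then have "r k < r l \<or> r l < r k" using assms by (metis inj_onD linorder_neqE_nat)
  moreover have "s(k := \<not> s k, l := \<not> s l) = s(l := \<not> s l, k := \<not> s k)"
    using False by (rule fun_upd_twist)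
  ultimately show ?thesis
    using assms False by (auto simp: gamma_def spin_sign_flip)
qed

lemma gamma_linear:
  "gamma r K k (\<lambda>t. \<Sum>i\<in>A. z i * \<phi> i t) s = (\<Sum>i\<in>A. z i * gamma r K k (\<phi> i) s)"
  by (simp add: gamma_def sum_distrib_left mult.left_commute)

text \<open>The functionals \<open>L k\<close> write the negative of the form as a sum of squares.
  Combining anticommuting involutions with these coefficients then satisfies the Clifford
  relation.\<close>

locale clifford_action =
  fixes ip :: "'b::real_vector \<Rightarrow> 'b \<Rightarrow> real"
    and K :: "'k set" and r :: "'k \<Rightarrow> nat" and L :: "'k \<Rightarrow> 'b cplx \<Rightarrow> complex"
  assumes finite_K: "finite K" and inj_r: "inj_on r K"
    and L_add: "L k (\<omega> + \<omega>') = L k \<omega> + L k \<omega>'"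
    and L_scale: "L k (cscale z \<omega>) = z * L k \<omega>"
    and L_form: "(\<Sum>k\<in>K. L k \<omega> * L k \<omega>') = - cip ip \<omega> \<omega>'"
begin

definition vec_act :: "'b cplx \<Rightarrow> (('k \<Rightarrow> bool) \<Rightarrow> complex) \<Rightarrow> ('k \<Rightarrow> bool) \<Rightarrow> complex" where
  "vec_act \<omega> \<phi> s = (\<Sum>k\<in>K. L k \<omega> * gamma r K k \<phi> s)"

lemma vec_act_linear:
  "vec_act \<omega> (\<lambda>t. \<Sum>i\<in>A. z i * \<phi> i t) = (\<lambda>s. \<Sum>i\<in>A. z i * vec_act \<omega> (\<phi> i) s)"
  unfolding vec_act_def gamma_linear sum_distrib_left
  by (rule ext, subst sum.swap) (simp add: mult.left_commute)

text \<open>After transposing one of the two double sums the coefficients agree, and only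
  anticommutators of the \<open>gamma\<close> operators remain. Off the diagonal they vanish; on it
  they give 2.\<close>

lemma vec_act_clifford:
  "vec_act \<omega> (vec_act \<omega>' \<phi>) s + vec_act \<omega>' (vec_act \<omega> \<phi>) s = - 2 * cip ip \<omega> \<omega>' * \<phi> s"
proof -
  have comp: "vec_act \<omega> (vec_act \<omega>' \<phi>) s =
      (\<Sum>k\<in>K. \<Sum>l\<in>K. L k \<omega> * L l \<omega>' * gamma r K k (gamma r K l \<phi>) s)" for \<omega> \<omega>'
  proof -
    have eq: "vec_act \<omega>' \<phi> = (\<lambda>s. \<Sum>l\<in>K. L l \<omega>' * gamma r K l \<phi> s)"
      by (rule ext) (rule vec_act_def)
    show ?thesis
      unfolding vec_act_def[of \<omega>] eq gamma_linear by (simp add: sum_distrib_left mult.assoc)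
  qed
  have "vec_act \<omega> (vec_act \<omega>' \<phi>) s + vec_act \<omega>' (vec_act \<omega> \<phi>) s =
      (\<Sum>k\<in>K. \<Sum>l\<in>K. L k \<omega> * L l \<omega>' * (gamma r K k (gamma r K l \<phi>) s + gamma r K l (gamma r K k \<phi>) s))"
    unfolding comp[of \<omega> \<omega>'] comp[of \<omega>' \<omega>]
    by (subst (2) sum.swap) (simp add: sum.distrib[symmetric] distrib_left mult.commute)
  also have "\<dots> = (\<Sum>k\<in>K. \<Sum>l\<in>K. if k = l then 2 * (L k \<omega> * L k \<omega>') * \<phi> s else 0)"
    by (intro sum.cong refl) (simp add: gamma_anticommute[OF finite_K inj_r])
  also have "\<dots> = 2 * (\<Sum>k\<in>K. L k \<omega> * L k \<omega>') * \<phi> s"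
    using finite_K by (simp add: sum_distrib_left sum_distrib_right)
  finally show ?thesis by (simp add: L_form)
qed

fun word_act :: "'b cplx list \<Rightarrow> (('k \<Rightarrow> bool) \<Rightarrow> complex) \<Rightarrow> ('k \<Rightarrow> bool) \<Rightarrow> complex" where
  "word_act [] \<phi> = \<phi>"
| "word_act (\<omega> # ws) \<phi> = vec_act \<omega> (word_act ws \<phi>)"

lemma word_act_append: "word_act (u @ v) \<phi> = word_act u (word_act v \<phi>)"
  by (induction u) simp_all

lemma word_act_linear:
  "word_act u (\<lambda>t. \<Sum>i\<in>A. z i * \<phi> i t) = (\<lambda>s. \<Sum>i\<in>A. z i * word_act u (\<phi> i) s)"
  by (induction u) (simp_all add: vec_act_linear)

text \<open>The kernel of the action of the free algebra, stated pointwise on functions. It is a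
  two-sided ideal that contains the Clifford relations, hence the ideal they generate.\<close>

definition annihilator :: "('b cplx list \<Rightarrow>\<^sub>0 complex) set" where
  "annihilator = {f. \<forall>\<phi> s. lin_ext (\<lambda>u. word_act u \<phi> s) f = 0}"

lemma ideal_annihilator: "ideal annihilator (free_algebra UNIV)"
proof -
  interpret F: complex_algebra "free_algebra (UNIV :: 'b cplx set)"
    by (rule complex_algebra_free_algebra)
  show ?thesis
  proof (rule idealI)
    show "subgroup annihilator (add_monoid (free_algebra UNIV))"
    proof (rule F.add.subgroupI)
      fix a assume "a \<in> annihilator"
      moreover have "\<ominus>\<^bsub>free_algebra UNIV\<^esub> a = - a"
        by (rule F.minus_equality) (auto simp: keys_minus)
      ultimately show "\<ominus>\<^bsub>free_algebra UNIV\<^esub> a \<in> annihilator"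
        by (simp add: annihilator_def lin_ext_uminus)
    qed (auto simp: annihilator_def lin_ext_add intro!: exI[of _ 0])
  next
    fix a x :: "'b cplx list \<Rightarrow>\<^sub>0 complex"
    assume a: "a \<in> annihilator"
    have "lin_ext (\<lambda>v. word_act u (word_act v \<phi>) s) a = 0" for u \<phi> s
    proof -
      have "lin_ext (\<lambda>v. word_act u (word_act v \<phi>) s) a =
          word_act u (\<lambda>t. lin_ext (\<lambda>v. word_act v \<phi> t) a) s"
        by (simp add: lin_ext_def word_act_linear)
      \<comment> \<open>Zero is written as an empty linear combination so that linearity of the
        action of \<open>u\<close> shows that \<open>u\<close> sends it to zero.\<close>
      also have "(\<lambda>t. lin_ext (\<lambda>v. word_act v \<phi> t) a) = (\<lambda>t. \<Sum>i\<in>{}. 0 * \<phi> t)"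
        using a by (simp add: annihilator_def)
      finally show ?thesis by (subst (asm) word_act_linear) simp
    qed
    then show "x \<otimes>\<^bsub>free_algebra UNIV\<^esub> a \<in> annihilator"
      by (simp add: annihilator_def lin_ext_mult word_act_append lin_ext_def[of _ x])
    show "a \<otimes>\<^bsub>free_algebra UNIV\<^esub> x \<in> annihilator"
      using a by (simp add: annihilator_def lin_ext_mult word_act_append lin_ext_swap[of _ x a])
        (simp add: lin_ext_def[of _ x])
  qed (rule F.ring_axioms)
qed

lemma clifford_rels_annihilator: "clifford_rels ip \<subseteq> annihilator"
proof -
  have "vec_act (\<omega> + \<omega>') \<phi> s = vec_act \<omega> \<phi> s + vec_act \<omega>' \<phi> s" for \<omega> \<omega>' \<phi> s
    by (simp add: vec_act_def L_add distrib_right sum.distrib)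
  moreover have "vec_act (cscale z \<omega>) \<phi> s = z * vec_act \<omega> \<phi> s" for z \<omega> \<phi> s
    by (simp add: vec_act_def L_scale sum_distrib_left mult.assoc)
  ultimately show ?thesis
    unfolding clifford_rels_def annihilator_def
    by (auto simp: lin_ext_add lin_ext_diff vec_act_clifford)
qed

end

lemma clifford_rels_add: "word [\<omega> + \<omega>'] - (word [\<omega>] + word [\<omega>']) \<in> clifford_rels ip"
  unfolding clifford_rels_def diff_diff_eq[symmetric] by blast

lemma clifford_rels_scale: "word [cscale z \<omega>] - Poly_Mapping.single [\<omega>] z \<in> clifford_rels ip"
  unfolding clifford_rels_def by blast

lemma clifford_rels_anticommute:
  "word [\<omega>, \<omega>'] + word [\<omega>', \<omega>] - Poly_Mapping.single [] (- 2 * cip ip \<omega> \<omega>') \<in> clifford_rels ip"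
proof -
  have "word [\<omega>, \<omega>'] + word [\<omega>', \<omega>] - Poly_Mapping.single [] (- 2 * cip ip \<omega> \<omega>') =
      word [\<omega>, \<omega>'] + word [\<omega>', \<omega>] + Poly_Mapping.single [] (2 * cip ip \<omega> \<omega>')"
    by (simp add: single_uminus)
  then show ?thesis unfolding clifford_rels_def by blast
qed

lemma clifford_presentation: "presentation UNIV (clifford_rels ip)"
  by unfold_locales (auto simp: lists_UNIV)

text \<open>Were one equal to zero, the empty word would lie in the ideal of relations and
  annihilate every function, but it acts as the identity.\<close>

lemma (in clifford_action) clifford_nontrivial: "\<one>\<^bsub>clifford ip\<^esub> \<noteq> \<zero>\<^bsub>clifford ip\<^esub>"
proof
  interpret presentation UNIV "clifford_rels ip" by (rule clifford_presentation)
  interpret J: ideal J "free_algebra UNIV" by (rule ideal_J)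
  assume "\<one>\<^bsub>clifford ip\<^esub> = \<zero>\<^bsub>clifford ip\<^esub>"
  then have "J +>\<^bsub>free_algebra UNIV\<^esub> word [] = J"
    by (simp add: clifford_def presented_algebra_def)
  moreover have "word [] \<in> J +>\<^bsub>free_algebra UNIV\<^esub> word []"
    by (rule J.a_rcos_self) simp
  ultimately have "word [] \<in> J" by simp
  then have "word [] \<in> annihilator"
    using F.genideal_minimal[OF ideal_annihilator clifford_rels_annihilator] by blast
  then have "\<forall>\<phi> :: ('k \<Rightarrow> bool) \<Rightarrow> complex. \<forall>s. \<phi> s = 0" by (simp add: annihilator_def)
  from spec[OF this, of "\<lambda>_. 1"] show False by simp
qed

section \<open>The parity automorphism and vectors in the Clifford algebra\<close>

definition parity_twist :: "('g list \<Rightarrow>\<^sub>0 complex) \<Rightarrow> ('g list \<Rightarrow>\<^sub>0 complex)" where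
  "parity_twist f =
    (\<Sum>w\<in>Poly_Mapping.keys f. Poly_Mapping.single w ((-1) ^ length w * Poly_Mapping.lookup f w))"

lemma lin_ext_parity_twist: "lin_ext h (parity_twist f) = lin_ext (\<lambda>w. (-1) ^ length w * h w) f"
  by (simp add: parity_twist_def lin_ext_sum) (simp add: lin_ext_def mult_ac)

lemma parity_twist_add: "parity_twist (f + g) = parity_twist f + parity_twist g"
  by (rule lin_ext_eqI) (simp add: lin_ext_parity_twist lin_ext_add)

lemma parity_twist_diff: "parity_twist (f - g) = parity_twist f - parity_twist g"
  by (rule lin_ext_eqI) (simp add: lin_ext_parity_twist lin_ext_diff)

lemma parity_twist_uminus: "parity_twist (- f) = - parity_twist f"
  by (rule lin_ext_eqI) (simp add: lin_ext_parity_twist lin_ext_uminus)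

lemma parity_twist_zero: "parity_twist 0 = 0"
  by (simp add: parity_twist_def)

lemma parity_twist_single:
  "parity_twist (Poly_Mapping.single w z) = Poly_Mapping.single w ((-1) ^ length w * z)"
  by (rule lin_ext_eqI) (simp add: lin_ext_parity_twist)

lemma parity_twist_twist: "parity_twist (parity_twist f) = f"
  by (rule lin_ext_eqI) (simp add: lin_ext_parity_twist mult.assoc[symmetric] power_add[symmetric])

lemma parity_twist_mult:
  "parity_twist (f \<otimes>\<^bsub>free_algebra S\<^esub> g) = parity_twist f \<otimes>\<^bsub>free_algebra S\<^esub> parity_twist g"
  by (rule lin_ext_eqI)
    (simp add: lin_ext_parity_twist lin_ext_mult power_add mult.assoc lin_ext_fun_scale)

locale clifford_form =
  fixes ip :: "'b::real_vector \<Rightarrow> 'b \<Rightarrow> real"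
begin

sublocale C: presentation UNIV "clifford_rels ip"
  rewrites "presented_algebra UNIV (clifford_rels ip) = clifford ip"
  by (rule clifford_presentation) (simp add: clifford_def)

text \<open>The preimage of the ideal under the twist is itself an ideal. It contains the relations,
  so minimality of the generated ideal applies.\<close>

lemma parity_twist_ideal: "f \<in> C.J \<Longrightarrow> parity_twist f \<in> C.J"
proof -
  interpret J: ideal C.J "free_algebra UNIV" by (rule C.ideal_J)
  have minus: "\<ominus>\<^bsub>free_algebra UNIV\<^esub> a = - a" for a :: "'b cplx list \<Rightarrow>\<^sub>0 complex"
    by (rule C.F.minus_equality) (auto simp: keys_minus)
  have "ideal {f. parity_twist f \<in> C.J} (free_algebra UNIV)"
  proof (rule idealI)
    show "subgroup {f. parity_twist f \<in> C.J} (add_monoid (free_algebra UNIV))"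
    proof (rule C.F.add.subgroupI)
      fix a assume "a \<in> {f. parity_twist f \<in> C.J}"
      then show "\<ominus>\<^bsub>free_algebra UNIV\<^esub> a \<in> {f. parity_twist f \<in> C.J}"
        using J.a_inv_closed[of "parity_twist a"] by (simp add: minus parity_twist_uminus)
    next
      fix a b assume "a \<in> {f. parity_twist f \<in> C.J}" "b \<in> {f. parity_twist f \<in> C.J}"
      then show "a \<oplus>\<^bsub>free_algebra UNIV\<^esub> b \<in> {f. parity_twist f \<in> C.J}"
        using J.a_closed[of "parity_twist a" "parity_twist b"] by (simp add: parity_twist_add)
    next
      show "{f. parity_twist f \<in> C.J} \<noteq> {}"
        using J.zero_closed by (auto simp: parity_twist_zero intro!: exI[of _ 0])
    qed auto
  next
    fix a x assume "a \<in> {f. parity_twist f \<in> C.J}"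
    then show "x \<otimes>\<^bsub>free_algebra UNIV\<^esub> a \<in> {f. parity_twist f \<in> C.J}"
      and "a \<otimes>\<^bsub>free_algebra UNIV\<^esub> x \<in> {f. parity_twist f \<in> C.J}"
      by (simp_all add: parity_twist_mult J.I_l_closed J.I_r_closed)
  qed (rule C.F.ring_axioms)
  moreover have "clifford_rels ip \<subseteq> {f. parity_twist f \<in> C.J}"
  proof
    fix f assume f: "f \<in> clifford_rels ip"
    \<comment> \<open>Each relation involves words of one parity only: the linear ones are odd, the
      quadratic ones with their constant term are even.\<close>
    have "parity_twist f = f \<or> parity_twist f = - f"
      using f unfolding clifford_rels_def
      by (auto simp: parity_twist_add parity_twist_diff parity_twist_single single_uminus)
    moreover have "f \<in> C.J" using f C.F.genideal_self[OF C.rels_subset] by blast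
    ultimately show "f \<in> {f. parity_twist f \<in> C.J}"
      using J.a_inv_closed[of f] by (auto simp: minus)
  qed
  ultimately show "f \<in> C.J \<Longrightarrow> parity_twist f \<in> C.J"
    using C.F.genideal_minimal by blast
qed

text \<open>\<open>clifford_eps\<close> is an image of sets. That the image lies in one coset needs
  invariance of the ideal; that it fills the coset needs the twist to be an involution.\<close>

lemma clifford_eps_cls: "clifford_eps (C.cls f) = C.cls (parity_twist f)"
proof -
  have "clifford_eps (C.cls f) = parity_twist ` (C.J +>\<^bsub>free_algebra UNIV\<^esub> f)"
    by (simp add: clifford_eps_def presented_class_def parity_twist_def[abs_def])
  also have "\<dots> = C.J +>\<^bsub>free_algebra UNIV\<^esub> parity_twist f"
  proof
    show "parity_twist ` (C.J +>\<^bsub>free_algebra UNIV\<^esub> f) \<subseteq> C.J +>\<^bsub>free_algebra UNIV\<^esub> parity_twist f"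
      by (auto simp: a_r_coset_def' parity_twist_add intro!: bexI parity_twist_ideal)
    show "C.J +>\<^bsub>free_algebra UNIV\<^esub> parity_twist f \<subseteq> parity_twist ` (C.J +>\<^bsub>free_algebra UNIV\<^esub> f)"
    proof
      fix g assume "g \<in> C.J +>\<^bsub>free_algebra UNIV\<^esub> parity_twist f"
      then obtain j where "j \<in> C.J" "g = j + parity_twist f" by (auto simp: a_r_coset_def')
      then have "g = parity_twist (parity_twist j + f)" "parity_twist j \<in> C.J"
        by (auto simp: parity_twist_add parity_twist_twist parity_twist_ideal)
      then show "g \<in> parity_twist ` (C.J +>\<^bsub>free_algebra UNIV\<^esub> f)"
        by (auto simp: a_r_coset_def')
    qed
  qed
  finally show ?thesis by (simp add: presented_class_def)
qed

abbreviation cv where "cv \<equiv> clifford_vec ip"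

lemma cv_mem [simp, intro]: "cv \<omega> \<in> carrier (clifford ip)"
  unfolding clifford_vec_def by (rule C.cls_mem) simp

lemma cv_add: "cv (\<omega> + \<omega>') = cv \<omega> \<oplus>\<^bsub>clifford ip\<^esub> cv \<omega>'"
  unfolding clifford_vec_def
  by (subst C.cls_add[symmetric]; (rule C.cls_eqI)?)
    (simp_all add: clifford_rels_add)

lemma cv_scale: "cv (cscale z \<omega>) = z \<odot>\<^bsub>clifford ip\<^esub> cv \<omega>"
  unfolding clifford_vec_def
  by (subst C.cls_single[symmetric]; (rule C.cls_eqI)?) (simp_all add: clifford_rels_scale)

lemma cv_anticommute:
  "cv \<omega> \<otimes>\<^bsub>clifford ip\<^esub> cv \<omega>' \<oplus>\<^bsub>clifford ip\<^esub> cv \<omega>' \<otimes>\<^bsub>clifford ip\<^esub> cv \<omega> =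
    (- 2 * cip ip \<omega> \<omega>') \<odot>\<^bsub>clifford ip\<^esub> \<one>\<^bsub>clifford ip\<^esub>"
proof -
  have "C.cls (word [\<omega>, \<omega>'] + word [\<omega>', \<omega>]) = C.cls (Poly_Mapping.single [] (- 2 * cip ip \<omega> \<omega>'))"
    by (rule C.cls_eqI) (use clifford_rels_anticommute in \<open>simp_all add: lists_UNIV\<close>)
  then show ?thesis
    using C.cls_word_append[of "[\<omega>]" "[\<omega>']"] C.cls_word_append[of "[\<omega>']" "[\<omega>]"]
    by (simp add: C.cls_add C.cls_single[of "[]"] C.cls_one clifford_vec_def lists_UNIV)
qed

end

text \<open>The Clifford relation determines only symmetrised products; this extracts the square
  itself.\<close>

lemma (in complex_algebra) double_eqD:
  assumes "x \<in> carrier A" "y \<in> carrier A" "x \<oplus> x = z \<odot> y"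
  shows "x = (z / 2) \<odot> y"
proof -
  have "x \<oplus> x = 2 \<odot> x"
    using assms smult_l_distr[of x 1 1] by simp
  then have "(1/2) \<odot> (2 \<odot> x) = (1/2) \<odot> (z \<odot> y)" using assms(3) by simp
  then show ?thesis using assms(1,2) by (simp add: smult_smult)
qed

section \<open>Root elements of the Clifford algebra and their projection to the Weyl group\<close>

context root_setup begin

sublocale clifford_form ip .

lemma ip_zero [simp]: "ip 0 x = 0" "ip x 0 = 0"
  using linear_0[OF linear_ip_l] linear_0[OF linear_ip_r] by auto

lemma rlin_cv: "rlin (clifford ip) (\<lambda>v. cv (of_real_vec v))"
proof -
  have "cv (of_real_vec (v + w)) = cv (of_real_vec v) \<oplus>\<^bsub>clifford ip\<^esub> cv (of_real_vec w)" for v w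
    by (subst cv_add[symmetric]) simp
  moreover have "cv (of_real_vec (r *\<^sub>R v)) = complex_of_real r \<odot>\<^bsub>clifford ip\<^esub> cv (of_real_vec v)" for r v
    by (subst cv_scale[symmetric]) (simp add: cscale_def)
  ultimately show ?thesis by (simp add: rlin_def)
qed

abbreviation fr where "fr \<equiv> clifford_root \<Phi> ip"

lemma fr_eq: "fr \<beta> = cv (of_real_vec (unit_coroot \<beta>))"
  by (simp add: clifford_root_def unit_coroot_def)

lemma fr_mem [simp, intro]: "fr \<beta> \<in> carrier (clifford ip)"
  by (simp add: fr_eq)

lemma fr_square:
  assumes "\<beta> \<in> roots \<Phi>"
  shows "fr \<beta> \<otimes>\<^bsub>clifford ip\<^esub> fr \<beta> = \<ominus>\<^bsub>clifford ip\<^esub> \<one>\<^bsub>clifford ip\<^esub>"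
proof -
  have "cip ip (of_real_vec (unit_coroot \<beta>)) (of_real_vec (unit_coroot \<beta>)) = 1"
    by (simp add: cip_def ip_unit_coroot[OF assms] complex_eq_iff)
  then have "fr \<beta> \<otimes>\<^bsub>clifford ip\<^esub> fr \<beta> \<oplus>\<^bsub>clifford ip\<^esub> fr \<beta> \<otimes>\<^bsub>clifford ip\<^esub> fr \<beta> =
      (- 2) \<odot>\<^bsub>clifford ip\<^esub> \<one>\<^bsub>clifford ip\<^esub>"
    using cv_anticommute[of "of_real_vec (unit_coroot \<beta>)" "of_real_vec (unit_coroot \<beta>)"]
    by (simp add: fr_eq)
  then have "fr \<beta> \<otimes>\<^bsub>clifford ip\<^esub> fr \<beta> = (- 2 / 2) \<odot>\<^bsub>clifford ip\<^esub> \<one>\<^bsub>clifford ip\<^esub>"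
    by (intro C.Q.double_eqD) auto
  then show ?thesis by (simp add: C.Q.smult_minus_one)
qed

lemma corefl_complex:
  assumes "\<beta> \<in> roots \<Phi>"
  shows "map_prod (corefl \<Phi> \<beta>) (corefl \<Phi> \<beta>) \<omega> =
    cscale (- 2 * cip ip (of_real_vec (unit_coroot \<beta>)) \<omega>) (of_real_vec (unit_coroot \<beta>)) + \<omega>"
  by (cases \<omega>) (simp add: corefl_unit_coroot[OF assms] cip_def cscale_def)

text \<open>The inverse and the parity image of \<open>fr \<beta>\<close> are both its negative, so
  this is its twisted conjugation. Moving \<open>fr \<beta>\<close> past the vector leaves twice
  their inner product, and the square -1 turns the result into a reflection.\<close>

lemma fr_conj:
  assumes "\<beta> \<in> roots \<Phi>"
  shows "fr \<beta> \<otimes>\<^bsub>clifford ip\<^esub> cv \<omega> \<otimes>\<^bsub>clifford ip\<^esub> fr \<beta> = cv (map_prod (corefl \<Phi> \<beta>) (corefl \<Phi> \<beta>) \<omega>)"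
proof -
  define k where "k = - 2 * cip ip (of_real_vec (unit_coroot \<beta>)) \<omega>"
  have "fr \<beta> \<otimes>\<^bsub>clifford ip\<^esub> cv \<omega> \<oplus>\<^bsub>clifford ip\<^esub> cv \<omega> \<otimes>\<^bsub>clifford ip\<^esub> fr \<beta> =
      k \<odot>\<^bsub>clifford ip\<^esub> \<one>\<^bsub>clifford ip\<^esub>"
    unfolding fr_eq k_def by (rule cv_anticommute)
  then have "fr \<beta> \<otimes>\<^bsub>clifford ip\<^esub> cv \<omega> =
      k \<odot>\<^bsub>clifford ip\<^esub> \<one>\<^bsub>clifford ip\<^esub> \<ominus>\<^bsub>clifford ip\<^esub> cv \<omega> \<otimes>\<^bsub>clifford ip\<^esub> fr \<beta>"
    by (metis C.Q.add.inv_solve_right C.Q.m_closed C.Q.minus_eq C.Q.one_closed C.Q.smult_closed cv_mem fr_mem)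
  then have "fr \<beta> \<otimes>\<^bsub>clifford ip\<^esub> cv \<omega> \<otimes>\<^bsub>clifford ip\<^esub> fr \<beta> =
      k \<odot>\<^bsub>clifford ip\<^esub> fr \<beta> \<ominus>\<^bsub>clifford ip\<^esub> cv \<omega> \<otimes>\<^bsub>clifford ip\<^esub> (fr \<beta> \<otimes>\<^bsub>clifford ip\<^esub> fr \<beta>)"
    by (simp add: C.Q.minus_eq C.Q.l_distr C.Q.l_minus C.Q.m_assoc C.Q.smult_mult_l)
  also have "\<dots> = k \<odot>\<^bsub>clifford ip\<^esub> fr \<beta> \<oplus>\<^bsub>clifford ip\<^esub> cv \<omega>"
    by (simp add: fr_square[OF assms] C.Q.minus_eq C.Q.r_minus)
  also have "\<dots> = cv (map_prod (corefl \<Phi> \<beta>) (corefl \<Phi> \<beta>) \<omega>)"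
    unfolding corefl_complex[OF assms] k_def fr_eq by (simp add: cv_add cv_scale)
  finally show ?thesis .
qed

lemma fr_cv:
  assumes "\<beta> \<in> roots \<Phi>"
  shows "fr \<beta> \<otimes>\<^bsub>clifford ip\<^esub> cv (of_real_vec v) =
    \<ominus>\<^bsub>clifford ip\<^esub> (cv (of_real_vec (corefl \<Phi> \<beta> v)) \<otimes>\<^bsub>clifford ip\<^esub> fr \<beta>)"
proof -
  have "cv (of_real_vec (corefl \<Phi> \<beta> v)) = fr \<beta> \<otimes>\<^bsub>clifford ip\<^esub> cv (of_real_vec v) \<otimes>\<^bsub>clifford ip\<^esub> fr \<beta>"
    by (simp add: fr_conj[OF assms] linear_0[OF linear_corefl])
  then have "cv (of_real_vec (corefl \<Phi> \<beta> v)) \<otimes>\<^bsub>clifford ip\<^esub> fr \<beta> =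
      fr \<beta> \<otimes>\<^bsub>clifford ip\<^esub> cv (of_real_vec v) \<otimes>\<^bsub>clifford ip\<^esub> (fr \<beta> \<otimes>\<^bsub>clifford ip\<^esub> fr \<beta>)"
    by (simp add: C.Q.m_assoc)
  then show ?thesis by (simp add: fr_square[OF assms] C.Q.r_minus)
qed

lemma fr_fr:
  assumes "\<alpha> \<in> roots \<Phi>" "\<beta> \<in> roots \<Phi>"
  shows "fr \<alpha> \<otimes>\<^bsub>clifford ip\<^esub> fr \<beta> = \<ominus>\<^bsub>clifford ip\<^esub> (fr (refl \<Phi> \<alpha> \<beta>) \<otimes>\<^bsub>clifford ip\<^esub> fr \<alpha>)"
  using fr_cv[OF assms(1), of "unit_coroot \<beta>"] by (simp add: fr_eq unit_coroot_refl[OF assms])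

text \<open>Anticommutators with all vectors are scalar multiples of one. Once one is nonzero they
  determine the complex form, which is nondegenerate.\<close>

lemma inj_cv:
  assumes "\<one>\<^bsub>clifford ip\<^esub> \<noteq> \<zero>\<^bsub>clifford ip\<^esub>"
  shows "inj cv"
proof (rule injI)
  fix \<omega> \<omega>' assume eq: "cv \<omega> = cv \<omega>'"
  have cip_eq: "cip ip \<omega> \<upsilon> = cip ip \<omega>' \<upsilon>" for \<upsilon>
  proof (rule ccontr)
    assume ne: "cip ip \<omega> \<upsilon> \<noteq> cip ip \<omega>' \<upsilon>"
    let ?z = "- 2 * cip ip \<omega> \<upsilon>" and ?w = "- 2 * cip ip \<omega>' \<upsilon>"
    have "?z \<odot>\<^bsub>clifford ip\<^esub> \<one>\<^bsub>clifford ip\<^esub> = ?w \<odot>\<^bsub>clifford ip\<^esub> \<one>\<^bsub>clifford ip\<^esub>"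
      using cv_anticommute[of \<omega> \<upsilon>] cv_anticommute[of \<omega>' \<upsilon>] eq by simp
    then have "(?z + - ?w) \<odot>\<^bsub>clifford ip\<^esub> \<one>\<^bsub>clifford ip\<^esub> = \<zero>\<^bsub>clifford ip\<^esub>"
      by (simp only: C.Q.smult_l_distr C.Q.one_closed C.Q.smult_uminus C.Q.r_neg C.Q.smult_closed)
    then have "(1 / (?z + - ?w)) \<odot>\<^bsub>clifford ip\<^esub> ((?z + - ?w) \<odot>\<^bsub>clifford ip\<^esub> \<one>\<^bsub>clifford ip\<^esub>) =
        \<zero>\<^bsub>clifford ip\<^esub>"
      by simp
    moreover have "1 / (?z + - ?w) * (?z + - ?w) = 1" using ne by simp
    ultimately show False using assms by (simp only: C.Q.smult_smult C.Q.one_closed C.Q.smult_one)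
  qed
  \<comment> \<open>Real test vectors suffice: they show the real and imaginary components
    separately.\<close>
  have "ip (fst \<omega>) v = ip (fst \<omega>') v" "ip (snd \<omega>) v = ip (snd \<omega>') v" for v
    using cip_eq[of "of_real_vec v"] by (simp_all add: cip_def)
  then show "\<omega> = \<omega>'" by (intro prod_eqI ip_eqI)
qed

text \<open>Each factor squares to -1, and the two signs cancel.\<close>

lemma inv_fr_fr:
  assumes "\<alpha> \<in> roots \<Phi>" "\<beta> \<in> roots \<Phi>"
  shows "inv\<^bsub>clifford ip\<^esub> (fr \<alpha> \<otimes>\<^bsub>clifford ip\<^esub> fr \<beta>) = fr \<beta> \<otimes>\<^bsub>clifford ip\<^esub> fr \<alpha>"
proof -
  have one: "fr \<alpha> \<otimes>\<^bsub>clifford ip\<^esub> fr \<beta> \<otimes>\<^bsub>clifford ip\<^esub> (fr \<beta> \<otimes>\<^bsub>clifford ip\<^esub> fr \<alpha>) = \<one>\<^bsub>clifford ip\<^esub>"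
    if "\<alpha> \<in> roots \<Phi>" "\<beta> \<in> roots \<Phi>" for \<alpha> \<beta>
  proof -
    have "fr \<alpha> \<otimes>\<^bsub>clifford ip\<^esub> fr \<beta> \<otimes>\<^bsub>clifford ip\<^esub> (fr \<beta> \<otimes>\<^bsub>clifford ip\<^esub> fr \<alpha>) =
        fr \<alpha> \<otimes>\<^bsub>clifford ip\<^esub> (fr \<beta> \<otimes>\<^bsub>clifford ip\<^esub> fr \<beta>) \<otimes>\<^bsub>clifford ip\<^esub> fr \<alpha>"
      by (simp add: C.Q.m_assoc)
    then show ?thesis using that by (simp add: fr_square C.Q.l_minus C.Q.r_minus)
  qed
  show ?thesis
    by (rule C.Q.inv_unique'[symmetric]) (auto simp: one assms)
qed

text \<open>Products of two roots are the group elements occurring in \<open>Omega_cover\<close>.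
  Such a product is even, hence fixed by the parity automorphism, and its conjugation nests two
  conjugations by single roots.\<close>

lemma pin_proj_fr_fr:
  assumes "\<one>\<^bsub>clifford ip\<^esub> \<noteq> \<zero>\<^bsub>clifford ip\<^esub>" "\<alpha> \<in> roots \<Phi>" "\<beta> \<in> roots \<Phi>"
  shows "pin_proj ip (fr \<alpha> \<otimes>\<^bsub>clifford ip\<^esub> fr \<beta>) =
    map_prod (corefl \<Phi> \<alpha> \<circ> corefl \<Phi> \<beta>) (corefl \<Phi> \<alpha> \<circ> corefl \<Phi> \<beta>)"
proof
  fix \<omega>
  define a where "a = [of_real_vec (unit_coroot \<alpha>), of_real_vec (unit_coroot \<beta>)]"
  have "fr \<alpha> \<otimes>\<^bsub>clifford ip\<^esub> fr \<beta> = C.cls (word a)"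
    using C.cls_word_append[of "[of_real_vec (unit_coroot \<alpha>)]" "[of_real_vec (unit_coroot \<beta>)]"]
    by (simp add: a_def fr_eq clifford_vec_def lists_UNIV)
  then have eps: "clifford_eps (fr \<alpha> \<otimes>\<^bsub>clifford ip\<^esub> fr \<beta>) = fr \<alpha> \<otimes>\<^bsub>clifford ip\<^esub> fr \<beta>"
    by (simp add: clifford_eps_cls parity_twist_single a_def)
  have "fr \<alpha> \<otimes>\<^bsub>clifford ip\<^esub> fr \<beta> \<otimes>\<^bsub>clifford ip\<^esub> cv \<omega> \<otimes>\<^bsub>clifford ip\<^esub> (fr \<beta> \<otimes>\<^bsub>clifford ip\<^esub> fr \<alpha>) =
      fr \<alpha> \<otimes>\<^bsub>clifford ip\<^esub> (fr \<beta> \<otimes>\<^bsub>clifford ip\<^esub> cv \<omega> \<otimes>\<^bsub>clifford ip\<^esub> fr \<beta>) \<otimes>\<^bsub>clifford ip\<^esub> fr \<alpha>"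
    by (simp add: C.Q.m_assoc)
  also have "\<dots> = cv (map_prod (corefl \<Phi> \<alpha> \<circ> corefl \<Phi> \<beta>) (corefl \<Phi> \<alpha> \<circ> corefl \<Phi> \<beta>) \<omega>)"
    by (simp only: fr_conj assms) (cases \<omega>, simp)
  finally show "pin_proj ip (fr \<alpha> \<otimes>\<^bsub>clifford ip\<^esub> fr \<beta>) \<omega> =
      map_prod (corefl \<Phi> \<alpha> \<circ> corefl \<Phi> \<beta>) (corefl \<Phi> \<alpha> \<circ> corefl \<Phi> \<beta>) \<omega>"
    unfolding pin_proj_def eps inv_fr_fr[OF assms(2,3)]
    using the_inv_f_f[OF inj_cv[OF assms(1)]] by simp
qed

lemma weyl_cover_proj_fr_fr:
  assumes "\<one>\<^bsub>clifford ip\<^esub> \<noteq> \<zero>\<^bsub>clifford ip\<^esub>" "\<alpha> \<in> roots \<Phi>" "\<beta> \<in> roots \<Phi>"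
  shows "weyl_cover_proj \<Phi> ip (fr \<alpha> \<otimes>\<^bsub>clifford ip\<^esub> fr \<beta>) = corefl \<Phi> \<alpha> \<circ> corefl \<Phi> \<beta>"
  unfolding weyl_cover_proj_def pin_proj_fr_fr[OF assms]
proof (rule the_equality)
  show "corefl \<Phi> \<alpha> \<circ> corefl \<Phi> \<beta> \<in> carrier (weyl \<Phi>) \<and>
      map_prod (corefl \<Phi> \<alpha> \<circ> corefl \<Phi> \<beta>) (corefl \<Phi> \<alpha> \<circ> corefl \<Phi> \<beta>) =
      map_prod (corefl \<Phi> \<alpha> \<circ> corefl \<Phi> \<beta>) (corefl \<Phi> \<alpha> \<circ> corefl \<Phi> \<beta>)"
    using assms by (simp add: weyl_mult_closed corefl_weyl)
next
  fix w assume "w \<in> carrier (weyl \<Phi>) \<and>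
      map_prod (corefl \<Phi> \<alpha> \<circ> corefl \<Phi> \<beta>) (corefl \<Phi> \<alpha> \<circ> corefl \<Phi> \<beta>) = map_prod w w"
  then have "map_prod (corefl \<Phi> \<alpha> \<circ> corefl \<Phi> \<beta>) (corefl \<Phi> \<alpha> \<circ> corefl \<Phi> \<beta>) (x, x) = map_prod w w (x, x)" for x
    by simp
  then show "w = corefl \<Phi> \<alpha> \<circ> corefl \<Phi> \<beta>" by (intro ext) simp
qed

end

context dirac_setup begin

lemma sum_ip_dual: "(\<Sum>i\<in>I. ip v (e i) * ip w (e' i)) = ip v w"
proof -
  have "ip v w = ip v (\<Sum>i\<in>I. ip w (e' i) *\<^sub>R e i)" by (simp only: dual_expand)
  then show ?thesis by (simp add: linear_sum[OF linear_ip_r] ip_simps mult.commute)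
qed

lemma sum_cip_dual:
  "(\<Sum>i\<in>I. cip ip \<omega> (of_real_vec (e i)) * cip ip \<omega>' (of_real_vec (e' i))) = cip ip \<omega> \<omega>'"
  by (simp add: complex_eq_iff cip_def sum_subtractf sum.distrib sum_ip_dual)

lemma clifford_one_neq_zero: "\<one>\<^bsub>clifford ip\<^esub> \<noteq> \<zero>\<^bsub>clifford ip\<^esub>"
proof -
  define x where "x i \<omega> = cip ip \<omega> (of_real_vec (e i))" for i \<omega>
  define y where "y i \<omega> = cip ip \<omega> (of_real_vec (e' i))" for i \<omega>
  \<comment> \<open>Polarisation: -x y is the sum of the squares of (x - y)/2 and \<i> (x + y)/2.
    Two sites per index thus diagonalise the form directly from dual bases, with no orthonormal
    basis chosen.\<close>
  define L where "L k \<omega> =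
    (if snd k then (x (fst k) \<omega> - y (fst k) \<omega>) / 2 else \<i> * (x (fst k) \<omega> + y (fst k) \<omega>) / 2)"
    for k :: "'i \<times> bool" and \<omega>
  have "finite (I \<times> (UNIV :: bool set))" using finite_I by simp
  \<comment> \<open>Any injective numbering serves to order the sites of the sign strings.\<close>
  then obtain r :: "'i \<times> bool \<Rightarrow> nat" where r: "inj_on r (I \<times> UNIV)"
    using finite_imp_inj_to_nat_seg by blast
  have cip_add: "cip ip (\<omega> + \<omega>') \<upsilon> = cip ip \<omega> \<upsilon> + cip ip \<omega>' \<upsilon>" for \<omega> \<omega>' \<upsilon>
    by (simp add: cip_def complex_eq_iff ip_simps)
  have cip_scale: "cip ip (cscale z \<omega>) \<upsilon> = z * cip ip \<omega> \<upsilon>" for z \<omega> \<upsilon>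
    by (simp add: cip_def cscale_def complex_eq_iff ip_simps algebra_simps)
  interpret clifford_action ip "I \<times> UNIV" r L
  proof
    show "L k (\<omega> + \<omega>') = L k \<omega> + L k \<omega>'" for k \<omega> \<omega>'
      by (simp add: L_def x_def y_def cip_add field_simps)
    show "L k (cscale z \<omega>) = z * L k \<omega>" for k z \<omega>
      by (simp add: L_def x_def y_def cip_scale field_simps)
    fix \<omega> \<omega>'
    have "(\<Sum>k\<in>I \<times> UNIV. L k \<omega> * L k \<omega>') =
        (\<Sum>i\<in>I. \<Sum>b\<in>UNIV. L (i, b) \<omega> * L (i, b) \<omega>')"
      by (simp add: sum.cartesian_product)
    also have "\<dots> = (\<Sum>i\<in>I. - (x i \<omega> * y i \<omega>' + x i \<omega>' * y i \<omega>) / 2)"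
      by (rule sum.cong) (simp_all add: UNIV_bool L_def field_simps)
    also have "\<dots> = - ((\<Sum>i\<in>I. x i \<omega> * y i \<omega>') + (\<Sum>i\<in>I. x i \<omega>' * y i \<omega>)) / 2"
      by (simp add: sum_subtractf sum_negf flip: sum_divide_distrib)
    also have "\<dots> = - (cip ip \<omega> \<omega>' + cip ip \<omega>' \<omega>) / 2"
      unfolding x_def y_def sum_cip_dual ..
    also have "cip ip \<omega>' \<omega> = cip ip \<omega> \<omega>'"
      by (simp add: cip_def complex_eq_iff ip_commute add.commute)
    finally show "(\<Sum>k\<in>I \<times> UNIV. L k \<omega> * L k \<omega>') = - cip ip \<omega> \<omega>'" by simp
  qed (use r finite_I in auto)
  show ?thesis by (rule clifford_nontrivial)
qed

end

section \<open>The graded affine Hecke algebra\<close>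

context root_setup begin

lemma hecke_gens_mem: "w \<in> carrier (weyl \<Phi>) \<Longrightarrow> GrpGen w \<in> hecke_gens \<Phi>" "VecGen \<omega> \<in> hecke_gens \<Phi>"
  by (auto simp: hecke_gens_def)

lemma hecke_presentation: "presentation (hecke_gens \<Phi>) (hecke_rels \<Phi> \<Delta> c)"
proof
  have "corefl \<Phi> \<alpha> \<in> carrier (weyl \<Phi>)" if "\<alpha> \<in> \<Delta>" for \<alpha>
    using that simple_subset corefl_weyl by blast
  then show "hecke_rels \<Phi> \<Delta> c \<subseteq> carrier (free_algebra (hecke_gens \<Phi>))"
    unfolding hecke_rels_def
    by (intro Un_least subsetI; elim CollectE exE conjE singletonE; hypsubst)
      (intro diff_mem_monoid_algebra single_mem_monoid_algebra;
        simp add: hecke_gens_mem weyl_one weyl_mult weyl_mult_closed)+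
qed

sublocale H: presentation "hecke_gens \<Phi>" "hecke_rels \<Phi> \<Delta> c"
  rewrites "presented_algebra (hecke_gens \<Phi>) (hecke_rels \<Phi> \<Delta> c) = hecke \<Phi> \<Delta> c"
  by (rule hecke_presentation) (simp add: hecke_def)

abbreviation HA where "HA \<equiv> hecke \<Phi> \<Delta> c"
abbreviation ht where "ht \<equiv> hecke_t \<Phi> \<Delta> c"
abbreviation hv where "hv \<equiv> hecke_vec \<Phi> \<Delta> c"

lemma ht_mem [intro]: "w \<in> carrier (weyl \<Phi>) \<Longrightarrow> ht w \<in> carrier HA"
  unfolding hecke_t_def by (rule H.cls_mem) (simp add: hecke_gens_mem)

lemma hv_mem [simp, intro]: "hv \<omega> \<in> carrier HA"
  unfolding hecke_vec_def by (rule H.cls_mem) (simp add: hecke_gens_mem)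

lemma ht_one: "ht id = \<one>\<^bsub>HA\<^esub>"
proof -
  have "word [GrpGen \<one>\<^bsub>weyl \<Phi>\<^esub>] - word [] \<in> hecke_rels \<Phi> \<Delta> c"
    unfolding hecke_rels_def by blast
  then have "H.cls (word [GrpGen \<one>\<^bsub>weyl \<Phi>\<^esub>]) = H.cls (word [])" by (rule H.cls_eqI) simp
  then show ?thesis by (simp add: hecke_t_def H.cls_one weyl_one_eq)
qed

lemma ht_mult:
  assumes "u \<in> carrier (weyl \<Phi>)" "v \<in> carrier (weyl \<Phi>)"
  shows "ht u \<otimes>\<^bsub>HA\<^esub> ht v = ht (u \<circ> v)"
proof -
  have "word [GrpGen u, GrpGen v] - word [GrpGen (u \<otimes>\<^bsub>weyl \<Phi>\<^esub> v)] \<in> hecke_rels \<Phi> \<Delta> c"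
    unfolding hecke_rels_def using assms by blast
  then have "H.cls (word [GrpGen u, GrpGen v]) = H.cls (word [GrpGen (u \<otimes>\<^bsub>weyl \<Phi>\<^esub> v)])"
    by (rule H.cls_eqI) (simp add: hecke_gens_mem assms weyl_mult weyl_mult_closed)
  then show ?thesis
    using H.cls_word_append[of "[GrpGen u]" "[GrpGen v]"]
    by (simp add: hecke_t_def assms hecke_gens_mem weyl_mult)
qed

lemma hv_add: "hv (\<omega> + \<omega>') = hv \<omega> \<oplus>\<^bsub>HA\<^esub> hv \<omega>'"
proof -
  have "word [VecGen (\<omega> + \<omega>')] - (word [VecGen \<omega>] + word [VecGen \<omega>']) \<in> hecke_rels \<Phi> \<Delta> c"
    unfolding hecke_rels_def diff_diff_eq[symmetric] by blast
  moreover have mem: "word [VecGen \<omega>] \<in> carrier (free_algebra (hecke_gens \<Phi>))" for \<omega> :: "'b cplx"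
    by (simp add: hecke_gens_mem)
  ultimately have "H.cls (word [VecGen (\<omega> + \<omega>')]) = H.cls (word [VecGen \<omega>] + word [VecGen \<omega>'])"
    by (intro H.cls_eqI add_mem_monoid_algebra)
  then show ?thesis unfolding hecke_vec_def H.cls_add[OF mem mem] .
qed

lemma hv_scale: "hv (cscale z \<omega>) = z \<odot>\<^bsub>HA\<^esub> hv \<omega>"
proof -
  have "word [VecGen (cscale z \<omega>)] - Poly_Mapping.single [VecGen \<omega>] z \<in> hecke_rels \<Phi> \<Delta> c"
    unfolding hecke_rels_def by blast
  then have "H.cls (word [VecGen (cscale z \<omega>)]) = H.cls (Poly_Mapping.single [VecGen \<omega>] z)"
    by (rule H.cls_eqI) (simp add: hecke_gens_mem)
  also have "\<dots> = z \<odot>\<^bsub>HA\<^esub> H.cls (word [VecGen \<omega>])"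
    by (rule H.cls_single) (simp add: hecke_gens_mem)
  finally show ?thesis by (simp add: hecke_vec_def)
qed

lemma hv_commute: "hv \<omega> \<otimes>\<^bsub>HA\<^esub> hv \<omega>' = hv \<omega>' \<otimes>\<^bsub>HA\<^esub> hv \<omega>"
proof -
  have "word [VecGen \<omega>, VecGen \<omega>'] - word [VecGen \<omega>', VecGen \<omega>] \<in> hecke_rels \<Phi> \<Delta> c"
    unfolding hecke_rels_def by blast
  then have "H.cls (word [VecGen \<omega>, VecGen \<omega>']) = H.cls (word [VecGen \<omega>', VecGen \<omega>])"
    by (rule H.cls_eqI) (simp add: hecke_gens_mem)
  then show ?thesis
    using H.cls_word_append[of "[VecGen \<omega>]" "[VecGen \<omega>']"] H.cls_word_append[of "[VecGen \<omega>']" "[VecGen \<omega>]"]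
    by (simp add: hecke_vec_def hecke_gens_mem)
qed

lemma hv_ht_simple:
  assumes "\<alpha> \<in> \<Delta>"
  shows "hv \<omega> \<otimes>\<^bsub>HA\<^esub> ht (corefl \<Phi> \<alpha>) =
    ht (corefl \<Phi> \<alpha>) \<otimes>\<^bsub>HA\<^esub> hv (map_prod (corefl \<Phi> \<alpha>) (corefl \<Phi> \<alpha>) \<omega>)
      \<oplus>\<^bsub>HA\<^esub> (of_real (c \<alpha>) * cpairing \<Phi> \<alpha> \<omega>) \<odot>\<^bsub>HA\<^esub> \<one>\<^bsub>HA\<^esub>"
proof -
  let ?s = "corefl \<Phi> \<alpha>"
  let ?\<omega> = "map_prod ?s ?s \<omega>"
  let ?k = "of_real (c \<alpha>) * cpairing \<Phi> \<alpha> \<omega>"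
  have s: "?s \<in> carrier (weyl \<Phi>)" using assms simple_subset corefl_weyl by blast
  have mem: "word [GrpGen ?s, VecGen ?\<omega>] \<in> carrier (free_algebra (hecke_gens \<Phi>))"
    "Poly_Mapping.single [] ?k \<in> carrier (free_algebra (hecke_gens \<Phi>))"
    using s by (simp_all add: hecke_gens_mem)
  have "word [VecGen \<omega>, GrpGen ?s] - (word [GrpGen ?s, VecGen ?\<omega>] + Poly_Mapping.single [] ?k)
      \<in> hecke_rels \<Phi> \<Delta> c"
    unfolding hecke_rels_def diff_diff_eq[symmetric] using assms by blast
  then have "H.cls (word [VecGen \<omega>, GrpGen ?s]) =
      H.cls (word [GrpGen ?s, VecGen ?\<omega>] + Poly_Mapping.single [] ?k)"
    using mem by (intro H.cls_eqI add_mem_monoid_algebra)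
  also have "\<dots> = H.cls (word [GrpGen ?s, VecGen ?\<omega>]) \<oplus>\<^bsub>HA\<^esub> ?k \<odot>\<^bsub>HA\<^esub> \<one>\<^bsub>HA\<^esub>"
    unfolding H.cls_add[OF mem] H.cls_one[symmetric] by (subst H.cls_single[of "[]" ?k]) simp_all
  finally show ?thesis
    using H.cls_word_append[of "[VecGen \<omega>]" "[GrpGen ?s]"] H.cls_word_append[of "[GrpGen ?s]" "[VecGen ?\<omega>]"]
    by (simp add: hecke_vec_def hecke_t_def s hecke_gens_mem)
qed

abbreviation hx :: "'b \<Rightarrow> 'b hecke_elem" where "hx v \<equiv> hv (of_real_vec v)"
abbreviation tr :: "'a \<Rightarrow> 'b hecke_elem" where "tr \<beta> \<equiv> ht (corefl \<Phi> \<beta>)"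

lemma tr_mem [intro]: "\<beta> \<in> roots \<Phi> \<Longrightarrow> tr \<beta> \<in> carrier HA"
  by (intro ht_mem corefl_weyl)

lemma tr_square: "\<beta> \<in> roots \<Phi> \<Longrightarrow> tr \<beta> \<otimes>\<^bsub>HA\<^esub> tr \<beta> = \<one>\<^bsub>HA\<^esub>"
  using ht_one by (simp add: ht_mult corefl_weyl comp_def corefl_corefl id_def)

lemma tr_tr:
  assumes "\<alpha> \<in> roots \<Phi>" "\<beta> \<in> roots \<Phi>"
  shows "tr \<alpha> \<otimes>\<^bsub>HA\<^esub> tr \<beta> = tr (refl \<Phi> \<alpha> \<beta>) \<otimes>\<^bsub>HA\<^esub> tr \<alpha>"
  using corefl_comp_swap[OF assms] by (simp add: ht_mult corefl_weyl refl_mem assms)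

lemma tr_refl:
  assumes "\<alpha> \<in> roots \<Phi>" "\<beta> \<in> roots \<Phi>"
  shows "tr (refl \<Phi> \<alpha> \<beta>) = tr \<alpha> \<otimes>\<^bsub>HA\<^esub> tr \<beta> \<otimes>\<^bsub>HA\<^esub> tr \<alpha>"
proof -
  have "tr \<alpha> \<otimes>\<^bsub>HA\<^esub> tr \<beta> \<otimes>\<^bsub>HA\<^esub> tr \<alpha> = tr (refl \<Phi> \<alpha> \<beta>) \<otimes>\<^bsub>HA\<^esub> (tr \<alpha> \<otimes>\<^bsub>HA\<^esub> tr \<alpha>)"
    unfolding tr_tr[OF assms] using assms by (simp add: H.Q.m_assoc tr_mem refl_mem)
  then show ?thesis using assms by (simp add: tr_square tr_mem refl_mem)
qed

lemma rlin_hx: "rlin HA hx"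
proof -
  have "hx (v + w) = hx v \<oplus>\<^bsub>HA\<^esub> hx w" for v w
    by (subst hv_add[symmetric]) simp
  moreover have "hx (r *\<^sub>R v) = complex_of_real r \<odot>\<^bsub>HA\<^esub> hx v" for r v
    by (subst hv_scale[symmetric]) (simp add: cscale_def)
  ultimately show ?thesis by (simp add: rlin_def)
qed

lemma cpairing_real: "cpairing \<Phi> \<beta> (of_real_vec v) = of_real (pairing \<Phi> \<beta> v)"
  by (simp add: cpairing_def complex_of_real_def linear_0[OF linear_pairing_r])

text \<open>The group algebra part subtracted in the tilde element, for real vectors and with the
  factor 1/2 moved into the coefficients.\<close>

definition hT :: "'b \<Rightarrow> 'b hecke_elem" where
  "hT v = (\<Oplus>\<^bsub>HA\<^esub>\<beta>\<in>Rp. of_real (c \<beta> * pairing \<Phi> \<beta> v / 2) \<odot>\<^bsub>HA\<^esub> tr \<beta>)"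

abbreviation hz :: "'b \<Rightarrow> 'b hecke_elem" where "hz v \<equiv> hecke_tilde \<Phi> Rp \<Delta> c (of_real_vec v)"

lemma tr_positive_mem [intro]: "\<beta> \<in> Rp \<Longrightarrow> tr \<beta> \<in> carrier HA"
  by (intro tr_mem positive_roots)

lemma rlin_hT: "rlin HA hT"
  unfolding rlin_def
proof (intro conjI allI)
  fix v w r
  show "hT v \<in> carrier HA"
    unfolding hT_def by (auto intro!: H.Q.finsum_closed)
  have "hT v \<oplus>\<^bsub>HA\<^esub> hT w = (\<Oplus>\<^bsub>HA\<^esub>\<beta>\<in>Rp.
      of_real (c \<beta> * pairing \<Phi> \<beta> v / 2) \<odot>\<^bsub>HA\<^esub> tr \<beta> \<oplus>\<^bsub>HA\<^esub> of_real (c \<beta> * pairing \<Phi> \<beta> w / 2) \<odot>\<^bsub>HA\<^esub> tr \<beta>)"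
    unfolding hT_def by (subst H.Q.finsum_addf) auto
  also have "\<dots> = hT (v + w)"
    unfolding hT_def
    by (intro H.Q.finsum_cong' HOL.refl)
      (auto simp: tr_positive_mem pairing_simps distrib_left add_divide_distrib simp flip: H.Q.smult_l_distr)
  finally show "hT (v + w) = hT v \<oplus>\<^bsub>HA\<^esub> hT w" ..
  have "complex_of_real r \<odot>\<^bsub>HA\<^esub> hT v =
      (\<Oplus>\<^bsub>HA\<^esub>\<beta>\<in>Rp. of_real r \<odot>\<^bsub>HA\<^esub> (of_real (c \<beta> * pairing \<Phi> \<beta> v / 2) \<odot>\<^bsub>HA\<^esub> tr \<beta>))"
    unfolding hT_def by (subst H.Q.finsum_smult) auto
  also have "\<dots> = hT (r *\<^sub>R v)"
    unfolding hT_def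
    by (intro H.Q.finsum_cong' HOL.refl)
      (auto simp: tr_positive_mem pairing_simps H.Q.smult_smult mult_ac)
  finally show "hT (r *\<^sub>R v) = complex_of_real r \<odot>\<^bsub>HA\<^esub> hT v" ..
qed

lemma hT_mem [simp, intro]: "hT v \<in> carrier HA"
  by (rule rlin_mem[OF rlin_hT])

lemma hz_eq: "hz v = hx v \<ominus>\<^bsub>HA\<^esub> hT v"
proof -
  have "(1/2) \<odot>\<^bsub>HA\<^esub> (\<Oplus>\<^bsub>HA\<^esub>\<beta>\<in>Rp. (of_real (c \<beta>) * cpairing \<Phi> \<beta> (of_real_vec v)) \<odot>\<^bsub>HA\<^esub> tr \<beta>) =
      (\<Oplus>\<^bsub>HA\<^esub>\<beta>\<in>Rp. (1/2) \<odot>\<^bsub>HA\<^esub> ((of_real (c \<beta>) * cpairing \<Phi> \<beta> (of_real_vec v)) \<odot>\<^bsub>HA\<^esub> tr \<beta>))"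
    by (subst H.Q.finsum_smult) auto
  also have "\<dots> = hT v"
    unfolding hT_def
    by (intro H.Q.finsum_cong' HOL.refl) (auto simp: tr_positive_mem H.Q.smult_smult cpairing_real)
  finally show ?thesis by (simp add: hecke_tilde_def)
qed

lemma rlin_hz: "rlin HA hz"
  unfolding rlin_def hz_eq
proof (intro conjI allI)
  fix v w r
  show "hx v \<ominus>\<^bsub>HA\<^esub> hT v \<in> carrier HA" by simp
  show "hx (v + w) \<ominus>\<^bsub>HA\<^esub> hT (v + w) = hx v \<ominus>\<^bsub>HA\<^esub> hT v \<oplus>\<^bsub>HA\<^esub> (hx w \<ominus>\<^bsub>HA\<^esub> hT w)"
    by (simp add: rlin_add[OF rlin_hx] rlin_add[OF rlin_hT] H.Q.minus_eq H.Q.minus_add H.Q.a_ac)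
  show "hx (r *\<^sub>R v) \<ominus>\<^bsub>HA\<^esub> hT (r *\<^sub>R v) = complex_of_real r \<odot>\<^bsub>HA\<^esub> (hx v \<ominus>\<^bsub>HA\<^esub> hT v)"
    by (simp add: rlin_scale[OF rlin_hx] rlin_scale[OF rlin_hT] H.Q.minus_eq H.Q.smult_r_distr H.Q.smult_minus)
qed

lemma hz_mem [simp, intro]: "hz v \<in> carrier HA"
  by (rule rlin_mem[OF rlin_hz])

text \<open>The terms of the positive roots other than \<alpha> are permuted and give the same
  remainder \<open>R\<close> on both sides. The term of \<alpha> flips its sign, and the difference
  of its two halves is the full scalar term.\<close>

lemma tr_hT_simple:
  assumes "\<alpha> \<in> \<Delta>"
  shows "tr \<alpha> \<otimes>\<^bsub>HA\<^esub> hT v =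
    hT (corefl \<Phi> \<alpha> v) \<otimes>\<^bsub>HA\<^esub> tr \<alpha> \<oplus>\<^bsub>HA\<^esub> of_real (c \<alpha> * pairing \<Phi> \<alpha> v) \<odot>\<^bsub>HA\<^esub> \<one>\<^bsub>HA\<^esub>"
proof -
  have \<alpha>: "\<alpha> \<in> roots \<Phi>" "\<alpha> \<in> Rp" using assms simple_subset simple_positive by auto
  define g where "g \<beta> v = complex_of_real (c \<beta> * pairing \<Phi> \<beta> v / 2)" for \<beta> v
  define R where "R = (\<Oplus>\<^bsub>HA\<^esub>\<beta>\<in>Rp - {\<alpha>}. g \<beta> v \<odot>\<^bsub>HA\<^esub> (tr \<alpha> \<otimes>\<^bsub>HA\<^esub> tr \<beta>))"
  have R: "R \<in> carrier HA"
    unfolding R_def using \<alpha> by (auto intro!: H.Q.finsum_closed)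
  have Rp: "Rp = insert \<alpha> (Rp - {\<alpha>})" using \<alpha>(2) by auto
  have fin: "finite (Rp - {\<alpha>})" using finite_positive by simp
  have "tr \<alpha> \<otimes>\<^bsub>HA\<^esub> hT v = (\<Oplus>\<^bsub>HA\<^esub>\<beta>\<in>Rp. tr \<alpha> \<otimes>\<^bsub>HA\<^esub> (g \<beta> v \<odot>\<^bsub>HA\<^esub> tr \<beta>))"
    unfolding hT_def g_def using \<alpha> finite_positive by (intro H.Q.finsum_rdistr) auto
  also have "\<dots> = (\<Oplus>\<^bsub>HA\<^esub>\<beta>\<in>Rp. g \<beta> v \<odot>\<^bsub>HA\<^esub> (tr \<alpha> \<otimes>\<^bsub>HA\<^esub> tr \<beta>))"
    using \<alpha> by (intro H.Q.finsum_cong' HOL.refl) (auto simp: H.Q.smult_mult_r tr_mem tr_positive_mem)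
  also have "\<dots> = g \<alpha> v \<odot>\<^bsub>HA\<^esub> \<one>\<^bsub>HA\<^esub> \<oplus>\<^bsub>HA\<^esub> R"
    unfolding R_def using \<alpha> fin
    by (subst Rp, subst H.Q.finsum_insert) (auto simp: tr_square)
  finally have left: "tr \<alpha> \<otimes>\<^bsub>HA\<^esub> hT v = g \<alpha> v \<odot>\<^bsub>HA\<^esub> \<one>\<^bsub>HA\<^esub> \<oplus>\<^bsub>HA\<^esub> R" .
  \<comment> \<open>A simple reflection permutes the positive roots other than its own; \<alpha> is
    not hit, since its only preimage is negative.\<close>
  have img: "refl \<Phi> \<alpha> ` (Rp - {\<alpha>}) = Rp - {\<alpha>}"
  proof -
    have "refl \<Phi> \<alpha> \<beta> \<in> Rp - {\<alpha>}" if "\<beta> \<in> Rp - {\<alpha>}" for \<beta>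
    proof -
      have "refl \<Phi> \<alpha> \<beta> \<noteq> \<alpha>"
      proof
        assume "refl \<Phi> \<alpha> \<beta> = \<alpha>"
        then have "\<beta> = - \<alpha>" using refl_refl[OF \<alpha>(1), of \<beta>] refl_self[OF \<alpha>(1)] by simp
        then show False using that \<alpha> neg_positive_iff by auto
      qed
      then show ?thesis using that refl_simple_positive[OF assms] by auto
    qed
    then show ?thesis
      using refl_refl[OF \<alpha>(1)] by (auto intro!: image_eqI[of _ "refl \<Phi> \<alpha>" "refl \<Phi> \<alpha> _"])
  qed
  have "hT (corefl \<Phi> \<alpha> v) \<otimes>\<^bsub>HA\<^esub> tr \<alpha> =
      (\<Oplus>\<^bsub>HA\<^esub>\<beta>\<in>Rp. (g \<beta> (corefl \<Phi> \<alpha> v) \<odot>\<^bsub>HA\<^esub> tr \<beta>) \<otimes>\<^bsub>HA\<^esub> tr \<alpha>)"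
    unfolding hT_def g_def using \<alpha> finite_positive by (intro H.Q.finsum_ldistr) auto
  also have "\<dots> = (\<Oplus>\<^bsub>HA\<^esub>\<beta>\<in>Rp. g \<beta> (corefl \<Phi> \<alpha> v) \<odot>\<^bsub>HA\<^esub> (tr \<beta> \<otimes>\<^bsub>HA\<^esub> tr \<alpha>))"
    using \<alpha> by (intro H.Q.finsum_cong' HOL.refl) (auto simp: H.Q.smult_mult_l tr_mem tr_positive_mem)
  also have "\<dots> = g \<alpha> (corefl \<Phi> \<alpha> v) \<odot>\<^bsub>HA\<^esub> \<one>\<^bsub>HA\<^esub> \<oplus>\<^bsub>HA\<^esub>
      (\<Oplus>\<^bsub>HA\<^esub>\<beta>\<in>Rp - {\<alpha>}. g \<beta> (corefl \<Phi> \<alpha> v) \<odot>\<^bsub>HA\<^esub> (tr \<beta> \<otimes>\<^bsub>HA\<^esub> tr \<alpha>))"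
    using \<alpha> fin by (subst Rp, subst H.Q.finsum_insert) (auto simp: tr_square)
  also have "g \<alpha> (corefl \<Phi> \<alpha> v) = - g \<alpha> v"
    by (simp add: g_def pairing_corefl \<alpha> refl_self linear_neg[OF linear_pairing_l])
  also have "(\<Oplus>\<^bsub>HA\<^esub>\<beta>\<in>Rp - {\<alpha>}. g \<beta> (corefl \<Phi> \<alpha> v) \<odot>\<^bsub>HA\<^esub> (tr \<beta> \<otimes>\<^bsub>HA\<^esub> tr \<alpha>)) =
      (\<Oplus>\<^bsub>HA\<^esub>\<beta>\<in>refl \<Phi> \<alpha> ` (Rp - {\<alpha>}). g \<beta> (corefl \<Phi> \<alpha> v) \<odot>\<^bsub>HA\<^esub> (tr \<beta> \<otimes>\<^bsub>HA\<^esub> tr \<alpha>))"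
    by (simp only: img)
  also have "\<dots> = (\<Oplus>\<^bsub>HA\<^esub>\<beta>\<in>Rp - {\<alpha>}.
      g (refl \<Phi> \<alpha> \<beta>) (corefl \<Phi> \<alpha> v) \<odot>\<^bsub>HA\<^esub> (tr (refl \<Phi> \<alpha> \<beta>) \<otimes>\<^bsub>HA\<^esub> tr \<alpha>))"
  proof (rule H.Q.finsum_reindex)
    show "inj_on (refl \<Phi> \<alpha>) (Rp - {\<alpha>})"
      by (rule inj_on_inverseI[of _ "refl \<Phi> \<alpha>"]) (simp add: refl_refl \<alpha>)
    show "(\<lambda>\<beta>. g \<beta> (corefl \<Phi> \<alpha> v) \<odot>\<^bsub>HA\<^esub> (tr \<beta> \<otimes>\<^bsub>HA\<^esub> tr \<alpha>))
        \<in> refl \<Phi> \<alpha> ` (Rp - {\<alpha>}) \<rightarrow> carrier HA"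
      unfolding img using \<alpha> by auto
  qed
  \<comment> \<open>Reindexing by the reflection leaves \<open>c\<close> and the pairing unchanged,
    and moves \<open>tr \<alpha>\<close> from the right of the product to the left.\<close>
  also have "\<dots> = R"
    unfolding R_def using \<alpha>
    by (intro H.Q.finsum_cong' HOL.refl)
      (auto simp: g_def c_refl positive_roots pairing_refl_corefl tr_tr[OF \<alpha>(1), symmetric])
  finally have right: "hT (corefl \<Phi> \<alpha> v) \<otimes>\<^bsub>HA\<^esub> tr \<alpha> = (- g \<alpha> v) \<odot>\<^bsub>HA\<^esub> \<one>\<^bsub>HA\<^esub> \<oplus>\<^bsub>HA\<^esub> R" .
  have "g \<alpha> v \<odot>\<^bsub>HA\<^esub> \<one>\<^bsub>HA\<^esub> =
      (- g \<alpha> v) \<odot>\<^bsub>HA\<^esub> \<one>\<^bsub>HA\<^esub> \<oplus>\<^bsub>HA\<^esub> of_real (c \<alpha> * pairing \<Phi> \<alpha> v) \<odot>\<^bsub>HA\<^esub> \<one>\<^bsub>HA\<^esub>"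
    by (subst H.Q.smult_l_distr[symmetric]) (simp_all add: g_def)
  then show ?thesis unfolding left right using R by (simp add: H.Q.a_ac)
qed

text \<open>The Hecke relation is applied to the reflected vector, so that the group element ends up
  on the left of the original one; \<alpha> pairs with the reflected vector with opposite sign. The
  scalar agrees with the one for \<open>hT\<close>, which is the point of the tilde
  correction.\<close>

lemma tr_hx_simple:
  assumes "\<alpha> \<in> \<Delta>"
  shows "tr \<alpha> \<otimes>\<^bsub>HA\<^esub> hx v =
    hx (corefl \<Phi> \<alpha> v) \<otimes>\<^bsub>HA\<^esub> tr \<alpha> \<oplus>\<^bsub>HA\<^esub> of_real (c \<alpha> * pairing \<Phi> \<alpha> v) \<odot>\<^bsub>HA\<^esub> \<one>\<^bsub>HA\<^esub>"
proof -
  have \<alpha>: "\<alpha> \<in> roots \<Phi>" using assms simple_subset by auto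
  have "hx (corefl \<Phi> \<alpha> v) \<otimes>\<^bsub>HA\<^esub> tr \<alpha> = tr \<alpha> \<otimes>\<^bsub>HA\<^esub> hx v \<oplus>\<^bsub>HA\<^esub>
      (- of_real (c \<alpha> * pairing \<Phi> \<alpha> v)) \<odot>\<^bsub>HA\<^esub> \<one>\<^bsub>HA\<^esub>"
    using hv_ht_simple[OF assms, of "of_real_vec (corefl \<Phi> \<alpha> v)"]
    by (simp add: corefl_corefl[OF \<alpha>] linear_0[OF linear_corefl] cpairing_real pairing_corefl \<alpha>
        refl_self linear_neg[OF linear_pairing_l])
  then show ?thesis
    using tr_mem[OF \<alpha>] by (simp add: H.Q.smult_uminus H.Q.a_assoc H.Q.l_neg)
qed

text \<open>For simple roots the two scalar defects cancel. The property passes from \<beta> to its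
  reflection because the reflection of a reflected root is the conjugate one.\<close>

lemma tr_hz:
  assumes "\<beta> \<in> Rp"
  shows "tr \<beta> \<otimes>\<^bsub>HA\<^esub> hz v = hz (corefl \<Phi> \<beta> v) \<otimes>\<^bsub>HA\<^esub> tr \<beta>"
proof -
  have simple_case: "tr \<alpha> \<otimes>\<^bsub>HA\<^esub> hz v = hz (corefl \<Phi> \<alpha> v) \<otimes>\<^bsub>HA\<^esub> tr \<alpha>" if "\<alpha> \<in> \<Delta>" for \<alpha> v
  proof -
    have t: "tr \<alpha> \<in> carrier HA" using that simple_subset by auto
    define k where "k = complex_of_real (c \<alpha> * pairing \<Phi> \<alpha> v) \<odot>\<^bsub>HA\<^esub> \<one>\<^bsub>HA\<^esub>"
    define a where "a = hx (corefl \<Phi> \<alpha> v) \<otimes>\<^bsub>HA\<^esub> tr \<alpha>"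
    define b where "b = hT (corefl \<Phi> \<alpha> v) \<otimes>\<^bsub>HA\<^esub> tr \<alpha>"
    have mem: "k \<in> carrier HA" "a \<in> carrier HA" "b \<in> carrier HA"
      using t by (auto simp: k_def a_def b_def)
    have "tr \<alpha> \<otimes>\<^bsub>HA\<^esub> hz v = tr \<alpha> \<otimes>\<^bsub>HA\<^esub> hx v \<oplus>\<^bsub>HA\<^esub> \<ominus>\<^bsub>HA\<^esub> (tr \<alpha> \<otimes>\<^bsub>HA\<^esub> hT v)"
      using t by (simp add: hz_eq H.Q.minus_eq H.Q.r_distr H.Q.r_minus)
    also have "\<dots> = (a \<oplus>\<^bsub>HA\<^esub> k) \<oplus>\<^bsub>HA\<^esub> \<ominus>\<^bsub>HA\<^esub> (b \<oplus>\<^bsub>HA\<^esub> k)"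
      by (simp only: tr_hx_simple[OF that] tr_hT_simple[OF that] a_def b_def k_def)
    also have "\<dots> = a \<oplus>\<^bsub>HA\<^esub> \<ominus>\<^bsub>HA\<^esub> b \<oplus>\<^bsub>HA\<^esub> (k \<oplus>\<^bsub>HA\<^esub> \<ominus>\<^bsub>HA\<^esub> k)"
      using mem by (simp add: H.Q.minus_add H.Q.a_ac del: H.Q.r_neg)
    also have "\<dots> = a \<oplus>\<^bsub>HA\<^esub> \<ominus>\<^bsub>HA\<^esub> b"
      using mem by (simp add: H.Q.r_neg)
    also have "\<dots> = hz (corefl \<Phi> \<alpha> v) \<otimes>\<^bsub>HA\<^esub> tr \<alpha>"
      using t by (simp add: a_def b_def hz_eq H.Q.minus_eq H.Q.l_distr H.Q.l_minus)
    finally show ?thesis .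
  qed
  \<comment> \<open>The vector is generalised because the induction hypothesis is applied to its
    image under a simple reflection.\<close>
  have "\<forall>v. tr \<beta> \<otimes>\<^bsub>HA\<^esub> hz v = hz (corefl \<Phi> \<beta> v) \<otimes>\<^bsub>HA\<^esub> tr \<beta>"
    using assms
  proof (induction rule: positive_root_induct)
    case (simple \<alpha>)
    then show ?case using simple_case by blast
  next
    case (refl \<alpha> \<beta>)
    have r: "\<alpha> \<in> roots \<Phi>" "\<beta> \<in> roots \<Phi>" using refl simple_subset positive_roots by auto
    have t: "tr \<alpha> \<in> carrier HA" "tr \<beta> \<in> carrier HA" using r by auto
    show ?case
    proof
      fix v
      let ?v = "corefl \<Phi> \<alpha> v"
      have "tr \<alpha> \<otimes>\<^bsub>HA\<^esub> tr \<beta> \<otimes>\<^bsub>HA\<^esub> tr \<alpha> \<otimes>\<^bsub>HA\<^esub> hz v =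
          tr \<alpha> \<otimes>\<^bsub>HA\<^esub> (tr \<beta> \<otimes>\<^bsub>HA\<^esub> (tr \<alpha> \<otimes>\<^bsub>HA\<^esub> hz v))"
        using t by (simp add: H.Q.m_assoc)
      also have "\<dots> = tr \<alpha> \<otimes>\<^bsub>HA\<^esub> (tr \<beta> \<otimes>\<^bsub>HA\<^esub> hz ?v) \<otimes>\<^bsub>HA\<^esub> tr \<alpha>"
        unfolding simple_case[OF refl(1)] using t by (simp add: H.Q.m_assoc)
      also have "\<dots> = tr \<alpha> \<otimes>\<^bsub>HA\<^esub> hz (corefl \<Phi> \<beta> ?v) \<otimes>\<^bsub>HA\<^esub> (tr \<beta> \<otimes>\<^bsub>HA\<^esub> tr \<alpha>)"
        unfolding spec[OF refl(3)] using t by (simp add: H.Q.m_assoc)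
      also have "\<dots> = hz (corefl \<Phi> \<alpha> (corefl \<Phi> \<beta> ?v)) \<otimes>\<^bsub>HA\<^esub> (tr \<alpha> \<otimes>\<^bsub>HA\<^esub> tr \<beta> \<otimes>\<^bsub>HA\<^esub> tr \<alpha>)"
        unfolding simple_case[OF refl(1)] using t by (simp add: H.Q.m_assoc)
      finally show "tr (Defs.refl \<Phi> \<alpha> \<beta>) \<otimes>\<^bsub>HA\<^esub> hz v =
          hz (corefl \<Phi> (Defs.refl \<Phi> \<alpha> \<beta>) v) \<otimes>\<^bsub>HA\<^esub> tr (Defs.refl \<Phi> \<alpha> \<beta>)"
        using r by (simp add: tr_refl corefl_refl)
    qed
  qed
  then show ?thesis by blast
qed

end

section \<open>The square of the Dirac operator\<close>

context complex_algebra_pair begin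

text \<open>The sum is the image of the canonical tensor of the inner product, hence invariant under
  every orthogonal map. Concretely, the matrix of \<open>s\<close> is moved from the first factor to
  the second, where it undoes the second copy of \<open>s\<close>.\<close>

lemma tens_rlin_invariance:
  assumes f: "rlin A f" and g: "rlin B g" and "finite I"
    and linear: "linear s" and expand: "\<And>v. (\<Sum>j\<in>I. ip v (e' j) *\<^sub>R e j) = v"
      "\<And>v. (\<Sum>i\<in>I. ip v (e i) *\<^sub>R e' i) = v"
    and adjoint: "\<And>v w. ip (s v) w = ip (s w) v" and invol: "\<And>v. s (s v) = v"
  shows "(\<Oplus>\<^bsub>AB\<^esub>i\<in>I. tn (f (s (e i))) (g (s (e' i)))) = (\<Oplus>\<^bsub>AB\<^esub>i\<in>I. tn (f (e i)) (g (e' i)))"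
proof -
  note mem = rlin_mem[OF f] rlin_mem[OF g]
  have "(\<Oplus>\<^bsub>AB\<^esub>i\<in>I. tn (f (s (e i))) (g (s (e' i)))) =
      (\<Oplus>\<^bsub>AB\<^esub>i\<in>I. \<Oplus>\<^bsub>AB\<^esub>j\<in>I. of_real (ip (s (e i)) (e' j)) \<odot>\<^bsub>AB\<^esub> tn (f (e j)) (g (s (e' i))))"
  proof (intro AB.finsum_cong' HOL.refl)
    fix i
    have "f (s (e i)) = (\<Oplus>\<^bsub>A\<^esub>j\<in>I. of_real (ip (s (e i)) (e' j)) \<odot>\<^bsub>A\<^esub> f (e j))"
      using A.rlin_sum[OF f, of "\<lambda>j. ip (s (e i)) (e' j)" e I] by (simp only: expand)
    then show "tn (f (s (e i))) (g (s (e' i))) =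
        (\<Oplus>\<^bsub>AB\<^esub>j\<in>I. of_real (ip (s (e i)) (e' j)) \<odot>\<^bsub>AB\<^esub> tn (f (e j)) (g (s (e' i))))"
      by (simp add: tens_finsum_l tens_smult_l mem)
  qed (auto intro!: AB.finsum_closed simp: mem)
  also have "\<dots> = (\<Oplus>\<^bsub>AB\<^esub>j\<in>I. \<Oplus>\<^bsub>AB\<^esub>i\<in>I. of_real (ip (s (e i)) (e' j)) \<odot>\<^bsub>AB\<^esub> tn (f (e j)) (g (s (e' i))))"
    using \<open>finite I\<close> by (intro AB.finsum_swap) (auto simp: mem)
  also have "\<dots> = (\<Oplus>\<^bsub>AB\<^esub>j\<in>I. tn (f (e j)) (g (e' j)))"
  proof (intro AB.finsum_cong' HOL.refl)
    fix j
    \<comment> \<open>The vector \<open>s (e' j)\<close> is expanded in the basis \<open>e'\<close>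
      and mapped back by the involution; self-adjointness makes the coefficients equal to the matrix
      entries from the first factor.\<close>
    have "e' j = s (\<Sum>i\<in>I. ip (s (e' j)) (e i) *\<^sub>R e' i)"
      by (simp only: expand invol)
    also have "\<dots> = (\<Sum>i\<in>I. ip (s (e i)) (e' j) *\<^sub>R s (e' i))"
      by (simp add: linear_sum[OF linear] linear_scale[OF linear] adjoint[of "e' j"])
    finally have "g (e' j) = g (\<Sum>i\<in>I. ip (s (e i)) (e' j) *\<^sub>R s (e' i))" by simp
    also have "\<dots> = (\<Oplus>\<^bsub>B\<^esub>i\<in>I. of_real (ip (s (e i)) (e' j)) \<odot>\<^bsub>B\<^esub> g (s (e' i)))"
      by (rule B.rlin_sum[OF g])
    finally have "g (e' j) = (\<Oplus>\<^bsub>B\<^esub>i\<in>I. of_real (ip (s (e i)) (e' j)) \<odot>\<^bsub>B\<^esub> g (s (e' i)))" .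
    then show "(\<Oplus>\<^bsub>AB\<^esub>i\<in>I. of_real (ip (s (e i)) (e' j)) \<odot>\<^bsub>AB\<^esub> tn (f (e j)) (g (s (e' i)))) =
        tn (f (e j)) (g (e' j))"
      by (simp add: tens_finsum_r tens_smult_r mem)
  qed (auto simp: mem)
  finally show ?thesis .
qed

end

context complex_algebra begin

definition lin_comb :: "('g \<Rightarrow> 'x) \<Rightarrow> ('g \<Rightarrow>\<^sub>0 complex) \<Rightarrow> 'x" where
  "lin_comb G x = (\<Oplus>a\<in>Poly_Mapping.keys x. Poly_Mapping.lookup x a \<odot> G a)"

lemma lin_comb_superset:
  assumes "finite B" "Poly_Mapping.keys x \<subseteq> B" "\<And>a. a \<in> B \<Longrightarrow> G a \<in> carrier A"
  shows "lin_comb G x = (\<Oplus>a\<in>B. Poly_Mapping.lookup x a \<odot> G a)"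
  unfolding lin_comb_def
  by (rule add.finprod_mono_neutral_cong_left) (use assms in \<open>auto simp: in_keys_iff\<close>)

text \<open>Different \<open>p\<close> may share the same \<open>a p\<close>, in which case the
  support on the left is smaller than \<open>S\<close>. The coefficients at a common element add up,
  and scalar multiplication distributes over them.\<close>

lemma lin_comb_sum:
  assumes "finite S" "\<And>p. p \<in> S \<Longrightarrow> G (a p) \<in> carrier A"
  shows "lin_comb G (\<Sum>p\<in>S. Poly_Mapping.single (a p) (k p)) = (\<Oplus>p\<in>S. k p \<odot> G (a p))"
  using assms
proof (induction S rule: finite_induct)
  case empty
  then show ?case by (simp add: lin_comb_def)
next
  case (insert p S)
  let ?x = "\<Sum>p\<in>S. Poly_Mapping.single (a p) (k p)" and ?y = "Poly_Mapping.single (a p) (k p)"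
  let ?B = "insert (a p) (a ` S)"
  have kx: "Poly_Mapping.keys ?x \<subseteq> a ` S"
    using keys_sum[of "\<lambda>p. Poly_Mapping.single (a p) (k p)" S] by (force split: if_splits)
  have ky: "Poly_Mapping.keys ?y \<subseteq> {a p}" by simp
  have G: "G b \<in> carrier A" if "b \<in> ?B" for b using that insert.prems by auto
  have "lin_comb G (?y + ?x) = (\<Oplus>b\<in>?B. Poly_Mapping.lookup (?y + ?x) b \<odot> G b)"
    using insert.hyps G kx ky keys_add[of ?y ?x] by (intro lin_comb_superset) auto
  also have "\<dots> = (\<Oplus>b\<in>?B. Poly_Mapping.lookup ?y b \<odot> G b \<oplus> Poly_Mapping.lookup ?x b \<odot> G b)"
    using G by (intro finsum_cong' HOL.refl) (auto simp: lookup_add smult_l_distr)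
  also have "\<dots> = (\<Oplus>b\<in>?B. Poly_Mapping.lookup ?y b \<odot> G b) \<oplus> (\<Oplus>b\<in>?B. Poly_Mapping.lookup ?x b \<odot> G b)"
    using G by (intro finsum_addf) auto
  also have "(\<Oplus>b\<in>?B. Poly_Mapping.lookup ?y b \<odot> G b) = lin_comb G ?y"
    using insert.hyps G ky by (intro lin_comb_superset[symmetric]) auto
  also have "lin_comb G ?y = k p \<odot> G (a p)"
    using insert.prems by (subst lin_comb_superset[of "{a p}"]) auto
  also have "(\<Oplus>b\<in>?B. Poly_Mapping.lookup ?x b \<odot> G b) = lin_comb G ?x"
    using insert.hyps G kx by (intro lin_comb_superset[symmetric]) auto
  also have "lin_comb G ?x = (\<Oplus>p\<in>S. k p \<odot> G (a p))"
    using insert by simp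
  finally show ?case using insert by (simp add: Pi_def)
qed

end

section \<open>The splitting of the Dirac operator and the anticommutation\<close>

context dirac_setup begin

sublocale HC: complex_algebra_pair "hecke \<Phi> \<Delta> c" "clifford ip"
  rewrites "tensor_algebra (hecke \<Phi> \<Delta> c) (clifford ip) = hecke_clifford \<Phi> \<Delta> c ip"
proof -
  show "complex_algebra_pair (hecke \<Phi> \<Delta> c) (clifford ip)"
    by (rule complex_algebra_pair.intro) (rule H.Q.complex_algebra_axioms C.Q.complex_algebra_axioms)+
qed (simp add: hecke_clifford_def)

abbreviation R where "R \<equiv> hecke_clifford \<Phi> \<Delta> c ip"
abbreviation cy :: "'b \<Rightarrow> 'b clifford_elem" where "cy v \<equiv> cv (of_real_vec v)"
abbreviation CA where "CA \<equiv> clifford ip"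

definition D where "D = dirac \<Phi> Rp \<Delta> c ip I e e'"
definition E where "E = (\<Oplus>\<^bsub>R\<^esub>i\<in>I. HC.tn (hx (e i)) (cy (e' i)))"
definition T where "T = (\<Oplus>\<^bsub>R\<^esub>i\<in>I. HC.tn (hT (e i)) (cy (e' i)))"
definition u where "u \<beta> = HC.tn (tr \<beta>) (fr \<beta>)"
text \<open>The product of two of these coefficients carries the factor 1/4 of
  \<open>Omega_cover\<close>.\<close>

definition \<kappa> where "\<kappa> \<beta> = c \<beta> * root_norm \<Phi> I e e' \<beta> / 2"

lemma D_eq: "D = (\<Oplus>\<^bsub>R\<^esub>i\<in>I. HC.tn (hz (e i)) (cy (e' i)))"
  by (simp add: D_def dirac_def)

lemma D_mem [simp, intro]: "D \<in> carrier R"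
  unfolding D_eq by (auto intro!: HC.AB.finsum_closed)

lemma E_mem [simp, intro]: "E \<in> carrier R"
  unfolding E_def by (auto intro!: HC.AB.finsum_closed)

lemma T_mem [simp, intro]: "T \<in> carrier R"
  unfolding T_def by (auto intro!: HC.AB.finsum_closed)

lemma u_mem [intro]: "\<beta> \<in> Rp \<Longrightarrow> u \<beta> \<in> carrier R"
  unfolding u_def by (auto intro!: HC.tens_mem)

lemma E_split: "E = D \<oplus>\<^bsub>R\<^esub> T"
proof -
  have "D \<oplus>\<^bsub>R\<^esub> T = (\<Oplus>\<^bsub>R\<^esub>i\<in>I. HC.tn (hz (e i)) (cy (e' i)) \<oplus>\<^bsub>R\<^esub> HC.tn (hT (e i)) (cy (e' i)))"
    unfolding D_eq T_def by (rule HC.AB.finsum_addf[symmetric]) auto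
  also have "\<dots> = E"
    unfolding E_def
  proof (intro HC.AB.finsum_cong' HOL.refl)
    fix i
    have "hz (e i) \<oplus>\<^bsub>HA\<^esub> hT (e i) = hx (e i)"
      by (simp add: hz_eq H.Q.minus_eq H.Q.a_assoc H.Q.l_neg)
    then show "HC.tn (hz (e i)) (cy (e' i)) \<oplus>\<^bsub>R\<^esub> HC.tn (hT (e i)) (cy (e' i)) = HC.tn (hx (e i)) (cy (e' i))"
      by (subst HC.tens_add_l[symmetric]) auto
  qed auto
  finally show ?thesis ..
qed

text \<open>Exchanging the two sums collects, for each positive root, the vector that represents it;
  that vector is its length times its unit coroot.\<close>

lemma T_eq: "T = (\<Oplus>\<^bsub>R\<^esub>\<beta>\<in>Rp. of_real (\<kappa> \<beta>) \<odot>\<^bsub>R\<^esub> u \<beta>)"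
proof -
  have "T = (\<Oplus>\<^bsub>R\<^esub>i\<in>I. \<Oplus>\<^bsub>R\<^esub>\<beta>\<in>Rp. of_real (c \<beta> * pairing \<Phi> \<beta> (e i) / 2) \<odot>\<^bsub>R\<^esub> HC.tn (tr \<beta>) (cy (e' i)))"
    unfolding T_def
  proof (intro HC.AB.finsum_cong' HOL.refl)
    fix i
    have "HC.tn (hT (e i)) (cy (e' i)) =
        (\<Oplus>\<^bsub>R\<^esub>\<beta>\<in>Rp. HC.tn (of_real (c \<beta> * pairing \<Phi> \<beta> (e i) / 2) \<odot>\<^bsub>HA\<^esub> tr \<beta>) (cy (e' i)))"
      unfolding hT_def by (rule HC.tens_finsum_l) auto
    also have "\<dots> = (\<Oplus>\<^bsub>R\<^esub>\<beta>\<in>Rp. of_real (c \<beta> * pairing \<Phi> \<beta> (e i) / 2) \<odot>\<^bsub>R\<^esub> HC.tn (tr \<beta>) (cy (e' i)))"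
      by (intro HC.AB.finsum_cong' HOL.refl) (auto intro!: HC.tens_smult_l)
    finally show "HC.tn (hT (e i)) (cy (e' i)) =
        (\<Oplus>\<^bsub>R\<^esub>\<beta>\<in>Rp. of_real (c \<beta> * pairing \<Phi> \<beta> (e i) / 2) \<odot>\<^bsub>R\<^esub> HC.tn (tr \<beta>) (cy (e' i)))" .
  qed (auto intro!: HC.AB.finsum_closed)
  also have "\<dots> = (\<Oplus>\<^bsub>R\<^esub>\<beta>\<in>Rp. \<Oplus>\<^bsub>R\<^esub>i\<in>I. of_real (c \<beta> * pairing \<Phi> \<beta> (e i) / 2) \<odot>\<^bsub>R\<^esub> HC.tn (tr \<beta>) (cy (e' i)))"
    using finite_I finite_positive by (intro HC.AB.finsum_swap) auto
  also have "\<dots> = (\<Oplus>\<^bsub>R\<^esub>\<beta>\<in>Rp. of_real (\<kappa> \<beta>) \<odot>\<^bsub>R\<^esub> u \<beta>)"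
  proof (intro HC.AB.finsum_cong' HOL.refl)
    fix \<beta> assume \<beta>: "\<beta> \<in> Rp"
    then have t: "tr \<beta> \<in> carrier HA" by auto
    have vec: "(\<Sum>i\<in>I. (c \<beta> * pairing \<Phi> \<beta> (e i) / 2) *\<^sub>R e' i) = \<kappa> \<beta> *\<^sub>R unit_coroot \<beta>"
    proof -
      have "(\<Sum>i\<in>I. (c \<beta> * pairing \<Phi> \<beta> (e i) / 2) *\<^sub>R e' i) = (c \<beta> / 2) *\<^sub>R (\<Sum>i\<in>I. pairing \<Phi> \<beta> (e i) *\<^sub>R e' i)"
        by (simp add: scaleR_sum_right)
      then show ?thesis by (simp add: sum_pairing_dual positive_roots[OF \<beta>] \<kappa>_def)
    qed
    have "(\<Oplus>\<^bsub>R\<^esub>i\<in>I. of_real (c \<beta> * pairing \<Phi> \<beta> (e i) / 2) \<odot>\<^bsub>R\<^esub> HC.tn (tr \<beta>) (cy (e' i))) =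
        (\<Oplus>\<^bsub>R\<^esub>i\<in>I. HC.tn (tr \<beta>) (of_real (c \<beta> * pairing \<Phi> \<beta> (e i) / 2) \<odot>\<^bsub>CA\<^esub> cy (e' i)))"
      using t by (intro HC.AB.finsum_cong' HOL.refl) (auto intro!: HC.tens_smult_r[symmetric])
    also have "\<dots> = HC.tn (tr \<beta>) (\<Oplus>\<^bsub>CA\<^esub>i\<in>I. of_real (c \<beta> * pairing \<Phi> \<beta> (e i) / 2) \<odot>\<^bsub>CA\<^esub> cy (e' i))"
      using t by (intro HC.tens_finsum_r[symmetric]) auto
    also have "\<dots> = HC.tn (tr \<beta>) (cy (\<kappa> \<beta> *\<^sub>R unit_coroot \<beta>))"
      by (simp only: vec[symmetric] C.Q.rlin_sum[OF rlin_cv])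
    also have "\<dots> = of_real (\<kappa> \<beta>) \<odot>\<^bsub>R\<^esub> u \<beta>"
      unfolding u_def rlin_scale[OF rlin_cv] fr_eq using t by (intro HC.tens_smult_r) auto
    finally show "(\<Oplus>\<^bsub>R\<^esub>i\<in>I. of_real (c \<beta> * pairing \<Phi> \<beta> (e i) / 2) \<odot>\<^bsub>R\<^esub> HC.tn (tr \<beta>) (cy (e' i))) =
        of_real (\<kappa> \<beta>) \<odot>\<^bsub>R\<^esub> u \<beta>" .
  qed auto
  finally show ?thesis .
qed

text \<open>Since the \<open>hx\<close> commute, adding the square to its transposed double sum
  leaves Clifford anticommutators, which are scalars. The bases are dual rather than orthonormal, so
  off-diagonal terms survive and have to be contracted.\<close>

lemma E_square:
  "E \<otimes>\<^bsub>R\<^esub> E = \<ominus>\<^bsub>R\<^esub> HC.tn (hecke_Omega \<Phi> \<Delta> c I e e') \<one>\<^bsub>CA\<^esub>"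
proof -
  let ?Om = "hecke_Omega \<Phi> \<Delta> c I e e'"
  define F where "F i j = HC.tn (hx (e i) \<otimes>\<^bsub>HA\<^esub> hx (e j)) (cy (e' i) \<otimes>\<^bsub>CA\<^esub> cy (e' j))" for i j
  define X where "X i j = hx (e i) \<otimes>\<^bsub>HA\<^esub> hx (e j)" for i j
  have X: "X i j \<in> carrier HA" for i j by (simp add: X_def)
  have F: "F i j \<in> carrier R" for i j by (simp add: F_def)
  have Om: "?Om \<in> carrier HA"
    unfolding hecke_Omega_def by (auto intro!: H.Q.finsum_closed)
  have EE: "E \<otimes>\<^bsub>R\<^esub> E = (\<Oplus>\<^bsub>R\<^esub>i\<in>I. \<Oplus>\<^bsub>R\<^esub>j\<in>I. F i j)"
    unfolding E_def F_def
    by (subst HC.AB.finsum_mult_finsum) (auto simp: finite_I HC.tens_mult)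
  also have "\<dots> = (\<Oplus>\<^bsub>R\<^esub>j\<in>I. \<Oplus>\<^bsub>R\<^esub>i\<in>I. F i j)"
    using finite_I F by (intro HC.AB.finsum_swap)
  finally have EE': "E \<otimes>\<^bsub>R\<^esub> E = (\<Oplus>\<^bsub>R\<^esub>i\<in>I. \<Oplus>\<^bsub>R\<^esub>j\<in>I. F j i)" .
  have sym: "F i j \<oplus>\<^bsub>R\<^esub> F j i = (- 2 * of_real (ip (e' i) (e' j))) \<odot>\<^bsub>R\<^esub> HC.tn (X i j) \<one>\<^bsub>CA\<^esub>" for i j
  proof -
    have "F j i = HC.tn (X i j) (cy (e' j) \<otimes>\<^bsub>CA\<^esub> cy (e' i))"
      unfolding F_def X_def by (subst hv_commute) (rule HOL.refl)
    then have "F i j \<oplus>\<^bsub>R\<^esub> F j i =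
        HC.tn (X i j) (cy (e' i) \<otimes>\<^bsub>CA\<^esub> cy (e' j) \<oplus>\<^bsub>CA\<^esub> cy (e' j) \<otimes>\<^bsub>CA\<^esub> cy (e' i))"
      using X by (simp add: F_def HC.tens_add_r flip: X_def)
    also have "\<dots> = HC.tn (X i j) ((- 2 * of_real (ip (e' i) (e' j))) \<odot>\<^bsub>CA\<^esub> \<one>\<^bsub>CA\<^esub>)"
      by (simp add: cv_anticommute cip_def complex_of_real_def)
    finally show ?thesis using X by (simp add: HC.tens_smult_r)
  qed
  \<comment> \<open>Contraction over \<open>j\<close>: the inner products of \<open>e' i\<close>
    with the \<open>e' j\<close> are its coefficients in the basis \<open>e\<close>.\<close>
  have row: "(\<Oplus>\<^bsub>R\<^esub>j\<in>I. (- 2 * of_real (ip (e' i) (e' j))) \<odot>\<^bsub>R\<^esub> HC.tn (X i j) \<one>\<^bsub>CA\<^esub>) =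
      (- 2) \<odot>\<^bsub>R\<^esub> HC.tn (hx (e i) \<otimes>\<^bsub>HA\<^esub> hx (e' i)) \<one>\<^bsub>CA\<^esub>" for i
  proof -
    have "hx (e' i) = (\<Oplus>\<^bsub>HA\<^esub>j\<in>I. of_real (ip (e' i) (e' j)) \<odot>\<^bsub>HA\<^esub> hx (e j))"
      using H.Q.rlin_sum[OF rlin_hx, of "\<lambda>j. ip (e' i) (e' j)" e I] by (simp only: dual_expand)
    then have "hx (e i) \<otimes>\<^bsub>HA\<^esub> hx (e' i) =
        (\<Oplus>\<^bsub>HA\<^esub>j\<in>I. hx (e i) \<otimes>\<^bsub>HA\<^esub> (of_real (ip (e' i) (e' j)) \<odot>\<^bsub>HA\<^esub> hx (e j)))"
      using finite_I by (simp add: H.Q.finsum_rdistr)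
    also have "\<dots> = (\<Oplus>\<^bsub>HA\<^esub>j\<in>I. of_real (ip (e' i) (e' j)) \<odot>\<^bsub>HA\<^esub> X i j)"
      by (simp add: X_def H.Q.smult_mult_r)
    finally have "HC.tn (hx (e i) \<otimes>\<^bsub>HA\<^esub> hx (e' i)) \<one>\<^bsub>CA\<^esub> =
        (\<Oplus>\<^bsub>R\<^esub>j\<in>I. of_real (ip (e' i) (e' j)) \<odot>\<^bsub>R\<^esub> HC.tn (X i j) \<one>\<^bsub>CA\<^esub>)"
      using X by (simp add: HC.tens_finsum_l HC.tens_smult_l)
    then show ?thesis
      using X by (simp add: HC.AB.finsum_smult HC.AB.smult_smult)
  qed
  have "E \<otimes>\<^bsub>R\<^esub> E \<oplus>\<^bsub>R\<^esub> E \<otimes>\<^bsub>R\<^esub> E =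
      (\<Oplus>\<^bsub>R\<^esub>i\<in>I. (\<Oplus>\<^bsub>R\<^esub>j\<in>I. F i j) \<oplus>\<^bsub>R\<^esub> (\<Oplus>\<^bsub>R\<^esub>j\<in>I. F j i))"
    using F by (subst EE, subst EE', subst HC.AB.finsum_addf) (auto intro!: HC.AB.finsum_closed)
  also have "\<dots> = (\<Oplus>\<^bsub>R\<^esub>i\<in>I. \<Oplus>\<^bsub>R\<^esub>j\<in>I. F i j \<oplus>\<^bsub>R\<^esub> F j i)"
    using F by (intro HC.AB.finsum_cong' HOL.refl HC.AB.finsum_addf[symmetric]) (auto intro!: HC.AB.finsum_closed)
  also have "\<dots> = (\<Oplus>\<^bsub>R\<^esub>i\<in>I. (- 2) \<odot>\<^bsub>R\<^esub> HC.tn (hx (e i) \<otimes>\<^bsub>HA\<^esub> hx (e' i)) \<one>\<^bsub>CA\<^esub>)"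
    by (simp only: sym row)
  also have "\<dots> = (- 2) \<odot>\<^bsub>R\<^esub> HC.tn ?Om \<one>\<^bsub>CA\<^esub>"
    unfolding hecke_Omega_def
    by (subst HC.tens_finsum_l) (auto simp: HC.AB.finsum_smult)
  finally have "E \<otimes>\<^bsub>R\<^esub> E = (- 2 / 2) \<odot>\<^bsub>R\<^esub> HC.tn ?Om \<one>\<^bsub>CA\<^esub>"
    using Om by (intro HC.AB.double_eqD) auto
  then show ?thesis using Om by (simp add: HC.AB.smult_minus_one)
qed

text \<open>The sign comes from the Clifford factor alone. Passing \<open>u \<beta>\<close> through
  reflects both factors of every summand, and the sum is invariant under that.\<close>

lemma u_D:
  assumes "\<beta> \<in> Rp"
  shows "u \<beta> \<otimes>\<^bsub>R\<^esub> D = \<ominus>\<^bsub>R\<^esub> (D \<otimes>\<^bsub>R\<^esub> u \<beta>)"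
proof -
  have \<beta>: "\<beta> \<in> roots \<Phi>" using assms by (rule positive_roots)
  have t: "tr \<beta> \<in> carrier HA" using \<beta> by auto
  let ?s = "corefl \<Phi> \<beta>"
  have "u \<beta> \<otimes>\<^bsub>R\<^esub> D = (\<Oplus>\<^bsub>R\<^esub>i\<in>I. u \<beta> \<otimes>\<^bsub>R\<^esub> HC.tn (hz (e i)) (cy (e' i)))"
    unfolding D_eq using finite_I u_mem[OF assms] by (intro HC.AB.finsum_rdistr) auto
  also have "\<dots> = (\<Oplus>\<^bsub>R\<^esub>i\<in>I. \<ominus>\<^bsub>R\<^esub> (HC.tn (hz (?s (e i))) (cy (?s (e' i))) \<otimes>\<^bsub>R\<^esub> u \<beta>))"
  proof (intro HC.AB.finsum_cong' HOL.refl)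
    fix i
    have "u \<beta> \<otimes>\<^bsub>R\<^esub> HC.tn (hz (e i)) (cy (e' i)) =
        HC.tn (tr \<beta> \<otimes>\<^bsub>HA\<^esub> hz (e i)) (fr \<beta> \<otimes>\<^bsub>CA\<^esub> cy (e' i))"
      unfolding u_def using t by (simp add: HC.tens_mult)
    also have "\<dots> = HC.tn (hz (?s (e i)) \<otimes>\<^bsub>HA\<^esub> tr \<beta>) (\<ominus>\<^bsub>CA\<^esub> (cy (?s (e' i)) \<otimes>\<^bsub>CA\<^esub> fr \<beta>))"
      by (simp only: tr_hz[OF assms] fr_cv[OF \<beta>])
    also have "\<dots> = \<ominus>\<^bsub>R\<^esub> (HC.tn (hz (?s (e i))) (cy (?s (e' i))) \<otimes>\<^bsub>R\<^esub> u \<beta>)"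
      unfolding u_def using t by (simp add: HC.tens_mult HC.tens_neg_r)
    finally show "u \<beta> \<otimes>\<^bsub>R\<^esub> HC.tn (hz (e i)) (cy (e' i)) =
        \<ominus>\<^bsub>R\<^esub> (HC.tn (hz (?s (e i))) (cy (?s (e' i))) \<otimes>\<^bsub>R\<^esub> u \<beta>)" .
  qed (use u_mem[OF assms] in auto)
  also have "\<dots> = \<ominus>\<^bsub>R\<^esub> ((\<Oplus>\<^bsub>R\<^esub>i\<in>I. HC.tn (hz (?s (e i))) (cy (?s (e' i)))) \<otimes>\<^bsub>R\<^esub> u \<beta>)"
    using finite_I u_mem[OF assms]
    by (subst HC.AB.finsum_ldistr) (auto intro!: HC.AB.finsum_neg[symmetric])
  also have "(\<Oplus>\<^bsub>R\<^esub>i\<in>I. HC.tn (hz (?s (e i))) (cy (?s (e' i)))) = D"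
    unfolding D_eq
  proof (rule HC.tens_rlin_invariance[OF rlin_hz rlin_cv finite_I linear_corefl dual_expand dual_expand'])
    show "ip (?s v) w = ip (?s w) v" for v w
      using ip_corefl_l[OF \<beta>, of v w] ip_commute by simp
    show "?s (?s v) = v" for v by (rule corefl_corefl[OF \<beta>])
  qed
  finally show ?thesis .
qed

lemma T_D: "T \<otimes>\<^bsub>R\<^esub> D = \<ominus>\<^bsub>R\<^esub> (D \<otimes>\<^bsub>R\<^esub> T)"
proof -
  have "T \<otimes>\<^bsub>R\<^esub> D = (\<Oplus>\<^bsub>R\<^esub>\<beta>\<in>Rp. (of_real (\<kappa> \<beta>) \<odot>\<^bsub>R\<^esub> u \<beta>) \<otimes>\<^bsub>R\<^esub> D)"
    unfolding T_eq using finite_positive u_mem by (intro HC.AB.finsum_ldistr) auto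
  also have "\<dots> = (\<Oplus>\<^bsub>R\<^esub>\<beta>\<in>Rp. \<ominus>\<^bsub>R\<^esub> (D \<otimes>\<^bsub>R\<^esub> (of_real (\<kappa> \<beta>) \<odot>\<^bsub>R\<^esub> u \<beta>)))"
    using u_mem
    by (intro HC.AB.finsum_cong' HOL.refl)
      (auto simp: HC.AB.smult_mult_l HC.AB.smult_mult_r u_D HC.AB.smult_minus)
  also have "\<dots> = \<ominus>\<^bsub>R\<^esub> (D \<otimes>\<^bsub>R\<^esub> T)"
    unfolding T_eq using finite_positive u_mem
    by (subst HC.AB.finsum_rdistr) (auto intro!: HC.AB.finsum_neg[symmetric])
  finally show ?thesis .
qed

text \<open>Read from the expansion of \<open>E \<otimes> E\<close> with \<open>E = D + T\<close>:
  its cross terms form the vanishing anticommutator.\<close>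

lemma D_square_eq: "D \<otimes>\<^bsub>R\<^esub> D = E \<otimes>\<^bsub>R\<^esub> E \<oplus>\<^bsub>R\<^esub> \<ominus>\<^bsub>R\<^esub> (T \<otimes>\<^bsub>R\<^esub> T)"
proof -
  have "E \<otimes>\<^bsub>R\<^esub> E = D \<otimes>\<^bsub>R\<^esub> D \<oplus>\<^bsub>R\<^esub> (T \<otimes>\<^bsub>R\<^esub> D \<oplus>\<^bsub>R\<^esub> D \<otimes>\<^bsub>R\<^esub> T) \<oplus>\<^bsub>R\<^esub> T \<otimes>\<^bsub>R\<^esub> T"
    unfolding E_split by (simp add: HC.AB.l_distr HC.AB.r_distr HC.AB.a_assoc)
  also have "T \<otimes>\<^bsub>R\<^esub> D \<oplus>\<^bsub>R\<^esub> D \<otimes>\<^bsub>R\<^esub> T = \<zero>\<^bsub>R\<^esub>"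
    unfolding T_D by (simp add: HC.AB.l_neg)
  finally show ?thesis by (simp add: HC.AB.a_assoc HC.AB.r_neg)
qed

section \<open>Cancellation in the square of \<open>T\<close>\<close>

definition pair_term where
  "pair_term p = of_real (\<kappa> (fst p) * \<kappa> (snd p)) \<odot>\<^bsub>R\<^esub>
     HC.tn (tr (fst p) \<otimes>\<^bsub>HA\<^esub> tr (snd p)) (fr (fst p) \<otimes>\<^bsub>CA\<^esub> fr (snd p))"

lemma pair_term_mem: "p \<in> Rp \<times> Rp \<Longrightarrow> pair_term p \<in> carrier R"
  unfolding pair_term_def
  by (auto intro!: HC.AB.smult_closed HC.tens_mem H.Q.m_closed tr_positive_mem)

lemma T_square: "T \<otimes>\<^bsub>R\<^esub> T = (\<Oplus>\<^bsub>R\<^esub>p\<in>Rp \<times> Rp. pair_term p)"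
proof -
  have "T \<otimes>\<^bsub>R\<^esub> T = (\<Oplus>\<^bsub>R\<^esub>\<alpha>\<in>Rp. \<Oplus>\<^bsub>R\<^esub>\<beta>\<in>Rp. (of_real (\<kappa> \<alpha>) \<odot>\<^bsub>R\<^esub> u \<alpha>) \<otimes>\<^bsub>R\<^esub> (of_real (\<kappa> \<beta>) \<odot>\<^bsub>R\<^esub> u \<beta>))"
    unfolding T_eq using finite_positive u_mem by (intro HC.AB.finsum_mult_finsum) auto
  also have "\<dots> = (\<Oplus>\<^bsub>R\<^esub>p\<in>Rp \<times> Rp. (of_real (\<kappa> (fst p)) \<odot>\<^bsub>R\<^esub> u (fst p)) \<otimes>\<^bsub>R\<^esub> (of_real (\<kappa> (snd p)) \<odot>\<^bsub>R\<^esub> u (snd p)))"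
    using finite_positive u_mem
    by (intro HC.AB.finsum_product_set[where f = "\<lambda>\<alpha> \<beta>. (of_real (\<kappa> \<alpha>) \<odot>\<^bsub>R\<^esub> u \<alpha>) \<otimes>\<^bsub>R\<^esub> (of_real (\<kappa> \<beta>) \<odot>\<^bsub>R\<^esub> u \<beta>)"]) auto
  also have "\<dots> = (\<Oplus>\<^bsub>R\<^esub>p\<in>Rp \<times> Rp. pair_term p)"
  proof (intro HC.AB.finsum_cong' HOL.refl)
    fix p assume "p \<in> Rp \<times> Rp"
    then have m: "u (fst p) \<in> carrier R" "u (snd p) \<in> carrier R"
      "tr (fst p) \<in> carrier HA" "tr (snd p) \<in> carrier HA" using u_mem by auto
    then have "(of_real (\<kappa> (fst p)) \<odot>\<^bsub>R\<^esub> u (fst p)) \<otimes>\<^bsub>R\<^esub> (of_real (\<kappa> (snd p)) \<odot>\<^bsub>R\<^esub> u (snd p)) =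
        of_real (\<kappa> (fst p) * \<kappa> (snd p)) \<odot>\<^bsub>R\<^esub> (u (fst p) \<otimes>\<^bsub>R\<^esub> u (snd p))"
      by (simp add: HC.AB.smult_mult_l HC.AB.smult_mult_r HC.AB.smult_smult mult.commute)
    then show "(of_real (\<kappa> (fst p)) \<odot>\<^bsub>R\<^esub> u (fst p)) \<otimes>\<^bsub>R\<^esub> (of_real (\<kappa> (snd p)) \<odot>\<^bsub>R\<^esub> u (snd p)) = pair_term p"
      using m(3,4) unfolding pair_term_def u_def by (simp add: HC.tens_mult)
  qed (use pair_term_mem in auto)
  finally show ?thesis .
qed

lemma pair_term_refl:
  assumes "\<alpha> \<in> Rp" "\<beta> \<in> Rp" "refl \<Phi> \<alpha> \<beta> \<in> Rp"
  shows "pair_term (refl \<Phi> \<alpha> \<beta>, \<alpha>) = \<ominus>\<^bsub>R\<^esub> pair_term (\<alpha>, \<beta>)"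
proof -
  have r: "\<alpha> \<in> roots \<Phi>" "\<beta> \<in> roots \<Phi>" using assms positive_roots by auto
  let ?g = "refl \<Phi> \<alpha> \<beta>"
  have m: "tr \<alpha> \<in> carrier HA" "tr \<beta> \<in> carrier HA" "tr ?g \<in> carrier HA"
    using assms by auto
  have "\<kappa> ?g = \<kappa> \<beta>" using r by (simp add: \<kappa>_def c_refl root_norm_refl)
  moreover have "HC.tn (tr \<alpha> \<otimes>\<^bsub>HA\<^esub> tr \<beta>) (fr \<alpha> \<otimes>\<^bsub>CA\<^esub> fr \<beta>) =
      \<ominus>\<^bsub>R\<^esub> HC.tn (tr ?g \<otimes>\<^bsub>HA\<^esub> tr \<alpha>) (fr ?g \<otimes>\<^bsub>CA\<^esub> fr \<alpha>)"
    unfolding tr_tr[OF r] fr_fr[OF r] using m by (simp add: HC.tens_neg_r)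
  ultimately show ?thesis
    unfolding pair_term_def using m by (simp add: HC.AB.smult_minus mult.commute)
qed

definition positive_pairs where
  "positive_pairs = {p \<in> Rp \<times> Rp. refl \<Phi> (fst p) (snd p) \<in> Rp}"

definition negative_pairs where
  "negative_pairs = {(\<alpha>, \<beta>). \<alpha> \<in> Rp \<and> \<beta> \<in> Rp \<and> - refl \<Phi> \<alpha> \<beta> \<in> Rp}"

text \<open>Both branches of the swap preserve the product \<open>t\<^sub>\<alpha> t\<^sub>\<beta>\<close> and reverse the sign of
  \<open>f\<^sub>\<alpha> f\<^sub>\<beta>\<close>; the branch is chosen by the sign of \<open>\<langle>\<alpha>, \<beta>\<rangle>\<close> so that the result is again a pair of
  positive roots with positive reflection.\<close>

definition swap_pair where
  "swap_pair p = (if 0 \<le> pairing \<Phi> (snd p) (coroot \<Phi> (fst p))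
     then (refl \<Phi> (fst p) (snd p), fst p) else (snd p, refl \<Phi> (snd p) (fst p)))"

text \<open>In either branch the root that must be positive is a positive root plus a nonnegative
  multiple of another. The pairing that selects the branch changes sign under the swap, so a second
  swap uses the other branch and undoes the first.\<close>

lemma swap_pair_properties:
  assumes "p \<in> positive_pairs"
  shows "swap_pair p \<in> positive_pairs" "swap_pair (swap_pair p) = p"
    "pair_term (swap_pair p) = \<ominus>\<^bsub>R\<^esub> pair_term p"
proof -
  obtain \<alpha> \<beta> where p: "p = (\<alpha>, \<beta>)" by (cases p)
  have \<alpha>\<beta>: "\<alpha> \<in> Rp" "\<beta> \<in> Rp" "refl \<Phi> \<alpha> \<beta> \<in> Rp"
    using assms by (auto simp: positive_pairs_def p)
  have r: "\<alpha> \<in> roots \<Phi>" "\<beta> \<in> roots \<Phi>" using \<alpha>\<beta> positive_roots by auto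
  have sym: "0 < pairing \<Phi> \<alpha> (coroot \<Phi> \<beta>) \<longleftrightarrow> 0 < pairing \<Phi> \<beta> (coroot \<Phi> \<alpha>)"
    by (rule pairing_coroot_pos_iff[OF r])
  have sym0: "pairing \<Phi> \<alpha> (coroot \<Phi> \<beta>) = 0 \<longleftrightarrow> pairing \<Phi> \<beta> (coroot \<Phi> \<alpha>) = 0"
    using pairing_coroot_zero_iff[OF r] .
  have "swap_pair p \<in> positive_pairs \<and> swap_pair (swap_pair p) = p \<and>
      pair_term (swap_pair p) = \<ominus>\<^bsub>R\<^esub> pair_term p"
  proof (cases "0 \<le> pairing \<Phi> \<beta> (coroot \<Phi> \<alpha>)")
    case True
    define \<gamma> where "\<gamma> = refl \<Phi> \<alpha> \<beta>"
    have \<gamma>: "\<gamma> \<in> Rp" "\<gamma> \<in> roots \<Phi>" using \<alpha>\<beta>(3) positive_roots by (auto simp: \<gamma>_def)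
    have swap: "swap_pair p = (\<gamma>, \<alpha>)" using True by (simp add: swap_pair_def p \<gamma>_def)
    \<comment> \<open>The sign change that sends the second swap into the other branch.\<close>
    have pr: "pairing \<Phi> \<alpha> (coroot \<Phi> \<gamma>) = - pairing \<Phi> \<alpha> (coroot \<Phi> \<beta>)"
      unfolding \<gamma>_def using r
      by (simp add: coroot_refl pairing_corefl refl_self linear_neg[OF linear_pairing_l])
    have nonneg: "0 \<le> pairing \<Phi> \<alpha> (coroot \<Phi> \<beta>)" using True sym sym0 by linarith
    have "refl \<Phi> \<gamma> \<alpha> = \<alpha> + pairing \<Phi> \<alpha> (coroot \<Phi> \<beta>) *\<^sub>R \<gamma>"
      by (simp add: refl_def[of _ \<gamma>] pr)
    then have "refl \<Phi> \<gamma> \<alpha> \<in> Rp"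
      using positive_combination[OF refl_mem[OF \<gamma>(2) r(1)] _ \<alpha>\<beta>(1) \<gamma>(1) nonneg] by blast
    then have mem: "swap_pair p \<in> positive_pairs"
      using \<gamma> \<alpha>\<beta> by (simp add: swap positive_pairs_def)
    have "swap_pair (\<gamma>, \<alpha>) = (\<alpha>, \<beta>)"
    \<comment> \<open>For orthogonal roots both swaps take the first branch, where the reflections
      are trivial and the swap merely exchanges the entries.\<close>
    proof (cases "pairing \<Phi> \<alpha> (coroot \<Phi> \<beta>) = 0")
      case True
      then have "\<gamma> = \<beta>" using sym0 by (simp add: \<gamma>_def refl_def)
      moreover have "refl \<Phi> \<beta> \<alpha> = \<alpha>" using True by (simp add: refl_def)
      ultimately show ?thesis using True by (simp add: swap_pair_def)
    next
      case False
      then show ?thesis using nonneg pr r by (simp add: swap_pair_def \<gamma>_def refl_refl)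
    qed
    then show ?thesis
      using mem pair_term_refl[OF \<alpha>\<beta>] unfolding swap unfolding p \<gamma>_def by simp
  next
    case False
    define \<delta> where "\<delta> = refl \<Phi> \<beta> \<alpha>"
    have swap: "swap_pair p = (\<beta>, \<delta>)" using False by (simp add: swap_pair_def p \<delta>_def)
    have neg: "pairing \<Phi> \<alpha> (coroot \<Phi> \<beta>) < 0" using False sym sym0 by linarith
    have invol: "refl \<Phi> \<beta> \<delta> = \<alpha>" unfolding \<delta>_def by (rule refl_refl[OF r(2)])
    have "\<delta> = \<alpha> + (- pairing \<Phi> \<alpha> (coroot \<Phi> \<beta>)) *\<^sub>R \<beta>" by (simp add: \<delta>_def refl_def)
    moreover have "\<delta> \<in> roots \<Phi>" unfolding \<delta>_def using r by (intro refl_mem)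
    ultimately have \<delta>: "\<delta> \<in> Rp"
      using positive_combination[OF _ _ \<alpha>\<beta>(1,2)] neg by (metis less_eq_real_def neg_0_le_iff_le)
    have "pairing \<Phi> \<delta> (coroot \<Phi> \<beta>) = - pairing \<Phi> \<alpha> (coroot \<Phi> \<beta>)"
      unfolding \<delta>_def using r
      by (simp add: corefl_coroot linear_neg[OF linear_pairing_r] flip: pairing_corefl)
    then have back_swap: "swap_pair (\<beta>, \<delta>) = (\<alpha>, \<beta>)"
      using neg by (simp add: swap_pair_def invol)
    \<comment> \<open>The cancellation identity is used backwards here, from the new pair to the old
      one.\<close>
    have "pair_term (\<alpha>, \<beta>) = \<ominus>\<^bsub>R\<^esub> pair_term (\<beta>, \<delta>)"
      using pair_term_refl[of \<beta> \<delta>] \<alpha>\<beta> \<delta> by (simp add: invol)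
    then have "pair_term (\<beta>, \<delta>) = \<ominus>\<^bsub>R\<^esub> pair_term (\<alpha>, \<beta>)"
      using pair_term_mem[of "(\<beta>, \<delta>)"] \<alpha>\<beta> \<delta> by simp
    then show ?thesis
      using \<alpha>\<beta> \<delta> unfolding swap unfolding p by (simp add: back_swap positive_pairs_def invol)
  qed
  then show "swap_pair p \<in> positive_pairs" "swap_pair (swap_pair p) = p"
    "pair_term (swap_pair p) = \<ominus>\<^bsub>R\<^esub> pair_term p" by auto
qed

text \<open>Reindexing by the sign-reversing involution equates the sum with its own
  negative.\<close>

lemma sum_positive_pairs: "(\<Oplus>\<^bsub>R\<^esub>p\<in>positive_pairs. pair_term p) = \<zero>\<^bsub>R\<^esub>"
proof (rule HC.AB.eq_neg_imp_zero)
  have sub: "positive_pairs \<subseteq> Rp \<times> Rp" by (auto simp: positive_pairs_def)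
  then have mem: "pair_term \<in> positive_pairs \<rightarrow> carrier R" using pair_term_mem by auto
  then show "(\<Oplus>\<^bsub>R\<^esub>p\<in>positive_pairs. pair_term p) \<in> carrier R" by (rule HC.AB.finsum_closed)
  have img: "swap_pair ` positive_pairs = positive_pairs"
    using swap_pair_properties by (metis (no_types, lifting) image_eqI image_subsetI subsetI subset_antisym)
  have "(\<Oplus>\<^bsub>R\<^esub>p\<in>positive_pairs. pair_term p) = (\<Oplus>\<^bsub>R\<^esub>p\<in>swap_pair ` positive_pairs. pair_term p)"
    by (simp only: img)
  also have "\<dots> = (\<Oplus>\<^bsub>R\<^esub>p\<in>positive_pairs. pair_term (swap_pair p))"
  proof (rule HC.AB.finsum_reindex)
    show "inj_on swap_pair positive_pairs"
      by (rule inj_on_inverseI[of _ swap_pair]) (rule swap_pair_properties(2))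
  qed (simp only: img mem)
  also have "\<dots> = (\<Oplus>\<^bsub>R\<^esub>p\<in>positive_pairs. \<ominus>\<^bsub>R\<^esub> pair_term p)"
    using mem by (intro HC.AB.finsum_cong' HOL.refl) (auto simp: swap_pair_properties(3))
  also have "\<dots> = \<ominus>\<^bsub>R\<^esub> (\<Oplus>\<^bsub>R\<^esub>p\<in>positive_pairs. pair_term p)"
    by (rule HC.AB.finsum_neg[OF mem, symmetric])
  finally show "(\<Oplus>\<^bsub>R\<^esub>p\<in>positive_pairs. pair_term p) = \<ominus>\<^bsub>R\<^esub> (\<Oplus>\<^bsub>R\<^esub>p\<in>positive_pairs. pair_term p)" .
qed

lemma finite_negative_pairs: "finite negative_pairs"
  by (rule finite_subset[of _ "Rp \<times> Rp"]) (auto simp: negative_pairs_def finite_positive)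

lemma T_square_negative: "T \<otimes>\<^bsub>R\<^esub> T = (\<Oplus>\<^bsub>R\<^esub>p\<in>negative_pairs. pair_term p)"
proof -
  have "refl \<Phi> \<alpha> \<beta> \<in> roots \<Phi>" if "\<alpha> \<in> Rp" "\<beta> \<in> Rp" for \<alpha> \<beta>
    using that positive_roots refl_mem by blast
  then have split: "Rp \<times> Rp = positive_pairs \<union> negative_pairs" "positive_pairs \<inter> negative_pairs = {}"
    by (auto simp: positive_pairs_def negative_pairs_def neg_positive_iff)
  then have fin: "finite positive_pairs" "finite negative_pairs"
    using finite_positive by (metis finite_Un finite_cartesian_product)+
  have mem: "pair_term \<in> positive_pairs \<rightarrow> carrier R" "pair_term \<in> negative_pairs \<rightarrow> carrier R"
    using pair_term_mem split(1) by auto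
  have "T \<otimes>\<^bsub>R\<^esub> T = (\<Oplus>\<^bsub>R\<^esub>p\<in>positive_pairs. pair_term p) \<oplus>\<^bsub>R\<^esub> (\<Oplus>\<^bsub>R\<^esub>p\<in>negative_pairs. pair_term p)"
    unfolding T_square split(1) by (rule HC.AB.finsum_Un_disjoint[OF fin split(2) mem])
  then show ?thesis
    using HC.AB.finsum_closed[OF mem(2)] by (simp add: sum_positive_pairs)
qed

text \<open>The pairs left in the square of \<open>T\<close> are those of
  \<open>Omega_cover\<close>. The projection of a product of two roots is the product of their
  reflections, and the coefficients are the negatives of those in \<open>pair_term\<close>.\<close>

lemma rho_Omega_cover:
  "rho \<Phi> \<Delta> c ip (Omega_cover \<Phi> Rp c ip I e e') = \<ominus>\<^bsub>R\<^esub> (T \<otimes>\<^bsub>R\<^esub> T)"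
proof -
  let ?n = "root_norm \<Phi> I e e'"
  define G where "G a = HC.tn (ht (weyl_cover_proj \<Phi> ip a)) a" for a
  define k where "k p = complex_of_real (c (fst p) * c (snd p) * ?n (fst p) * ?n (snd p))" for p
  define a where "a p = fr (fst p) \<otimes>\<^bsub>CA\<^esub> fr (snd p)" for p
  have mem: "p \<in> Rp \<times> Rp" if "p \<in> negative_pairs" for p
    using that by (auto simp: negative_pairs_def)
  have G: "G (a p) = HC.tn (tr (fst p) \<otimes>\<^bsub>HA\<^esub> tr (snd p)) (a p)" if "p \<in> negative_pairs" for p
  proof -
    have "fst p \<in> roots \<Phi>" "snd p \<in> roots \<Phi>" using mem[OF that] positive_roots by auto
    then show ?thesis
      by (simp add: G_def a_def weyl_cover_proj_fr_fr clifford_one_neq_zero ht_mult corefl_weyl)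
  qed
  have Gm: "G (a p) \<in> carrier R" if "p \<in> negative_pairs" for p
    unfolding G[OF that] unfolding a_def using mem[OF that]
    by (auto intro!: HC.tens_mem H.Q.m_closed tr_positive_mem)
  have "Omega_cover \<Phi> Rp c ip I e e' = Poly_Mapping.map ((*) (- 1/4))
      (\<Sum>p\<in>negative_pairs. Poly_Mapping.single (a p) (k p))"
    \<comment> \<open>\<open>negative_pairs\<close> repeats the index set literally, so it folds;
      basis elements of the group algebra multiply by Clifford multiplication of their
      labels.\<close>
    unfolding Omega_cover_def negative_pairs_def[symmetric]
    by (simp add: case_prod_unfold a_def k_def weyl_cover_def)
  also have "\<dots> = (\<Sum>p\<in>negative_pairs. Poly_Mapping.single (a p) (- k p / 4))"
    by (rule lin_ext_eqI) (simp add: lin_ext_map lin_ext_sum sum_distrib_left)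
  finally have Om: "Omega_cover \<Phi> Rp c ip I e e' = (\<Sum>p\<in>negative_pairs. Poly_Mapping.single (a p) (- k p / 4))" .
  have "rho \<Phi> \<Delta> c ip (Omega_cover \<Phi> Rp c ip I e e') = HC.AB.lin_comb G (Omega_cover \<Phi> Rp c ip I e e')"
    by (simp add: rho_def HC.AB.lin_comb_def G_def)
  also have "\<dots> = (\<Oplus>\<^bsub>R\<^esub>p\<in>negative_pairs. (- k p / 4) \<odot>\<^bsub>R\<^esub> G (a p))"
    unfolding Om using finite_negative_pairs Gm by (rule HC.AB.lin_comb_sum)
  also have "\<dots> = (\<Oplus>\<^bsub>R\<^esub>p\<in>negative_pairs. \<ominus>\<^bsub>R\<^esub> pair_term p)"
  proof (intro HC.AB.finsum_cong' HOL.refl)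
    fix p assume p: "p \<in> negative_pairs"
    have "- k p / 4 = - of_real (\<kappa> (fst p) * \<kappa> (snd p))" by (simp add: k_def \<kappa>_def)
    then have "(- k p / 4) \<odot>\<^bsub>R\<^esub> G (a p) = \<ominus>\<^bsub>R\<^esub> (of_real (\<kappa> (fst p) * \<kappa> (snd p)) \<odot>\<^bsub>R\<^esub> G (a p))"
      using HC.AB.smult_uminus[OF Gm[OF p]] by simp
    then show "(- k p / 4) \<odot>\<^bsub>R\<^esub> G (a p) = \<ominus>\<^bsub>R\<^esub> pair_term p"
      unfolding pair_term_def G[OF p] unfolding a_def .
  qed (use mem pair_term_mem in auto)
  also have "\<dots> = \<ominus>\<^bsub>R\<^esub> (T \<otimes>\<^bsub>R\<^esub> T)"
    unfolding T_square_negative using mem pair_term_mem by (intro HC.AB.finsum_neg[symmetric]) auto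
  finally show ?thesis .
qed

lemma dirac_square:
  "dirac \<Phi> Rp \<Delta> c ip I e e' [^]\<^bsub>R\<^esub> (2::nat) =
    (\<ominus>\<^bsub>R\<^esub> HC.tn (hecke_Omega \<Phi> \<Delta> c I e e') \<one>\<^bsub>CA\<^esub>)
    \<oplus>\<^bsub>R\<^esub> rho \<Phi> \<Delta> c ip (Omega_cover \<Phi> Rp c ip I e e')"
proof -
  have "D [^]\<^bsub>R\<^esub> (2::nat) = D \<otimes>\<^bsub>R\<^esub> D"
    by (simp add: numeral_2_eq_2)
  then show ?thesis
    by (simp only: D_square_eq E_square rho_Omega_cover flip: D_def)
qed

end

theorem theorem3p5:
  fixes \<Phi> :: "('a::real_vector, 'b::real_vector) root_datum"
    and Rp \<Delta> :: "'a set"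
    and c :: "'a \<Rightarrow> real"
    and ip :: "'b \<Rightarrow> 'b \<Rightarrow> real"
    and I :: "'i set"
    and e e' :: "'i \<Rightarrow> 'b"
  assumes "reduced_root_system \<Phi>"
    and "positive_roots_with_simple \<Phi> Rp \<Delta>"
    and "weyl_invariant_parameter \<Phi> c"
    and "weyl_invariant_inner_product \<Phi> ip"
    and "dual_bases ip I e e'"
  shows "dirac \<Phi> Rp \<Delta> c ip I e e' [^]\<^bsub>hecke_clifford \<Phi> \<Delta> c ip\<^esub> (2::nat) =
    (\<ominus>\<^bsub>hecke_clifford \<Phi> \<Delta> c ip\<^esub>
       tens (hecke \<Phi> \<Delta> c) (clifford ip) (hecke_Omega \<Phi> \<Delta> c I e e') \<one>\<^bsub>clifford ip\<^esub>)
    \<oplus>\<^bsub>hecke_clifford \<Phi> \<Delta> c ip\<^esub> rho \<Phi> \<Delta> c ip (Omega_cover \<Phi> Rp c ip I e e')"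
proof -
  interpret dirac_setup \<Phi> Rp \<Delta> c ip I e e'
    using assms by unfold_locales
  show ?thesis by (rule dirac_square)
qed

end
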